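(* Let $G$ be a topological group and let $0<p<q<\infty$. Then for every continuous affine isometric action $\alpha$ of $G$ on an $L_p$ space, there exists a continuous affine isometric action $\beta$ of $G$ on an $L_q$ space such that $\|\alpha_g(0)\|_{L_p}^p=\|\beta_g(0)\|_{L_q}^q$ for all $g\in G$.
   Context: An "$L_p$ space" means $L_p(X,\mu)$ for a $\sigma$-finite standard measure space $(X,\mu)$ (complex-valued functions). For $p\ge 1$ it carries the norm $\|f\|_{L_p}=(\int|f|^p\,d\mu)^{1/p}$; for $0<p<1$ it carries the metric $d(f,f')=\|f-f'\|_{L_p}^p=\int|f-f'|^p\,d\mu$, and "isometry" refers to this metric. An affine isometric action of $G$ on $L_p$ is a homomorphism $g\mapsto\alpha_g$ into the group of affine isometries $f\mapsto \pi(g)f+c(g)$ (with $\pi(g)$ a linear isometry); it is continuous if $g\mapsto \alpha_g(f)$ is continuous for every $f$. *)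

theory Defs
  imports "HOL-Analysis.Analysis" "HOL-Algebra.Group"
begin

definition topological_group :: "('g, 'm) monoid_scheme \<Rightarrow> 'g topology \<Rightarrow> bool" where
  "topological_group G T \<longleftrightarrow>
     group G \<and> topspace T = carrier G \<and>
     continuous_map (prod_topology T T) T (\<lambda>(x, y). x \<otimes>\<^bsub>G\<^esub> y) \<and>
     continuous_map T T (\<lambda>x. inv\<^bsub>G\<^esub> x)"

definition standard_measure_space :: "'a::polish_space measure \<Rightarrow> bool" where
  "standard_measure_space M \<longleftrightarrow>
     space M \<in> sets borel \<and>
     sets M = sets (restrict_space borel (space M)) \<and>
     sigma_finite_measure M"

section \<open>L_p spaces (complex valued), elements represented by functions modulo a.e. equality\<close>

definition Lp_space :: "'a measure \<Rightarrow> real \<Rightarrow> ('a \<Rightarrow> complex) set" where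
  "Lp_space M p = {f \<in> borel_measurable M. (\<integral>\<^sup>+ x. ennreal (cmod (f x) powr p) \<partial>M) < \<infinity>}"

definition Lp_int :: "'a measure \<Rightarrow> real \<Rightarrow> ('a \<Rightarrow> complex) \<Rightarrow> real" where
  "Lp_int M p f = enn2real (\<integral>\<^sup>+ x. ennreal (cmod (f x) powr p) \<partial>M)"

definition Lp_dist :: "'a measure \<Rightarrow> real \<Rightarrow> ('a \<Rightarrow> complex) \<Rightarrow> ('a \<Rightarrow> complex) \<Rightarrow> real" where
  "Lp_dist M p f f' =
     (if p < 1 then Lp_int M p (\<lambda>x. f x - f' x)
      else Lp_int M p (\<lambda>x. f x - f' x) powr (1 / p))"

definition Lp_eq :: "'a measure \<Rightarrow> ('a \<Rightarrow> complex) \<Rightarrow> ('a \<Rightarrow> complex) \<Rightarrow> bool" where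
  "Lp_eq M f f' \<longleftrightarrow> (AE x in M. f x = f' x)"

definition Lp_linear_isometry :: "'a measure \<Rightarrow> real \<Rightarrow> (('a \<Rightarrow> complex) \<Rightarrow> ('a \<Rightarrow> complex)) \<Rightarrow> bool" where
  "Lp_linear_isometry M p P \<longleftrightarrow>
     (\<forall>f\<in>Lp_space M p. P f \<in> Lp_space M p) \<and>
     (\<forall>f\<in>Lp_space M p. \<forall>f'\<in>Lp_space M p. Lp_eq M f f' \<longrightarrow> Lp_eq M (P f) (P f')) \<and>
     (\<forall>f\<in>Lp_space M p. \<forall>f'\<in>Lp_space M p. Lp_eq M (P (\<lambda>x. f x + f' x)) (\<lambda>x. P f x + P f' x)) \<and>
     (\<forall>f\<in>Lp_space M p. \<forall>a::complex. Lp_eq M (P (\<lambda>x. a * f x)) (\<lambda>x. a * P f x)) \<and>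
     (\<forall>f\<in>Lp_space M p. \<forall>f'\<in>Lp_space M p. Lp_dist M p (P f) (P f') = Lp_dist M p f f') \<and>
     (\<forall>h\<in>Lp_space M p. \<exists>f\<in>Lp_space M p. Lp_eq M (P f) h)"

definition Lp_affine_isometry :: "'a measure \<Rightarrow> real \<Rightarrow> (('a \<Rightarrow> complex) \<Rightarrow> ('a \<Rightarrow> complex)) \<Rightarrow> bool" where
  "Lp_affine_isometry M p A \<longleftrightarrow>
     (\<forall>f\<in>Lp_space M p. A f \<in> Lp_space M p) \<and>
     (\<forall>f\<in>Lp_space M p. \<forall>f'\<in>Lp_space M p. Lp_eq M f f' \<longrightarrow> Lp_eq M (A f) (A f')) \<and>
     (\<exists>P c. Lp_linear_isometry M p P \<and> c \<in> Lp_space M p \<and>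
        (\<forall>f\<in>Lp_space M p. Lp_eq M (A f) (\<lambda>x. P f x + c x)))"

definition cont_affine_isometric_action ::
  "('g, 'm) monoid_scheme \<Rightarrow> 'g topology \<Rightarrow> 'a measure \<Rightarrow> real \<Rightarrow>
   ('g \<Rightarrow> ('a \<Rightarrow> complex) \<Rightarrow> ('a \<Rightarrow> complex)) \<Rightarrow> bool" where
  "cont_affine_isometric_action G T M p \<alpha> \<longleftrightarrow>
     (\<forall>g\<in>carrier G. Lp_affine_isometry M p (\<alpha> g)) \<and>
     (\<forall>f\<in>Lp_space M p. Lp_eq M (\<alpha> \<one>\<^bsub>G\<^esub> f) f) \<and>
     (\<forall>g\<in>carrier G. \<forall>h\<in>carrier G. \<forall>f\<in>Lp_space M p.
        Lp_eq M (\<alpha> (g \<otimes>\<^bsub>G\<^esub> h) f) (\<alpha> g (\<alpha> h f))) \<and>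
     (\<forall>f\<in>Lp_space M p. \<forall>g0\<in>carrier G. \<forall>e>0. \<exists>U. openin T U \<and> g0 \<in> U \<and>
        (\<forall>g\<in>U. Lp_dist M p (\<alpha> g f) (\<alpha> g0 f) < e))"

end

theory Submission
  imports Defs "HOL-Probability.Probability"
begin

text \<open>
  Suppose that \<open>\<xi>\<close> sends \<open>L_p(M)\<close> additively to real functions on a measure space \<open>Y\<close> such that
  \<open>E f = exp(i \<xi> f) - 1\<close> satisfies \<open>\<parallel>E f - E g\<parallel>_q^q = \<parallel>f - g\<parallel>_p^p\<close> and such that every linear isometry
  of \<open>L_p(M)\<close> preserves the \<open>L_q\<close> norms of the combinations of the \<open>exp(i \<xi> f)\<close> with coefficient sum 0.
  Restrict \<open>Y\<close> to the \<open>\<sigma>\<close>-algebra generated by the \<open>E f\<close>, where the span of the \<open>E f\<close>, being an algebra,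
  is dense in \<open>L_q\<close>. Then \<open>E f \<mapsto> E (\<alpha>_g f)\<close> extends uniquely to an affine isometry \<open>\<beta>_g\<close>, so the \<open>\<beta>_g\<close> form an
  action, and \<open>\<beta>_g 0 = E (\<alpha>_g 0)\<close>.

  For \<open>p \<noteq> 2\<close> take \<open>Y = M \<times> \<complex>\<close> with the measure \<open>|z|^(-2-p) dz\<close> on the second factor and
  \<open>\<xi> f (x, z) = Re (z f(x))\<close>. As linear isometries preserve disjointness of supports, the invariance holds
  on simple functions by homogeneity of that measure, and in general by density.

  For \<open>p = 2\<close> take \<open>Y = \<Omega> \<times> (0, \<infinity>)\<close> with \<open>dt / t^3\<close> on the second factor and \<open>\<xi> f (\<omega>, t) = t \<gamma> f (\<omega>)\<close> for the
  Gaussian field \<open>\<gamma>\<close> indexed by \<open>L_2(M)\<close>. For fixed \<open>t\<close> the even moments of a combination depend only on the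
  norms \<open>\<parallel>f\<parallel>_2\<close>, and these moments determine its \<open>L_q\<close> norm.
\<close>

section \<open>Lp spaces\<close>

text \<open>Analytically, \<open>p < q\<close> serves one purpose: the integral of
  \<open>|exp(i t) - 1|^q t^(-1-p)\<close> must converge at 0. On an infinite measure space a phase
  of modulus 1 is not in L_q; hence the subtraction of 1 and the restriction to coefficient sum 0. A
  translation of L_p multiplies all phases by one unimodular function, so only linear isometries
  need an invariance argument. The exponent 2 is the obstacle that splits the proof: the
  parallelogram law is an equality there, a unitary may mix disjoint supports, and the product with
  the plane loses its symmetry. The law of a Gaussian field depends on norms alone and has exactly
  the missing symmetry. A second obstacle is the target. The auxiliary space need not be standard,
  nor sigma-finite for the generated sigma-algebra. So countably many phases are coded into one real
  function, and the measure is moved to the real line, less the part where all of them are 1. Below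
  exponent 1 there is no norm and possibly no nonzero dual, so all estimates use integrals of p-th
  powers and a quasi-triangle inequality.\<close>

lemma norm_add_powr_le:
  fixes a b :: complex
  assumes "0 < p"
  shows "cmod (a + b) powr p \<le> 2 powr p * (cmod a powr p + cmod b powr p)"
proof -
  define m where "m = max (cmod a) (cmod b)"
  have "cmod (a + b) \<le> 2 * m"
    using norm_triangle_ineq[of a b] by (auto simp: m_def)
  then have "cmod (a + b) powr p \<le> (2 * m) powr p"
    using assms by (intro powr_mono2) auto
  also have "\<dots> = 2 powr p * m powr p"
    by (simp add: powr_mult m_def)
  also have "m powr p \<le> cmod a powr p + cmod b powr p"
    by (auto simp: m_def max_def)
  finally show ?thesis by simp
qed

text \<open>The factor \<open>2 powr p\<close> of the plain quasi-triangle inequality is too coarse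
  to prove that \<open>Lp_int\<close> is continuous. Here the constant at \<open>a\<close> is as
  close to 1 as desired, at the price of a large \<open>C\<close>: either \<open>b\<close> is small
  against \<open>a\<close> and is absorbed, or \<open>a\<close> is bounded by a multiple of
  \<open>b\<close>.\<close>

lemma norm_add_powr_le_eps:
  assumes "0 < p" "0 < e"
  obtains C where "0 \<le> C"
    "\<And>a b :: complex. cmod (a + b) powr p \<le> (1 + e) * cmod a powr p + C * cmod b powr p"
proof -
  define d where "d = (1 + e) powr (1 / p) - 1"
  have d: "0 < d" "(1 + d) powr p = 1 + e"
    using assms by (auto simp: d_def powr_powr)
  define C where "C = (1 + 1 / d) powr p"
  have "cmod (a + b) powr p \<le> (1 + e) * cmod a powr p + C * cmod b powr p" for a b :: complex
  proof (cases "cmod b \<le> d * cmod a")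
    case True
    then have "cmod (a + b) \<le> (1 + d) * cmod a"
      using norm_triangle_ineq[of a b] by (simp add: algebra_simps)
    then have "cmod (a + b) powr p \<le> ((1 + d) * cmod a) powr p"
      using assms by (intro powr_mono2) auto
    also have "\<dots> = (1 + e) * cmod a powr p"
      using d by (simp add: powr_mult)
    finally show ?thesis by (simp add: C_def add_increasing2)
  next
    case False
    then have "cmod a \<le> cmod b / d"
      using d by (simp add: field_simps)
    then have "cmod (a + b) \<le> (1 + 1 / d) * cmod b"
      using norm_triangle_ineq[of a b] by (simp add: algebra_simps)
    then have "cmod (a + b) powr p \<le> ((1 + 1 / d) * cmod b) powr p"
      using assms by (intro powr_mono2) auto
    also have "\<dots> = C * cmod b powr p"
      using d by (simp add: powr_mult C_def)
    finally show ?thesis using assms by (simp add: add_increasing)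
  qed
  moreover have "0 \<le> C" by (simp add: C_def)
  ultimately show ?thesis using that by blast
qed

lemma Lp_spaceI:
  "f \<in> borel_measurable M \<Longrightarrow> (\<integral>\<^sup>+ x. ennreal (cmod (f x) powr p) \<partial>M) < \<infinity> \<Longrightarrow> f \<in> Lp_space M p"
  by (simp add: Lp_space_def)

lemma Lp_space_measurable [measurable_dest]: "f \<in> Lp_space M p \<Longrightarrow> f \<in> borel_measurable M"
  by (simp add: Lp_space_def)

lemma Lp_int_eq_nn_integral:
  "f \<in> Lp_space M p \<Longrightarrow> ennreal (Lp_int M p f) = (\<integral>\<^sup>+ x. ennreal (cmod (f x) powr p) \<partial>M)"
  by (simp add: Lp_space_def Lp_int_def)

lemma Lp_int_nonneg [simp]: "0 \<le> Lp_int M p f"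
  by (simp add: Lp_int_def)

lemma Lp_space_bound:
  assumes f: "f \<in> Lp_space M p" and g: "g \<in> borel_measurable M"
    and le: "AE x in M. cmod (g x) powr p \<le> cmod (f x) powr p"
  shows "g \<in> Lp_space M p" "Lp_int M p g \<le> Lp_int M p f"
proof -
  have *: "(\<integral>\<^sup>+ x. ennreal (cmod (g x) powr p) \<partial>M) \<le> (\<integral>\<^sup>+ x. ennreal (cmod (f x) powr p) \<partial>M)"
    by (intro nn_integral_mono_AE) (use le in \<open>auto elim!: eventually_mono simp: ennreal_leI\<close>)
  then show "g \<in> Lp_space M p"
    using f g by (auto simp: Lp_space_def intro: le_less_trans)
  show "Lp_int M p g \<le> Lp_int M p f"
    unfolding Lp_int_def using * f by (intro enn2real_mono) (auto simp: Lp_space_def)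
qed

lemma Lp_int_cong_AE:
  assumes "AE x in M. f x = g x"
  shows "Lp_int M p f = Lp_int M p g"
  unfolding Lp_int_def
  by (intro arg_cong[where f = enn2real] nn_integral_cong_AE) (use assms in \<open>auto elim!: eventually_mono\<close>)

text \<open>The quasi-triangle inequalities for integrals are pointwise bounds integrated by this
  lemma; membership of \<open>h\<close> comes with them.\<close>

lemma Lp_int_linear_bound:
  assumes f: "f \<in> Lp_space M p" and g: "g \<in> Lp_space M p" and h: "h \<in> borel_measurable M"
    and K: "0 \<le> K" and L: "0 \<le> L"
    and le: "AE x in M. cmod (h x) powr p \<le> K * cmod (f x) powr p + L * cmod (g x) powr p"
  shows "h \<in> Lp_space M p" "Lp_int M p h \<le> K * Lp_int M p f + L * Lp_int M p g"
proof -
  note [measurable] = Lp_space_measurable[OF f] Lp_space_measurable[OF g] h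
  have "(\<integral>\<^sup>+ x. ennreal (cmod (h x) powr p) \<partial>M)
      \<le> (\<integral>\<^sup>+ x. ennreal K * ennreal (cmod (f x) powr p) + ennreal L * ennreal (cmod (g x) powr p) \<partial>M)"
    by (intro nn_integral_mono_AE)
       (use le K L in \<open>auto elim!: eventually_mono simp: ennreal_leI simp flip: ennreal_mult ennreal_plus\<close>)
  also have "\<dots> = ennreal K * (\<integral>\<^sup>+ x. ennreal (cmod (f x) powr p) \<partial>M)
      + ennreal L * (\<integral>\<^sup>+ x. ennreal (cmod (g x) powr p) \<partial>M)"
    by (subst nn_integral_add) (auto simp: nn_integral_cmult)
  also have "\<dots> = ennreal (K * Lp_int M p f + L * Lp_int M p g)"
    using K L by (simp add: Lp_int_eq_nn_integral[OF f, symmetric] Lp_int_eq_nn_integral[OF g, symmetric]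
        ennreal_mult)
  finally have *: "(\<integral>\<^sup>+ x. ennreal (cmod (h x) powr p) \<partial>M) \<le> ennreal (K * Lp_int M p f + L * Lp_int M p g)" .
  show "h \<in> Lp_space M p"
    using * h by (intro Lp_spaceI) (auto intro: le_less_trans)
  show "Lp_int M p h \<le> K * Lp_int M p f + L * Lp_int M p g"
    unfolding Lp_int_def[of M p h] using * K L
    by (intro enn2real_leI) auto
qed

lemma Lp_zero [simp]: "(\<lambda>x. 0) \<in> Lp_space M p"
  by (simp add: Lp_space_def)

lemma Lp_int_zero [simp]: "Lp_int M p (\<lambda>x. 0) = 0"
  by (simp add: Lp_int_def)

lemma Lp_int_eq_0_iff:
  assumes "f \<in> Lp_space M p"
  shows "Lp_int M p f = 0 \<longleftrightarrow> (AE x in M. f x = 0)"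
proof -
  note [measurable] = Lp_space_measurable[OF assms]
  have "Lp_int M p f = 0 \<longleftrightarrow> (\<integral>\<^sup>+ x. ennreal (cmod (f x) powr p) \<partial>M) = 0"
    using Lp_int_eq_nn_integral[OF assms] by (metis Lp_int_nonneg ennreal_eq_0_iff order_antisym order_refl)
  then show ?thesis
    by (simp add: nn_integral_0_iff_AE)
qed

lemma Lp_add:
  assumes "0 < p" "f \<in> Lp_space M p" "g \<in> Lp_space M p"
  shows Lp_space_add: "(\<lambda>x. f x + g x) \<in> Lp_space M p"
    and Lp_int_add_le: "Lp_int M p (\<lambda>x. f x + g x) \<le> 2 powr p * (Lp_int M p f + Lp_int M p g)"
proof -
  have [measurable]: "f \<in> borel_measurable M" "g \<in> borel_measurable M" using assms by auto
  have "AE x in M. cmod (f x + g x) powr p \<le> 2 powr p * cmod (f x) powr p + 2 powr p * cmod (g x) powr p"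
    using norm_add_powr_le[OF assms(1)] by (simp flip: distrib_left)
  from Lp_int_linear_bound[OF assms(2,3) _ _ _ this] show
    "(\<lambda>x. f x + g x) \<in> Lp_space M p"
    "Lp_int M p (\<lambda>x. f x + g x) \<le> 2 powr p * (Lp_int M p f + Lp_int M p g)"
    by (auto simp: algebra_simps)
qed

lemma Lp_int_add_eps:
  assumes "0 < p" "0 < e"
  obtains C where "0 \<le> C"
    "\<And>f g. f \<in> Lp_space M p \<Longrightarrow> g \<in> Lp_space M p \<Longrightarrow>
       Lp_int M p (\<lambda>x. f x + g x) \<le> (1 + e) * Lp_int M p f + C * Lp_int M p g"
proof -
  obtain C where C: "0 \<le> C"
    "\<And>a b :: complex. cmod (a + b) powr p \<le> (1 + e) * cmod a powr p + C * cmod b powr p"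
    using norm_add_powr_le_eps[OF assms] by blast
  show ?thesis
  proof (rule that[OF C(1)])
    fix f g assume fg: "f \<in> Lp_space M p" "g \<in> Lp_space M p"
    then have [measurable]: "f \<in> borel_measurable M" "g \<in> borel_measurable M" by auto
    show "Lp_int M p (\<lambda>x. f x + g x) \<le> (1 + e) * Lp_int M p f + C * Lp_int M p g"
      using assms C fg by (intro Lp_int_linear_bound(2)) auto
  qed
qed

lemma Lp_space_scale:
  assumes "f \<in> Lp_space M p"
  shows "(\<lambda>x. a * f x) \<in> Lp_space M p"
    and "Lp_int M p (\<lambda>x. a * f x) = cmod a powr p * Lp_int M p f"
proof -
  have [measurable]: "f \<in> borel_measurable M" using assms by auto
  have *: "(\<integral>\<^sup>+ x. ennreal (cmod (a * f x) powr p) \<partial>M) = ennreal (cmod a powr p) * (\<integral>\<^sup>+ x. ennreal (cmod (f x) powr p) \<partial>M)"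
    by (simp add: norm_mult powr_mult ennreal_mult nn_integral_cmult)
  then show "(\<lambda>x. a * f x) \<in> Lp_space M p"
    using assms by (auto simp: Lp_space_def ennreal_mult_less_top)
  show "Lp_int M p (\<lambda>x. a * f x) = cmod a powr p * Lp_int M p f"
    unfolding Lp_int_def * by (simp add: enn2real_mult)
qed

lemma Lp_space_uminus: "f \<in> Lp_space M p \<Longrightarrow> (\<lambda>x. - f x) \<in> Lp_space M p"
  using Lp_space_scale(1)[of f M p "-1"] by simp

lemma Lp_space_diff:
  "0 < p \<Longrightarrow> f \<in> Lp_space M p \<Longrightarrow> g \<in> Lp_space M p \<Longrightarrow> (\<lambda>x. f x - g x) \<in> Lp_space M p"
  using Lp_space_add[of p f M "\<lambda>x. - g x"] Lp_space_uminus[of g M p] by simp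

lemma Lp_space_sum:
  assumes "0 < p" "\<And>i. i \<in> I \<Longrightarrow> f i \<in> Lp_space M p"
  shows "(\<lambda>x. \<Sum>i\<in>I. f i x) \<in> Lp_space M p"
  using assms(2)
proof (induction I rule: infinite_finite_induct)
  case (insert i I)
  then show ?case using Lp_space_add[OF assms(1), of "f i" M "\<lambda>x. \<Sum>i\<in>I. f i x"] by simp
qed auto

lemma Lp_int_minus_commute: "Lp_int M p (\<lambda>x. f x - g x) = Lp_int M p (\<lambda>x. g x - f x)"
  by (simp add: Lp_int_def norm_minus_commute)

lemma Lp_int_triangle:
  assumes "0 < p" "f \<in> Lp_space M p" "g \<in> Lp_space M p" "h \<in> Lp_space M p"
  shows "Lp_int M p (\<lambda>x. f x - h x) \<le> 2 powr p * (Lp_int M p (\<lambda>x. f x - g x) + Lp_int M p (\<lambda>x. g x - h x))"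
  using Lp_int_add_le[of p "\<lambda>x. f x - g x" M "\<lambda>x. g x - h x"] assms by (simp add: Lp_space_diff)

lemma Lp_int_tendsto:
  assumes "0 < p" and f: "\<And>n. f n \<in> Lp_space M p" "g \<in> Lp_space M p"
    and lim: "(\<lambda>n::nat. Lp_int M p (\<lambda>x. f n x - g x)) \<longlonglongrightarrow> 0"
  shows "(\<lambda>n. Lp_int M p (f n)) \<longlonglongrightarrow> Lp_int M p g"
proof -
  define L where "L = Lp_int M p g"
  have L: "0 \<le> L" by (simp add: L_def)
  have diff: "(\<lambda>x. f n x - g x) \<in> Lp_space M p" for n
    using Lp_space_diff assms by blast
  have up: "eventually (\<lambda>n. Lp_int M p (f n) < a) sequentially" if "L < a" for a
  proof -
    define c where "c = (a - L) / 2"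
    \<comment> \<open>Half of the gap \<open>a - L\<close> may be spent on \<open>e * L\<close>; the
      \<open>+ 1\<close> covers \<open>L = 0\<close>.\<close>
    define e where "e = c / (L + 1)"
    have "L + 1 \<noteq> 0" "0 < e" using that L by (auto simp: e_def c_def)
    moreover from this have "e * (L + 1) = c"
      by (simp add: e_def)
    moreover have "e * L \<le> e * (L + 1)" using \<open>0 < e\<close> by simp
    ultimately have "e * L \<le> e * (L + 1)" "e * (L + 1) = (a - L) / 2" "0 < e" by (auto simp: c_def)
    then have e: "0 < e" "e * L < a - L"
      using that by auto
    obtain C where C: "0 \<le> C" "\<And>f g. f \<in> Lp_space M p \<Longrightarrow> g \<in> Lp_space M p \<Longrightarrow>
       Lp_int M p (\<lambda>x. f x + g x) \<le> (1 + e) * Lp_int M p f + C * Lp_int M p g"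
      using Lp_int_add_eps[OF assms(1) e(1)] by blast
    have "(\<lambda>n. (1 + e) * L + C * Lp_int M p (\<lambda>x. f n x - g x)) \<longlonglongrightarrow> (1 + e) * L + C * 0"
      by (intro tendsto_intros lim)
    moreover have "(1 + e) * L + C * 0 < a" using e by (simp add: algebra_simps)
    ultimately have "eventually (\<lambda>n. (1 + e) * L + C * Lp_int M p (\<lambda>x. f n x - g x) < a) sequentially"
      by (rule order_tendstoD)
    then show ?thesis
    proof (rule eventually_mono)
      fix n assume "(1 + e) * L + C * Lp_int M p (\<lambda>x. f n x - g x) < a"
      moreover have "Lp_int M p (f n) \<le> (1 + e) * L + C * Lp_int M p (\<lambda>x. f n x - g x)"
        using C(2)[OF f(2) diff[of n]] by (simp add: L_def)
      ultimately show "Lp_int M p (f n) < a" by simp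
    qed
  qed
  have lo: "eventually (\<lambda>n. a < Lp_int M p (f n)) sequentially" if "a < L" for a
  proof (cases "a < 0")
    case True
    then show ?thesis by (auto intro!: always_eventually less_le_trans[OF True])
  next
    case False
    define c where "c = (L - a) / 2"
    define e where "e = c / (a + 1)"
    have "a + 1 \<noteq> 0" "0 < e" using that False by (auto simp: e_def c_def)
    moreover from this have "e * (a + 1) = c"
      by (simp add: e_def)
    moreover have "e * a \<le> e * (a + 1)" using \<open>0 < e\<close> by simp
    ultimately have "e * a \<le> e * (a + 1)" "e * (a + 1) = (L - a) / 2" "0 < e" by (auto simp: c_def)
    then have e: "0 < e" "(1 + e) * a < L"
      using that by (auto simp: algebra_simps)
    obtain C where C: "0 \<le> C" "\<And>f g. f \<in> Lp_space M p \<Longrightarrow> g \<in> Lp_space M p \<Longrightarrow>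
       Lp_int M p (\<lambda>x. f x + g x) \<le> (1 + e) * Lp_int M p f + C * Lp_int M p g"
      using Lp_int_add_eps[OF assms(1) e(1)] by blast
    have "(\<lambda>n. C * Lp_int M p (\<lambda>x. f n x - g x)) \<longlonglongrightarrow> C * 0"
      by (intro tendsto_intros lim)
    moreover have "C * 0 < L - (1 + e) * a" using e by (simp add: algebra_simps)
    ultimately have "eventually (\<lambda>n. C * Lp_int M p (\<lambda>x. f n x - g x) < L - (1 + e) * a) sequentially"
      by (rule order_tendstoD)
    then show ?thesis
    proof (rule eventually_mono)
      fix n assume "C * Lp_int M p (\<lambda>x. f n x - g x) < L - (1 + e) * a"
      moreover have "L \<le> (1 + e) * Lp_int M p (f n) + C * Lp_int M p (\<lambda>x. f n x - g x)"
        using C(2)[OF f(1) Lp_space_uminus[OF diff[of n]], of n]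
          Lp_space_scale(2)[OF diff[of n], of "-1"] by (simp add: L_def)
      ultimately have "(1 + e) * a < (1 + e) * Lp_int M p (f n)" by simp
      then show "a < Lp_int M p (f n)" using e by simp
    qed
  qed
  show ?thesis
    using up lo unfolding L_def[symmetric] by (intro order_tendstoI)
qed

lemma Lp_int_tendsto_minus:
  assumes "0 < p" "\<And>n. f n \<in> Lp_space M p" "g \<in> Lp_space M p" "h \<in> Lp_space M p"
    and lim: "(\<lambda>n::nat. Lp_int M p (\<lambda>x. f n x - g x)) \<longlonglongrightarrow> 0"
  shows "(\<lambda>n. Lp_int M p (\<lambda>x. f n x - h x)) \<longlonglongrightarrow> Lp_int M p (\<lambda>x. g x - h x)"
  using assms by (intro Lp_int_tendsto) (auto simp: Lp_space_diff)

section \<open>Dominated convergence, simple functions and completeness\<close>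

lemma Lp_int_dominated:
  assumes [measurable]: "\<And>n. f n \<in> borel_measurable M" "g \<in> borel_measurable M" and w: "w \<in> Lp_space M p" and "0 < p"
    and lim: "AE x in M. (\<lambda>n::nat. f n x) \<longlonglongrightarrow> g x"
    and bound: "\<And>n. AE x in M. cmod (f n x) \<le> cmod (w x)"
  shows "g \<in> Lp_space M p" "(\<lambda>n. Lp_int M p (\<lambda>x. f n x - g x)) \<longlonglongrightarrow> 0"
proof -
  note [measurable] = Lp_space_measurable[OF w]
  have bound': "AE x in M. \<forall>n. cmod (f n x) \<le> cmod (w x)"
    using bound by (simp add: AE_all_countable)
  have g: "AE x in M. cmod (g x) \<le> cmod (w x)"
    using lim bound'
  proof eventually_elim
    case (elim x)
    then show ?case by (intro tendsto_upperbound[OF tendsto_norm[OF elim(1)]]) auto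
  qed
  show gL: "g \<in> Lp_space M p"
    using w g \<open>0 < p\<close> by (intro Lp_space_bound(1)[OF w]) (auto elim!: eventually_mono intro!: powr_mono2)
  have "(\<lambda>n. \<integral>\<^sup>+ x. ennreal (cmod (f n x - g x) powr p) \<partial>M) \<longlonglongrightarrow> (\<integral>\<^sup>+ x. 0 \<partial>M)"
  proof (rule nn_integral_dominated_convergence[where w = "\<lambda>x. ennreal (cmod (2 * w x) powr p)"])
    show "AE x in M. ennreal (cmod (f n x - g x) powr p) \<le> ennreal (cmod (2 * w x) powr p)" for n
      using bound' g
    proof eventually_elim
      case (elim x)
      have "cmod (f n x - g x) \<le> cmod (2 * w x)"
        using norm_triangle_ineq4[of "f n x" "g x"] elim(1)[rule_format, of n] elim(2) by (simp add: norm_mult)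
      then show ?case using \<open>0 < p\<close> by (intro ennreal_leI powr_mono2) auto
    qed
    show "(\<integral>\<^sup>+ x. ennreal (cmod (2 * w x) powr p) \<partial>M) < \<infinity>"
      using Lp_space_scale(1)[OF w, of 2] by (simp add: Lp_space_def)
    show "AE x in M. (\<lambda>n. ennreal (cmod (f n x - g x) powr p)) \<longlonglongrightarrow> 0"
      using lim
    proof eventually_elim
      case (elim x)
      have "(\<lambda>n. cmod (f n x - g x)) \<longlonglongrightarrow> 0"
        using elim by (simp add: LIM_zero tendsto_norm_zero)
      then have "(\<lambda>n. cmod (f n x - g x) powr p) \<longlonglongrightarrow> 0 powr p"
        using \<open>0 < p\<close> by (intro tendsto_powr2) auto
      then have "(\<lambda>n. ennreal (cmod (f n x - g x) powr p)) \<longlonglongrightarrow> ennreal 0"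
        by (intro tendsto_ennrealI) simp
      then show ?case by simp
    qed
  qed measurable
  then have "(\<lambda>n. enn2real (\<integral>\<^sup>+ x. ennreal (cmod (f n x - g x) powr p) \<partial>M)) \<longlonglongrightarrow> enn2real 0"
    by (intro tendsto_enn2real) auto
  then show "(\<lambda>n. Lp_int M p (\<lambda>x. f n x - g x)) \<longlonglongrightarrow> 0"
    by (simp add: Lp_int_def)
qed

lemma Lp_simple_approx:
  assumes f: "f \<in> Lp_space M p" and "0 < p"
  obtains g where "\<And>n. simple_function M (g n)" "\<And>n. g n \<in> Lp_space M p"
    "(\<lambda>n::nat. Lp_int M p (\<lambda>x. g n x - f x)) \<longlonglongrightarrow> 0"
proof -
  obtain F where F: "\<And>i. simple_function M (F i)"
    "\<And>x. x \<in> space M \<Longrightarrow> (\<lambda>i. F i x) \<longlonglongrightarrow> f x"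
    "\<And>i x. x \<in> space M \<Longrightarrow> dist (F i x) 0 \<le> 2 * dist (f x) 0"
    using borel_measurable_implies_sequence_metric[OF Lp_space_measurable[OF f], of 0] by blast
  have [measurable]: "F i \<in> borel_measurable M" "f \<in> borel_measurable M" for i
    using F(1) f by (auto intro: borel_measurable_simple_function)
  have w: "(\<lambda>x. 2 * f x) \<in> Lp_space M p" by (intro Lp_space_scale f)
  have b: "AE x in M. cmod (F i x) \<le> cmod (2 * f x)" for i
    using F(3) by (auto simp: norm_mult)
  have "F i \<in> Lp_space M p" for i
    using b[of i] \<open>0 < p\<close> by (intro Lp_space_bound(1)[OF w]) (auto elim!: eventually_mono intro!: powr_mono2)
  moreover have "(\<lambda>n. Lp_int M p (\<lambda>x. F n x - f x)) \<longlonglongrightarrow> 0"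
    using F(2) b by (intro Lp_int_dominated(2)[OF _ _ w \<open>0 < p\<close>]) auto
  ultimately show ?thesis using that F(1) by blast
qed

text \<open>Riesz-Fischer for every positive exponent: a fast subsequence converges almost
  everywhere, and Fatou's lemma carries the Cauchy estimate of the whole sequence over to that
  limit.\<close>

lemma Lp_complete:
  assumes "0 < p" and f: "\<And>n. f n \<in> Lp_space M p"
    and cauchy: "\<And>e. 0 < e \<Longrightarrow> \<exists>N. \<forall>m\<ge>N. \<forall>n\<ge>N. Lp_int M p (\<lambda>x. f m x - f n x) < e"
  obtains g where "g \<in> Lp_space M p" "(\<lambda>n::nat. Lp_int M p (\<lambda>x. f n x - g x)) \<longlonglongrightarrow> 0"
proof -
  note [measurable] = Lp_space_measurable[OF f]
  \<comment> \<open>With these bounds the sum of \<open>2^(k p) |d k x|^p\<close> has a finite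
    integral, so almost everywhere \<open>|d k x|\<close> is at most a constant times
    \<open>2^(-k)\<close>. The telescoping series then converges pointwise without Minkowski's
    inequality, which fails for \<open>p < 1\<close>.\<close>
  define \<delta> where "\<delta> k = (1/2) ^ k / 2 powr (k * p)" for k :: nat
  have \<delta>: "0 < \<delta> k" for k by (simp add: \<delta>_def)
  have "\<forall>k. \<exists>N. \<forall>m\<ge>N. \<forall>n\<ge>N. Lp_int M p (\<lambda>x. f m x - f n x) < \<delta> k"
    using cauchy \<delta> by blast
  then obtain N where N: "\<And>k m n. m \<ge> N k \<Longrightarrow> n \<ge> N k \<Longrightarrow> Lp_int M p (\<lambda>x. f m x - f n x) < \<delta> k"
    by metis
  \<comment> \<open>Cumulative sums keep both \<open>r k\<close> and \<open>r (Suc k)\<close> above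
    \<open>N k\<close>; the summand \<open>k\<close> drives \<open>r\<close> to infinity.\<close>
  define r where "r k = (\<Sum>j\<le>k. N j) + k" for k
  have r: "N k \<le> r k" "N k \<le> r (Suc k)" "k \<le> r k" for k
    using member_le_sum[of k "{..k}" N] by (auto simp: r_def)
  define d where "d k x = f (r (Suc k)) x - f (r k) x" for k x
  have [measurable]: "d k \<in> borel_measurable M" for k unfolding d_def by measurable
  have dL: "d k \<in> Lp_space M p" for k unfolding d_def using Lp_space_diff assms by blast
  have dint: "Lp_int M p (d k) < \<delta> k" for k unfolding d_def using N r by blast
  have "(\<integral>\<^sup>+ x. (\<Sum>k. ennreal (2 powr (k * p) * cmod (d k x) powr p)) \<partial>M)
      = (\<Sum>k. \<integral>\<^sup>+ x. ennreal (2 powr (k * p) * cmod (d k x) powr p) \<partial>M)"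
    by (intro nn_integral_suminf) measurable
  also have "\<dots> = (\<Sum>k. ennreal (2 powr (k * p) * Lp_int M p (d k)))"
    by (simp add: ennreal_mult nn_integral_cmult Lp_int_eq_nn_integral[OF dL])
  also have "\<dots> \<le> (\<Sum>k. ennreal ((1/2) ^ k))"
  proof (intro suminf_le ennreal_leI)
    show "2 powr (k * p) * Lp_int M p (d k) \<le> (1/2) ^ k" for k :: nat
      using dint[of k] by (simp add: \<delta>_def field_simps)
  qed auto
  also have "\<dots> = ennreal 2"
    by (subst suminf_ennreal2) (auto simp: suminf_geometric summable_geometric)
  finally have "(\<integral>\<^sup>+ x. (\<Sum>k. ennreal (2 powr (k * p) * cmod (d k x) powr p)) \<partial>M) \<noteq> \<infinity>"
    by (auto simp: top_unique)
  then have ae: "AE x in M. (\<Sum>k. ennreal (2 powr (k * p) * cmod (d k x) powr p)) \<noteq> \<infinity>"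
    by (intro nn_integral_PInf_AE) measurable
  have conv: "AE x in M. convergent (\<lambda>k. f (r k) x)"
    using ae
  proof eventually_elim
    case (elim x)
    define t where "t k = 2 powr (k * p) * cmod (d k x) powr p" for k :: nat
    define B where "B = enn2real (\<Sum>k. ennreal (t k))"
    have le: "t k \<le> B" for k
    proof -
      have "ennreal (t k) \<le> (\<Sum>k. ennreal (t k))"
        using sum_le_suminf[of "\<lambda>k. ennreal (t k)" "{k}"] by simp
      also have "\<dots> = ennreal B"
        unfolding B_def using elim by (subst ennreal_enn2real) (auto simp: less_top t_def)
      finally show ?thesis by (simp add: B_def)
    qed
    have "cmod (d k x) \<le> B powr (1/p) * (1/2) ^ k" for k
    proof -
      have "(2 ^ k * cmod (d k x)) powr p \<le> B"
        using le[of k] by (simp add: t_def powr_mult powr_powr flip: powr_realpow)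
      then have "((2 ^ k * cmod (d k x)) powr p) powr (1/p) \<le> B powr (1/p)"
        using assms(1) by (intro powr_mono2) auto
      then have "2 ^ k * cmod (d k x) \<le> B powr (1/p)"
        using assms(1) by (simp add: powr_powr)
      then show ?thesis by (simp add: field_simps)
    qed
    then have "summable (\<lambda>k. d k x)"
      by (rule summable_comparison_test'[OF summable_mult[OF summable_geometric], rotated]) simp
    then have "convergent (\<lambda>n. \<Sum>k<n. d k x)"
      by (simp add: summable_iff_convergent)
    moreover have "(\<Sum>k<n. d k x) = f (r n) x - f (r 0) x" for n
      unfolding d_def by (rule sum_lessThan_telescope)
    ultimately have "convergent (\<lambda>n. (f (r n) x - f (r 0) x) + f (r 0) x)"
      by (intro convergent_add convergent_const) simp
    then show ?case by simp
  qed
  define g where "g x = lim (\<lambda>k. f (r k) x)" for x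
  have [measurable]: "g \<in> borel_measurable M"
    unfolding g_def by (intro borel_measurable_lim_metric) measurable
  have lim: "AE x in M. (\<lambda>k. f (r k) x) \<longlonglongrightarrow> g x"
    using conv by (auto elim!: eventually_mono simp: g_def convergent_LIMSEQ_iff)
  have fatou: "(\<integral>\<^sup>+ x. ennreal (cmod (f m x - g x) powr p) \<partial>M) \<le> ennreal e"
    if "\<forall>m\<ge>K. \<forall>n\<ge>K. Lp_int M p (\<lambda>x. f m x - f n x) < e" "K \<le> m" for e K m
  proof -
    have "(\<integral>\<^sup>+ x. ennreal (cmod (f m x - g x) powr p) \<partial>M)
       = (\<integral>\<^sup>+ x. liminf (\<lambda>k. ennreal (cmod (f m x - f (r k) x) powr p)) \<partial>M)"
    proof (intro nn_integral_cong_AE)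
      show "AE x in M. ennreal (cmod (f m x - g x) powr p) = liminf (\<lambda>k. ennreal (cmod (f m x - f (r k) x) powr p))"
        using lim
      proof eventually_elim
        case (elim x)
        have "(\<lambda>k. cmod (f m x - f (r k) x) powr p) \<longlonglongrightarrow> cmod (f m x - g x) powr p"
          using \<open>0 < p\<close> by (intro tendsto_powr2 tendsto_intros elim) auto
        then have "(\<lambda>k. ennreal (cmod (f m x - f (r k) x) powr p)) \<longlonglongrightarrow> ennreal (cmod (f m x - g x) powr p)"
          by (intro tendsto_ennrealI)
        then show ?case by (intro lim_imp_Liminf[symmetric]) auto
      qed
    qed
    also have "\<dots> \<le> liminf (\<lambda>k. \<integral>\<^sup>+ x. ennreal (cmod (f m x - f (r k) x) powr p) \<partial>M)"
      by (intro nn_integral_liminf) measurable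
    also have "\<dots> = liminf (\<lambda>k. ennreal (Lp_int M p (\<lambda>x. f m x - f (r k) x)))"
      using assms by (simp add: Lp_int_eq_nn_integral Lp_space_diff)
    also have "\<dots> \<le> ennreal e"
    proof -
      have "eventually (\<lambda>k. ennreal (Lp_int M p (\<lambda>x. f m x - f (r k) x)) \<le> ennreal e) sequentially"
        using eventually_ge_at_top[of K]
      proof eventually_elim
        case (elim k)
        then have "K \<le> r k" using r(3)[of k] by simp
        then show ?case using that by (intro ennreal_leI) (auto intro: less_imp_le)
      qed
      then show ?thesis
        by (intro order_trans[OF Liminf_le_Limsup Limsup_bounded]) auto
    qed
    finally show ?thesis .
  qed
  obtain K where K: "\<forall>m\<ge>K. \<forall>n\<ge>K. Lp_int M p (\<lambda>x. f m x - f n x) < 1"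
    using cauchy[of 1] by auto
  have "(\<lambda>x. f K x - g x) \<in> Lp_space M p"
    using fatou[OF K order_refl] by (intro Lp_spaceI) (auto intro: le_less_trans)
  from Lp_space_diff[OF \<open>0 < p\<close> f[of K] this] have gL: "g \<in> Lp_space M p" by simp
  have "(\<lambda>n. Lp_int M p (\<lambda>x. f n x - g x)) \<longlonglongrightarrow> 0"
  proof (rule LIMSEQ_I)
    fix e :: real assume e: "0 < e"
    obtain K where K: "\<forall>m\<ge>K. \<forall>n\<ge>K. Lp_int M p (\<lambda>x. f m x - f n x) < e / 2"
      using cauchy[of "e / 2"] e by auto
    have "norm (Lp_int M p (\<lambda>x. f n x - g x) - 0) < e" if "n \<ge> K" for n
    proof -
      have "Lp_int M p (\<lambda>x. f n x - g x) \<le> e / 2"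
        unfolding Lp_int_def using fatou[OF K that] e by (intro enn2real_leI) auto
      then show ?thesis using e by simp
    qed
    then show "\<exists>no. \<forall>n\<ge>no. norm (Lp_int M p (\<lambda>x. f n x - g x) - 0) < e" by blast
  qed
  with gL show ?thesis using that by blast
qed

section \<open>Extension of equidistant maps from dense families\<close>

lemma null_sequence_exists:
  assumes "\<And>e::real. 0 < e \<Longrightarrow> \<exists>i\<in>I. h i < e" "\<And>i. i \<in> I \<Longrightarrow> 0 \<le> h i"
  obtains s where "\<And>n::nat. s n \<in> I" "(\<lambda>n. h (s n)) \<longlonglongrightarrow> 0"
proof -
  have "\<forall>n::nat. \<exists>i\<in>I. h i < 1 / Suc n" using assms by simp
  then obtain s where s: "\<And>n. s n \<in> I" "\<And>n::nat. h (s n) < 1 / Suc n" by metis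
  have "(\<lambda>n. h (s n)) \<longlonglongrightarrow> 0"
    using s assms(2) by (intro real_tendsto_sandwich[OF _ _ tendsto_const LIMSEQ_Suc[OF lim_1_over_n]])
      (auto intro!: always_eventually simp: less_imp_le)
  with s(1) show ?thesis using that by blast
qed

text \<open>Extension by continuity in purely metric terms: along a sequence of
  \<open>\<psi> i\<close> tending to \<open>F\<close> the \<open>\<phi> i\<close> form a Cauchy
  sequence. Since p-th and q-th power integrals are compared, the exponents may differ, and no
  linearity is involved. Recording the distances from \<open>H\<close> to all
  \<open>\<phi> i\<close> pins \<open>H\<close> down up to null sets.\<close>

lemma Lp_equidistant_extension:
  assumes "0 < p" "0 < q"
    and \<psi>: "\<And>i. i \<in> I \<Longrightarrow> \<psi> i \<in> Lp_space M p" and \<phi>: "\<And>i. i \<in> I \<Longrightarrow> \<phi> i \<in> Lp_space N q"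
    and eq: "\<And>i j. i \<in> I \<Longrightarrow> j \<in> I \<Longrightarrow>
      Lp_int N q (\<lambda>x. \<phi> i x - \<phi> j x) = Lp_int M p (\<lambda>x. \<psi> i x - \<psi> j x)"
    and F: "F \<in> Lp_space M p"
    and dense: "\<And>e. 0 < e \<Longrightarrow> \<exists>i\<in>I. Lp_int M p (\<lambda>x. \<psi> i x - F x) < e"
  shows "\<exists>H\<in>Lp_space N q. \<forall>i\<in>I. Lp_int N q (\<lambda>x. \<phi> i x - H x) = Lp_int M p (\<lambda>x. \<psi> i x - F x)"
proof -
  obtain s where s: "\<And>n::nat. s n \<in> I" and lim: "(\<lambda>n. Lp_int M p (\<lambda>x. \<psi> (s n) x - F x)) \<longlonglongrightarrow> 0"
    using null_sequence_exists[of I "\<lambda>i. Lp_int M p (\<lambda>x. \<psi> i x - F x)"] dense by force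
  have "\<exists>K. \<forall>m\<ge>K. \<forall>n\<ge>K. Lp_int N q (\<lambda>x. \<phi> (s m) x - \<phi> (s n) x) < e" if "0 < e" for e
  proof -
    define d where "d = e / (2 * 2 powr p)"
    have d: "0 < d" "2 powr p * (d + d) = e" using that by (auto simp: d_def field_simps)
    obtain K where K: "\<And>n. n \<ge> K \<Longrightarrow> Lp_int M p (\<lambda>x. \<psi> (s n) x - F x) < d"
      using order_tendstoD(2)[OF lim d(1)] by (auto simp: eventually_sequentially)
    have "Lp_int N q (\<lambda>x. \<phi> (s m) x - \<phi> (s n) x) < e" if "m \<ge> K" "n \<ge> K" for m n
    proof -
      have "Lp_int N q (\<lambda>x. \<phi> (s m) x - \<phi> (s n) x)
        \<le> 2 powr p * (Lp_int M p (\<lambda>x. \<psi> (s m) x - F x) + Lp_int M p (\<lambda>x. F x - \<psi> (s n) x))"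
        using s eq Lp_int_triangle[OF \<open>0 < p\<close> \<psi>[OF s] F \<psi>[OF s]] by simp
      also have "\<dots> < 2 powr p * (d + d)"
        using K[OF that(1)] K[OF that(2)] by (simp add: Lp_int_minus_commute[of M p F])
      finally show ?thesis using d by simp
    qed
    then show ?thesis by blast
  qed
  then obtain H where H: "H \<in> Lp_space N q" "(\<lambda>n. Lp_int N q (\<lambda>x. \<phi> (s n) x - H x)) \<longlonglongrightarrow> 0"
    using Lp_complete[OF \<open>0 < q\<close>, of "\<lambda>n. \<phi> (s n)" N] \<phi> s by blast
  have "Lp_int N q (\<lambda>x. \<phi> i x - H x) = Lp_int M p (\<lambda>x. \<psi> i x - F x)" if "i \<in> I" for i
  proof -
    have "(\<lambda>n. Lp_int N q (\<lambda>x. \<phi> (s n) x - \<phi> i x)) \<longlonglongrightarrow> Lp_int N q (\<lambda>x. H x - \<phi> i x)"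
      using Lp_int_tendsto_minus[OF \<open>0 < q\<close> _ H(1) _ H(2)] \<phi> s that by blast
    moreover have "(\<lambda>n. Lp_int M p (\<lambda>x. \<psi> (s n) x - \<psi> i x)) \<longlonglongrightarrow> Lp_int M p (\<lambda>x. F x - \<psi> i x)"
      using Lp_int_tendsto_minus[OF \<open>0 < p\<close> _ F _ lim] \<psi> s that by blast
    ultimately show ?thesis
      using eq s that LIMSEQ_unique by (fastforce simp: Lp_int_minus_commute[of _ _ H] Lp_int_minus_commute[of _ _ F])
  qed
  with H(1) show ?thesis by blast
qed

text \<open>With \<open>F = F'\<close> this is uniqueness of the extension, in general its isometry.
  Density is required near \<open>F\<close> only, since \<open>H'\<close> is reached through its
  distances.\<close>

lemma Lp_equidistant_limits:
  assumes "0 < p" "0 < q"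
    and \<psi>: "\<And>i. i \<in> I \<Longrightarrow> \<psi> i \<in> Lp_space M p" and \<phi>: "\<And>i. i \<in> I \<Longrightarrow> \<phi> i \<in> Lp_space N q"
    and F: "F \<in> Lp_space M p" "F' \<in> Lp_space M p" and H: "H \<in> Lp_space N q" "H' \<in> Lp_space N q"
    and FH: "\<And>i. i \<in> I \<Longrightarrow> Lp_int N q (\<lambda>x. \<phi> i x - H x) = Lp_int M p (\<lambda>x. \<psi> i x - F x)"
    and FH': "\<And>i. i \<in> I \<Longrightarrow> Lp_int N q (\<lambda>x. \<phi> i x - H' x) = Lp_int M p (\<lambda>x. \<psi> i x - F' x)"
    and dense: "\<And>e. 0 < e \<Longrightarrow> \<exists>i\<in>I. Lp_int M p (\<lambda>x. \<psi> i x - F x) < e"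
  shows "Lp_int N q (\<lambda>x. H x - H' x) = Lp_int M p (\<lambda>x. F x - F' x)"
proof -
  obtain s where s: "\<And>n::nat. s n \<in> I" and lim: "(\<lambda>n. Lp_int M p (\<lambda>x. \<psi> (s n) x - F x)) \<longlonglongrightarrow> 0"
    using null_sequence_exists[of I "\<lambda>i. Lp_int M p (\<lambda>x. \<psi> i x - F x)"] dense by force
  then have lim': "(\<lambda>n. Lp_int N q (\<lambda>x. \<phi> (s n) x - H x)) \<longlonglongrightarrow> 0"
    using FH s by simp
  have "(\<lambda>n. Lp_int N q (\<lambda>x. \<phi> (s n) x - H' x)) \<longlonglongrightarrow> Lp_int N q (\<lambda>x. H x - H' x)"
    using Lp_int_tendsto_minus[OF \<open>0 < q\<close> _ H lim'] \<phi> s by blast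
  moreover have "(\<lambda>n. Lp_int M p (\<lambda>x. \<psi> (s n) x - F' x)) \<longlonglongrightarrow> Lp_int M p (\<lambda>x. F x - F' x)"
    using Lp_int_tendsto_minus[OF \<open>0 < p\<close> _ F lim] \<psi> s by blast
  ultimately show ?thesis
    using FH' s LIMSEQ_unique by fastforce
qed

text \<open>Taking roots is injective. Under either convention for the metric, preserving distances
  therefore means preserving \<open>Lp_int\<close> of differences, and roots disappear from the
  argument.\<close>

lemma Lp_dist_eq_iff:
  assumes "0 < p"
  shows "Lp_dist M p f f' = Lp_dist M p g g' \<longleftrightarrow> Lp_int M p (\<lambda>x. f x - f' x) = Lp_int M p (\<lambda>x. g x - g' x)"
proof -
  have "a powr (1 / p) = b powr (1 / p) \<longleftrightarrow> a = b" if "0 \<le> a" "0 \<le> b" for a b :: real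
  proof
    assume "a powr (1 / p) = b powr (1 / p)"
    then have "(a powr (1 / p)) powr p = (b powr (1 / p)) powr p" by simp
    then show "a = b" using that assms by (simp add: powr_powr)
  qed simp
  then show ?thesis by (auto simp: Lp_dist_def)
qed

lemma Lp_dist_less_iff:
  assumes "0 < p" "0 < e"
  shows "Lp_dist M p f g < e \<longleftrightarrow> Lp_int M p (\<lambda>x. f x - g x) < (if p < 1 then e else e powr p)"
proof -
  have "a powr (1 / p) < e \<longleftrightarrow> a < e powr p" if "0 \<le> a" for a :: real
  proof -
    have *: "(a powr (1 / p)) powr p = a" using that assms by (simp add: powr_powr)
    show ?thesis
      using powr_less_mono2[of p "a powr (1 / p)" e] powr_mono2[of p e "a powr (1 / p)"] assms * 
      by (metis less_le_not_le less_eq_real_def not_le powr_ge_zero)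
  qed
  then show ?thesis by (auto simp: Lp_dist_def)
qed

lemma Lp_null_add:
  assumes "0 < p" "\<And>n. f n \<in> Lp_space M p" "\<And>n. g n \<in> Lp_space M p"
    and "(\<lambda>n::nat. Lp_int M p (f n)) \<longlonglongrightarrow> 0" "(\<lambda>n. Lp_int M p (g n)) \<longlonglongrightarrow> 0"
  shows "(\<lambda>n. Lp_int M p (\<lambda>x. f n x + g n x)) \<longlonglongrightarrow> 0"
proof (rule real_tendsto_sandwich[where f = "\<lambda>_. 0"])
  show "(\<lambda>n. 2 powr p * (Lp_int M p (f n) + Lp_int M p (g n))) \<longlonglongrightarrow> 0"
    using tendsto_mult[OF tendsto_const tendsto_add[OF assms(4,5)], of "2 powr p"] by simp
qed (use assms in \<open>auto intro!: always_eventually Lp_int_add_le\<close>)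

lemma Lp_null_scale:
  assumes "\<And>n. f n \<in> Lp_space M p" and "(\<lambda>n::nat. Lp_int M p (f n)) \<longlonglongrightarrow> 0"
  shows "(\<lambda>n. Lp_int M p (\<lambda>x. a * f n x)) \<longlonglongrightarrow> 0"
  using tendsto_mult[OF tendsto_const assms(2), of "cmod a powr p"] assms(1) by (simp add: Lp_space_scale)

section \<open>Formal linear combinations\<close>

text \<open>Lists rather than functions: a map \<open>A\<close> acts on them entrywise even if the
  functions \<open>E f\<close> are linearly dependent. That the induced map of functions is well
  defined is then a consequence of distance preservation.\<close>

definition comb :: "('f \<Rightarrow> 'y \<Rightarrow> complex) \<Rightarrow> (complex \<times> 'f) list \<Rightarrow> 'y \<Rightarrow> complex" where
  "comb E s y = (\<Sum>(a, f)\<leftarrow>s. a * E f y)"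

text \<open>The augmentation of the formal sums. Weight 1 singles out affine combinations, weight 0
  their differences.\<close>

definition weight :: "(complex \<times> 'f) list \<Rightarrow> complex" where
  "weight s = (\<Sum>(a, f)\<leftarrow>s. a)"

definition scale :: "complex \<Rightarrow> (complex \<times> 'f) list \<Rightarrow> (complex \<times> 'f) list" where
  "scale c s = map (\<lambda>(a, f). (c * a, f)) s"

lemma comb_simps [simp]:
  "comb E [] y = 0" "comb E ((a, f) # s) y = a * E f y + comb E s y"
  "comb E (s @ t) y = comb E s y + comb E t y"
  by (auto simp: comb_def)

lemma weight_simps [simp]:
  "weight [] = 0" "weight ((a, f) # s) = a + weight s" "weight (s @ t) = weight s + weight t"
  by (auto simp: weight_def)

lemma comb_scale [simp]: "comb E (scale c s) y = c * comb E s y"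
  by (induction s) (auto simp: scale_def algebra_simps)

lemma weight_scale [simp]: "weight (scale c s) = c * weight s"
  by (induction s) (auto simp: scale_def algebra_simps)

lemma weight_map_apsnd [simp]: "weight (map (apsnd A) s) = weight s"
  by (induction s) auto

lemma snd_set_scale [simp]: "snd ` set (scale c s) = snd ` set s"
  by (force simp: scale_def)

lemma map_apsnd_scale: "map (apsnd A) (scale c s) = scale c (map (apsnd A) s)"
  by (auto simp: scale_def)

lemma comb_measurable:
  assumes "\<And>f. f \<in> snd ` set s \<Longrightarrow> E f \<in> borel_measurable N"
  shows "comb E s \<in> borel_measurable N"
  using assms
proof (induction s)
  case Nil
  have "comb E [] = (\<lambda>y. 0)" by auto
  then show ?case by simp
next
  case (Cons af s)
  obtain a f where af: "af = (a, f)" by fastforce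
  have "comb E (af # s) = (\<lambda>y. a * E f y + comb E s y)" by (auto simp: af)
  with Cons show ?case by (auto simp: af)
qed

lemma comb_Lp_space:
  assumes "0 < q" "\<And>f. f \<in> snd ` set s \<Longrightarrow> E f \<in> Lp_space N q"
  shows "comb E s \<in> Lp_space N q"
  using assms(2)
proof (induction s)
  case Nil
  have "comb E [] = (\<lambda>y. 0)" by auto
  then show ?case by simp
next
  case (Cons af s)
  obtain a f where af: "af = (a, f)" by fastforce
  have "comb E (af # s) = (\<lambda>y. a * E f y + comb E s y)" by (auto simp: af)
  with Cons show ?case by (auto simp: af intro!: Lp_space_add[OF assms(1)] Lp_space_scale(1))
qed

section \<open>Affine actions from equidistant embeddings\<close>

text \<open>Collects what the construction of the action uses about \<open>E\<close>. The last
  assumption is restricted to weight 0 because such combinations are the differences of affine ones;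
  it says that \<open>E f \<mapsto> E (A f)\<close> extends isometrically to the affine
  span.\<close>

locale Lp_embedding =
  fixes M :: "'a measure" and p :: real and N :: "'b measure" and q :: real
    and E :: "('a \<Rightarrow> complex) \<Rightarrow> 'b \<Rightarrow> complex"
  assumes p: "0 < p" and q: "0 < q"
    and E_Lp: "f \<in> Lp_space M p \<Longrightarrow> E f \<in> Lp_space N q"
    and E_dist: "f \<in> Lp_space M p \<Longrightarrow> g \<in> Lp_space M p \<Longrightarrow>
      Lp_int N q (\<lambda>y. E f y - E g y) = Lp_int M p (\<lambda>x. f x - g x)"
    and E_zero: "AE y in N. E (\<lambda>x. 0) y = 0"
    and E_dense: "F \<in> Lp_space N q \<Longrightarrow> 0 < e \<Longrightarrow>
      \<exists>s. snd ` set s \<subseteq> Lp_space M p \<and> Lp_int N q (\<lambda>y. comb E s y - F y) < e"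
    and E_isometry: "Lp_affine_isometry M p A \<Longrightarrow> snd ` set s \<subseteq> Lp_space M p \<Longrightarrow> weight s = 0 \<Longrightarrow>
      Lp_int N q (comb E (map (apsnd A) s)) = Lp_int N q (comb E s)"
begin

text \<open>Since \<open>E 0 = 0\<close> almost everywhere, every linear combination can be completed to an affine one.\<close>

definition "affine_combs = {s. snd ` set s \<subseteq> Lp_space M p \<and> weight s = 1}"

lemma comb_Lp: "snd ` set s \<subseteq> Lp_space M p \<Longrightarrow> comb E s \<in> Lp_space N q"
  by (rule comb_Lp_space[OF q E_Lp]) auto

lemma affine_combs_dense:
  assumes "F \<in> Lp_space N q" "0 < e"
  shows "\<exists>s\<in>affine_combs. Lp_int N q (\<lambda>y. comb E s y - F y) < e"
proof -
  obtain s where s: "snd ` set s \<subseteq> Lp_space M p" "Lp_int N q (\<lambda>y. comb E s y - F y) < e"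
    using E_dense[OF assms] by blast
  let ?t = "s @ [(1 - weight s, \<lambda>x. 0)]"
  have "?t \<in> affine_combs" using s(1) by (auto simp: affine_combs_def)
  moreover have "Lp_int N q (\<lambda>y. comb E ?t y - F y) = Lp_int N q (\<lambda>y. comb E s y - F y)"
    using E_zero by (intro Lp_int_cong_AE) auto
  ultimately show ?thesis using s(2) by metis
qed

section \<open>Lifting a single affine isometry\<close>

context
  fixes A assumes A: "Lp_affine_isometry M p A"
begin

lemma A_Lp: "f \<in> Lp_space M p \<Longrightarrow> A f \<in> Lp_space M p"
  using A by (auto simp: Lp_affine_isometry_def)

lemma map_A_combs: "s \<in> affine_combs \<Longrightarrow> map (apsnd A) s \<in> affine_combs"
  using A_Lp by (auto simp: affine_combs_def image_subset_iff)

text \<open>The formal difference \<open>s @ scale (-1) t\<close> has weight 0.\<close>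

lemma comb_A_dist:
  assumes "s \<in> affine_combs" "t \<in> affine_combs"
  shows "Lp_int N q (\<lambda>y. comb E (map (apsnd A) s) y - comb E (map (apsnd A) t) y)
       = Lp_int N q (\<lambda>y. comb E s y - comb E t y)"
proof -
  have "Lp_int N q (comb E (map (apsnd A) (s @ scale (-1) t))) = Lp_int N q (comb E (s @ scale (-1) t))"
    using assms by (intro E_isometry[OF A]) (auto simp: affine_combs_def image_Un)
  moreover have "comb E (map (apsnd A) (s @ scale (-1) t)) = (\<lambda>y. comb E (map (apsnd A) s) y - comb E (map (apsnd A) t) y)"
    by (auto simp: map_apsnd_scale)
  moreover have "comb E (s @ scale (-1) t) = (\<lambda>y. comb E s y - comb E t y)"
    by auto
  ultimately show ?thesis by simp
qed

text \<open>The image of \<open>F\<close> is determined by its distances to the dense set of affine combinations.\<close>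

definition "lift F = (SOME H. H \<in> Lp_space N q \<and>
  (\<forall>s\<in>affine_combs. Lp_int N q (\<lambda>y. comb E (map (apsnd A) s) y - H y) = Lp_int N q (\<lambda>y. comb E s y - F y)))"

lemma lift:
  assumes "F \<in> Lp_space N q"
  shows lift_Lp: "lift F \<in> Lp_space N q"
    and lift_dist_comb: "s \<in> affine_combs \<Longrightarrow>
      Lp_int N q (\<lambda>y. comb E (map (apsnd A) s) y - lift F y) = Lp_int N q (\<lambda>y. comb E s y - F y)"
proof -
  have "\<exists>H. H \<in> Lp_space N q \<and>
    (\<forall>s\<in>affine_combs. Lp_int N q (\<lambda>y. comb E (map (apsnd A) s) y - H y) = Lp_int N q (\<lambda>y. comb E s y - F y))"
    using Lp_equidistant_extension[OF q q, of affine_combs "comb E" N "\<lambda>s. comb E (map (apsnd A) s)" N F]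
      comb_A_dist affine_combs_dense[OF assms] assms comb_Lp map_A_combs
    by (auto simp: affine_combs_def Bex_def)
  from someI_ex[OF this] show "lift F \<in> Lp_space N q"
    "s \<in> affine_combs \<Longrightarrow>
      Lp_int N q (\<lambda>y. comb E (map (apsnd A) s) y - lift F y) = Lp_int N q (\<lambda>y. comb E s y - F y)"
    unfolding lift_def by auto
qed

lemma lift_dist:
  assumes "F \<in> Lp_space N q" "F' \<in> Lp_space N q"
  shows "Lp_int N q (\<lambda>y. lift F y - lift F' y) = Lp_int N q (\<lambda>y. F y - F' y)"
proof (rule Lp_equidistant_limits[OF q q, of affine_combs "comb E" N "\<lambda>s. comb E (map (apsnd A) s)" N])
  show "\<exists>s\<in>affine_combs. Lp_int N q (\<lambda>y. comb E s y - F y) < e" if "0 < e" for e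
    using affine_combs_dense assms that by blast
qed (use assms lift_dist_comb lift_Lp comb_Lp map_A_combs in \<open>auto simp: affine_combs_def\<close>)

lemma lift_cong:
  assumes "F \<in> Lp_space N q" "F' \<in> Lp_space N q" "AE y in N. F y = F' y"
  shows "AE y in N. lift F y = lift F' y"
proof -
  have "Lp_int N q (\<lambda>y. F y - F' y) = Lp_int N q (\<lambda>y. 0)"
    using assms(3) by (intro Lp_int_cong_AE) auto
  then have "Lp_int N q (\<lambda>y. lift F y - lift F' y) = 0"
    using lift_dist[OF assms(1,2)] by simp
  then show ?thesis
    using Lp_int_eq_0_iff[OF Lp_space_diff[OF q lift_Lp lift_Lp]] assms by simp
qed

lemma lift_zero: "AE y in N. lift (\<lambda>y. 0) y = E (A (\<lambda>x. 0)) y"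
proof -
  have s: "[(1, \<lambda>x. 0)] \<in> affine_combs" by (simp add: affine_combs_def)
  have "Lp_int N q (\<lambda>y. E (A (\<lambda>x. 0)) y - lift (\<lambda>y. 0) y) = Lp_int N q (\<lambda>y. E (\<lambda>x. 0) y)"
    using lift_dist_comb[OF Lp_zero s] by simp
  also have "\<dots> = 0"
    using E_zero Lp_int_eq_0_iff[OF E_Lp[OF Lp_zero]] by simp
  finally have "AE y in N. E (A (\<lambda>x. 0)) y - lift (\<lambda>y. 0) y = 0"
    using Lp_int_eq_0_iff[OF Lp_space_diff[OF q E_Lp[OF A_Lp[OF Lp_zero]] lift_Lp[OF Lp_zero]]] by simp
  then show ?thesis by (auto elim!: eventually_mono)
qed

text \<open>\<open>F + a F'\<close> is the affine combination of \<open>F\<close>, \<open>F'\<close>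
  and 0 with coefficients 1, \<open>a\<close> and \<open>-a\<close>. For formal combinations the
  identity holds by construction, and both sides pass to the limit.\<close>

lemma lift_affine:
  assumes F: "F \<in> Lp_space N q" and F': "F' \<in> Lp_space N q"
  shows "AE y in N. lift (\<lambda>y. F y + a * F' y) y = lift F y + a * (lift F' y - lift (\<lambda>y. 0) y)"
proof -
  note D = Lp_space_diff[OF q] and S = Lp_space_scale(1)
  note Ad = Lp_space_add[OF q]
  let ?B = "\<lambda>s. comb E (map (apsnd A) s)"
  let ?G = "\<lambda>y. F y + a * F' y"
  have G: "?G \<in> Lp_space N q" using Ad[OF F S[OF F']] .
  obtain s where s: "\<And>n. s n \<in> affine_combs" "(\<lambda>n. Lp_int N q (\<lambda>y. comb E (s n) y - F y)) \<longlonglongrightarrow> 0"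
    using null_sequence_exists[of affine_combs "\<lambda>s. Lp_int N q (\<lambda>y. comb E s y - F y)"] affine_combs_dense[OF F] by force
  obtain t where t: "\<And>n. t n \<in> affine_combs" "(\<lambda>n. Lp_int N q (\<lambda>y. comb E (t n) y - F' y)) \<longlonglongrightarrow> 0"
    using null_sequence_exists[of affine_combs "\<lambda>s. Lp_int N q (\<lambda>y. comb E s y - F' y)"] affine_combs_dense[OF F'] by force
  \<comment> \<open>The last entry restores weight 1. It vanishes before \<open>A\<close> is applied
    and becomes \<open>- a\<close> times \<open>E (A (\<lambda>x. 0))\<close> afterwards, which is
    the origin of the term with \<open>lift (\<lambda>y. 0)\<close>.\<close>
  define r where "r n = s n @ scale a (t n) @ [(- a, \<lambda>x. 0)]" for n
  have r: "r n \<in> affine_combs" for n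
    using s(1)[of n] t(1)[of n] by (auto simp: r_def affine_combs_def image_Un)
  have c: "comb E u \<in> Lp_space N q" "?B u \<in> Lp_space N q" if "u \<in> affine_combs" for u
    using that map_A_combs[OF that] comb_Lp by (auto simp: affine_combs_def)
  have 1: "(\<lambda>n. Lp_int N q (\<lambda>y. comb E (r n) y - ?G y)) \<longlonglongrightarrow> 0"
  proof -
    have "(\<lambda>n. Lp_int N q (\<lambda>y. (comb E (s n) y - F y) + a * (comb E (t n) y - F' y))) \<longlonglongrightarrow> 0"
      by (intro Lp_null_add[OF q] Lp_null_scale s t D S c F F')
    moreover have "Lp_int N q (\<lambda>y. (comb E (s n) y - F y) + a * (comb E (t n) y - F' y))
        = Lp_int N q (\<lambda>y. comb E (r n) y - ?G y)" for n
      using E_zero by (intro Lp_int_cong_AE) (auto simp: r_def algebra_simps)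
    ultimately show ?thesis by simp
  qed
  have 2: "(\<lambda>n. Lp_int N q (\<lambda>y. ?B (r n) y - lift ?G y)) \<longlonglongrightarrow> 0"
    using 1 lift_dist_comb[OF G r] by simp
  have 3: "(\<lambda>n. Lp_int N q (\<lambda>y. ?B (s n) y - lift F y)) \<longlonglongrightarrow> 0"
    using s lift_dist_comb[OF F] by simp
  have 4: "(\<lambda>n. Lp_int N q (\<lambda>y. ?B (t n) y - lift F' y)) \<longlonglongrightarrow> 0"
    using t lift_dist_comb[OF F'] by simp
  let ?R = "\<lambda>y. lift F y + a * (lift F' y - lift (\<lambda>y. 0) y) - lift ?G y"
  have RL: "?R \<in> Lp_space N q"
    by (intro D Ad S lift_Lp F F' G Lp_zero)
  have "(\<lambda>n. Lp_int N q (\<lambda>y. (?B (r n) y - lift ?G y) + ((-1) * (?B (s n) y - lift F y) + (-a) * (?B (t n) y - lift F' y)))) \<longlonglongrightarrow> 0"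
    by (intro Lp_null_add[OF q] Lp_null_scale 2 3 4 D S Ad c r s(1) t(1) lift_Lp F F' G)
  moreover have "Lp_int N q (\<lambda>y. (?B (r n) y - lift ?G y) + ((-1) * (?B (s n) y - lift F y) + (-a) * (?B (t n) y - lift F' y)))
     = Lp_int N q ?R" for n
    using lift_zero by (intro Lp_int_cong_AE) (auto simp: r_def algebra_simps map_apsnd_scale elim!: eventually_mono)
  ultimately have "Lp_int N q ?R = 0"
    by (simp add: LIMSEQ_const_iff)
  then have "AE y in N. ?R y = 0"
    using Lp_int_eq_0_iff[OF RL] by simp
  then show ?thesis by (auto elim!: eventually_mono)
qed

text \<open>Surjectivity is left as a hypothesis: in a group action it comes from the lift of the
  inverse element.\<close>

lemma lift_affine_isometry:
  assumes surj: "\<And>H. H \<in> Lp_space N q \<Longrightarrow> \<exists>F\<in>Lp_space N q. AE y in N. lift F y = H y"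
  shows "Lp_affine_isometry N q lift"
proof -
  note D = Lp_space_diff[OF q] and S = Lp_space_scale(1)
  note Ad = Lp_space_add[OF q]
  let ?c = "lift (\<lambda>y. 0)"
  let ?P = "\<lambda>F y. lift F y - ?c y"
  have cL: "?c \<in> Lp_space N q" by (intro lift_Lp Lp_zero)
  have "Lp_linear_isometry N q ?P"
    unfolding Lp_linear_isometry_def Lp_eq_def
  proof (intro conjI ballI allI impI)
    fix F assume F: "F \<in> Lp_space N q"
    show "?P F \<in> Lp_space N q" by (intro D lift_Lp F Lp_zero)
    show "AE y in N. ?P (\<lambda>x. a * F x) y = a * ?P F y" for a
      using lift_affine[OF Lp_zero F, of a] by (auto elim!: eventually_mono)
    show "\<exists>H\<in>Lp_space N q. AE y in N. ?P H y = F y"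
    proof -
      obtain H where "H \<in> Lp_space N q" "AE y in N. lift H y = F y + ?c y"
        using surj[OF Ad[OF F cL]] by blast
      then show ?thesis by (intro bexI[of _ H]) (auto elim!: eventually_mono)
    qed
    fix F' assume F': "F' \<in> Lp_space N q"
    show "AE y in N. ?P F y = ?P F' y" if "AE y in N. F y = F' y"
      using lift_cong[OF F F' that] by (auto elim!: eventually_mono)
    show "AE y in N. ?P (\<lambda>x. F x + F' x) y = ?P F y + ?P F' y"
      using lift_affine[OF F F', of 1] by (auto elim!: eventually_mono)
    show "Lp_dist N q (?P F) (?P F') = Lp_dist N q F F'"
      using lift_dist[OF F F'] by (subst Lp_dist_eq_iff[OF q]) simp
  qed
  moreover have "\<forall>F\<in>Lp_space N q. Lp_eq N (lift F) (\<lambda>x. ?P F x + ?c x)"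
    by (simp add: Lp_eq_def)
  moreover have "\<forall>F\<in>Lp_space N q. \<forall>F'\<in>Lp_space N q. Lp_eq N F F' \<longrightarrow> Lp_eq N (lift F) (lift F')"
    using lift_cong by (simp add: Lp_eq_def)
  ultimately show ?thesis
    using lift_Lp cL unfolding Lp_affine_isometry_def by blast
qed

end

text \<open>The action laws hold only almost everywhere, so the composite enters as a third map
  \<open>C\<close>. That \<open>E\<close> respects equality almost everywhere follows from
  \<open>E_dist\<close>.\<close>

lemma lift_compose:
  assumes A: "Lp_affine_isometry M p A" and B: "Lp_affine_isometry M p B" and C: "Lp_affine_isometry M p C"
    and eq: "\<And>f. f \<in> Lp_space M p \<Longrightarrow> AE x in M. C f x = A (B f) x"
    and F: "F \<in> Lp_space N q"
  shows "AE y in N. lift C F y = lift A (lift B F) y"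
proof -
  note D = Lp_space_diff[OF q]
  have E_cong: "AE y in N. E f y = E g y" if "f \<in> Lp_space M p" "g \<in> Lp_space M p" "AE x in M. f x = g x" for f g
  proof -
    have "Lp_int M p (\<lambda>x. f x - g x) = Lp_int M p (\<lambda>x. 0)"
      using that(3) by (intro Lp_int_cong_AE) auto
    then have "Lp_int N q (\<lambda>y. E f y - E g y) = 0"
      using E_dist[OF that(1,2)] by simp
    then show ?thesis using Lp_int_eq_0_iff[OF D[OF E_Lp E_Lp]] that by simp
  qed
  have comb_eq: "AE y in N. comb E (map (apsnd C) s) y = comb E (map (apsnd A) (map (apsnd B) s)) y"
    if "snd ` set s \<subseteq> Lp_space M p" for s
    using that
  proof (induction s)
    case (Cons af s)
    obtain a f where af: "af = (a, f)" by fastforce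
    then have f: "f \<in> Lp_space M p" using Cons by auto
    have "AE y in N. E (C f) y = E (A (B f)) y"
      using f eq by (intro E_cong A_Lp[OF C] A_Lp[OF A] A_Lp[OF B]) auto
    moreover have "AE y in N. comb E (map (apsnd C) s) y = comb E (map (apsnd A) (map (apsnd B) s)) y"
      using Cons by simp
    ultimately show ?case by eventually_elim (simp add: af)
  qed simp
  have BF: "lift B F \<in> Lp_space N q" by (rule lift_Lp[OF B F])
  obtain s where s: "\<And>n. s n \<in> affine_combs" "(\<lambda>n. Lp_int N q (\<lambda>y. comb E (s n) y - F y)) \<longlonglongrightarrow> 0"
    using null_sequence_exists[of affine_combs "\<lambda>s. Lp_int N q (\<lambda>y. comb E s y - F y)"] affine_combs_dense[OF F] by force
  let ?CA = "\<lambda>n. comb E (map (apsnd A) (map (apsnd B) (s n)))"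
  let ?CC = "\<lambda>n. comb E (map (apsnd C) (s n))"
  have 1: "(\<lambda>n. Lp_int N q (\<lambda>y. ?CC n y - lift C F y)) \<longlonglongrightarrow> 0"
    using s lift_dist_comb[OF C F] by simp
  have 2: "(\<lambda>n. Lp_int N q (\<lambda>y. ?CA n y - lift A (lift B F) y)) \<longlonglongrightarrow> 0"
    using s lift_dist_comb[OF B F] lift_dist_comb[OF A BF map_A_combs[OF B]] by simp
  have L: "?CC n \<in> Lp_space N q" "?CA n \<in> Lp_space N q" for n
    using map_A_combs[OF C s(1)[of n]] map_A_combs[OF A map_A_combs[OF B s(1)[of n]]] comb_Lp
    by (auto simp: affine_combs_def)
  have "(\<lambda>n. Lp_int N q (\<lambda>y. (?CA n y - lift A (lift B F) y) + (-1) * (?CC n y - lift C F y))) \<longlonglongrightarrow> 0"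
    by (intro Lp_null_add[OF q] Lp_null_scale 1 2 D Lp_space_scale(1) L lift_Lp[OF A] lift_Lp[OF C] F BF)
  moreover have "Lp_int N q (\<lambda>y. (?CA n y - lift A (lift B F) y) + (-1) * (?CC n y - lift C F y))
      = Lp_int N q (\<lambda>y. lift C F y - lift A (lift B F) y)" for n
  proof (rule Lp_int_cong_AE)
    have "snd ` set (s n) \<subseteq> Lp_space M p" using s(1)[of n] by (simp add: affine_combs_def)
    from comb_eq[OF this]
    show "AE y in N. (?CA n y - lift A (lift B F) y) + (-1) * (?CC n y - lift C F y) = lift C F y - lift A (lift B F) y"
      by eventually_elim simp
  qed
  ultimately have "Lp_int N q (\<lambda>y. lift C F y - lift A (lift B F) y) = 0"
    by (simp add: LIMSEQ_const_iff)
  then show ?thesis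
    using Lp_int_eq_0_iff[OF D[OF lift_Lp[OF C F] lift_Lp[OF A BF]]] by simp
qed

text \<open>\<open>A\<close> agrees with its square, hence so does its lift. An idempotent isometry
  moves nothing: the distance from \<open>F\<close> to its image equals that from the image to its
  own image, which is 0.\<close>

lemma lift_identity:
  assumes A: "Lp_affine_isometry M p A" and eq: "\<And>f. f \<in> Lp_space M p \<Longrightarrow> AE x in M. A f x = f x"
    and F: "F \<in> Lp_space N q"
  shows "AE y in N. lift A F y = F y"
proof -
  have "AE x in M. A f x = A (A f) x" if "f \<in> Lp_space M p" for f
    using eq[OF A_Lp[OF A that]] by (rule eventually_mono) (rule sym)
  from lift_compose[OF A A A this F] have "AE y in N. lift A F y = lift A (lift A F) y" .
  then have "Lp_int N q (\<lambda>y. lift A F y - lift A (lift A F) y) = Lp_int N q (\<lambda>y. 0)"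
    by (intro Lp_int_cong_AE) (erule eventually_mono, simp)
  then have "Lp_int N q (\<lambda>y. F y - lift A F y) = 0"
    using lift_dist[OF A F lift_Lp[OF A F]] by simp
  then have "AE y in N. F y - lift A F y = 0"
    using Lp_int_eq_0_iff[OF Lp_space_diff[OF q F lift_Lp[OF A F]]] by simp
  then show ?thesis by (auto elim!: eventually_mono)
qed

section \<open>Continuity and the lifted action\<close>

lemma comb_continuous:
  assumes "topspace T = carrier G"
    and \<alpha>: "cont_affine_isometric_action G T M p \<alpha>" and g0: "g0 \<in> carrier G"
    and "snd ` set s \<subseteq> Lp_space M p" "0 < e"
  shows "\<exists>U. openin T U \<and> g0 \<in> U \<and>
    (\<forall>g\<in>U. Lp_int N q (\<lambda>y. comb E (map (apsnd (\<alpha> g)) s) y - comb E (map (apsnd (\<alpha> g0)) s) y) < e)"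
  using assms(4,5)
proof (induction s arbitrary: e)
  case Nil
  then show ?case using g0 assms(1) openin_topspace[of T] by auto
next
  case (Cons af s)
  obtain a f where af: "af = (a, f)" by fastforce
  have f: "f \<in> Lp_space M p" and s: "snd ` set s \<subseteq> Lp_space M p" using Cons af by auto
  \<comment> \<open>Errors below \<open>d\<close> in the head and in the tail add up to at most
    \<open>2 powr q * (cmod a powr q + 1) * d\<close>; the extra factor 2 makes the final bound
    strict.\<close>
  define k where "k = 2 powr q * (2 * (cmod a powr q + 1))"
  have k: "0 < k" by (simp add: k_def add_nonneg_pos)
  define d where "d = e / k"
  have "0 < d" "k * d = e" using Cons.prems k by (auto simp: d_def)
  then have d: "0 < d" "2 powr q * (2 * (cmod a powr q + 1) * d) = e"
    by (auto simp: k_def mult.assoc)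
  obtain U where U: "openin T U" "g0 \<in> U"
    "\<And>g. g \<in> U \<Longrightarrow> Lp_int N q (\<lambda>y. comb E (map (apsnd (\<alpha> g)) s) y - comb E (map (apsnd (\<alpha> g0)) s) y) < d"
    using Cons.IH[OF s d(1)] by blast
  \<comment> \<open>The threshold for the metric that corresponds to the threshold \<open>d\<close>
    for \<open>Lp_int\<close>.\<close>
  define d' where "d' = (if p < 1 then d else d powr (1 / p))"
  have d': "0 < d'" "(if p < 1 then d' else d' powr p) = d" using d(1) p by (auto simp: d'_def powr_powr)
  obtain V where V: "openin T V" "g0 \<in> V" "\<And>g. g \<in> V \<Longrightarrow> Lp_dist M p (\<alpha> g f) (\<alpha> g0 f) < d'"
  proof -
    have "\<forall>f\<in>Lp_space M p. \<forall>g0\<in>carrier G. \<forall>e>0. \<exists>U. openin T U \<and> g0 \<in> U \<and>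
        (\<forall>g\<in>U. Lp_dist M p (\<alpha> g f) (\<alpha> g0 f) < e)"
      using \<alpha> by (simp add: cont_affine_isometric_action_def)
    from this[rule_format, OF f g0 d'(1)] show ?thesis using that by blast
  qed
  have V': "Lp_int M p (\<lambda>x. \<alpha> g f x - \<alpha> g0 f x) < d" if "g \<in> V" for g
    using V(3)[OF that] unfolding Lp_dist_less_iff[OF p d'(1)] d'(2) .
  have "Lp_int N q (\<lambda>y. comb E (map (apsnd (\<alpha> g)) (af # s)) y - comb E (map (apsnd (\<alpha> g0)) (af # s)) y) < e"
    if g: "g \<in> U \<inter> V" for g
  proof -
    have gc: "g \<in> carrier G" using openin_subset[OF U(1)] g assms(1) by auto
    have AI: "Lp_affine_isometry M p (\<alpha> g)" "Lp_affine_isometry M p (\<alpha> g0)"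
      using \<alpha> gc g0 by (auto simp: cont_affine_isometric_action_def)
    have L: "\<alpha> g h \<in> Lp_space M p" "\<alpha> g0 h \<in> Lp_space M p" if "h \<in> Lp_space M p" for h
      using A_Lp AI that by auto
    let ?x = "\<lambda>y. a * (E (\<alpha> g f) y - E (\<alpha> g0 f) y)"
    let ?z = "\<lambda>y. comb E (map (apsnd (\<alpha> g)) s) y - comb E (map (apsnd (\<alpha> g0)) s) y"
    have x0: "(\<lambda>y. E (\<alpha> g f) y - E (\<alpha> g0 f) y) \<in> Lp_space N q"
      by (intro Lp_space_diff[OF q] E_Lp L f)
    have x: "?x \<in> Lp_space N q" "Lp_int N q ?x = cmod a powr q * Lp_int M p (\<lambda>x. \<alpha> g f x - \<alpha> g0 f x)"
      using Lp_space_scale[OF x0] E_dist[OF L(1)[OF f] L(2)[OF f]] by auto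
    have z: "?z \<in> Lp_space N q" using L s by (intro Lp_space_diff[OF q] comb_Lp) auto
    have "Lp_int N q (\<lambda>y. comb E (map (apsnd (\<alpha> g)) (af # s)) y - comb E (map (apsnd (\<alpha> g0)) (af # s)) y)
        = Lp_int N q (\<lambda>y. ?x y + ?z y)" by (simp add: af algebra_simps)
    also have "\<dots> \<le> 2 powr q * (Lp_int N q ?x + Lp_int N q ?z)"
      by (rule Lp_int_add_le[OF q x(1) z])
    also have "\<dots> \<le> 2 powr q * (cmod a powr q * d + d)"
      using V'[of g] U(3)[of g] g x(2) by (intro mult_left_mono add_mono) (auto intro: mult_left_mono)
    also have "\<dots> < 2 powr q * (2 * (cmod a powr q + 1) * d)"
    proof -
      have "0 \<le> cmod a powr q * d" "0 < d" using d(1) by auto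
      then have "cmod a powr q * d + d < 2 * (cmod a powr q + 1) * d" by (simp add: algebra_simps add_pos_nonneg)
      then show ?thesis by simp
    qed
    finally show ?thesis using d(2) by simp
  qed
  then show ?case using openin_Int[OF U(1) V(1)] U(2) V(2) by blast
qed

text \<open>Continuity need be known on affine combinations only: the lifts are isometric, so one
  approximation of \<open>F\<close> is equally good for all group elements at once.\<close>

theorem lifted_action:
  assumes G: "group G" and T: "topspace T = carrier G"
    and \<alpha>: "cont_affine_isometric_action G T M p \<alpha>"
  shows "\<exists>\<beta>. cont_affine_isometric_action G T N q \<beta> \<and>
     (\<forall>g\<in>carrier G. Lp_int M p (\<alpha> g (\<lambda>x. 0)) = Lp_int N q (\<beta> g (\<lambda>x. 0)))"
proof -
  interpret group G by fact
  note D = Lp_space_diff[OF q]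
  define \<beta> where "\<beta> g = lift (\<alpha> g)" for g
  have AI: "Lp_affine_isometry M p (\<alpha> g)" if "g \<in> carrier G" for g
    using \<alpha> that by (auto simp: cont_affine_isometric_action_def)
  have AL: "\<alpha> g f \<in> Lp_space M p" if "g \<in> carrier G" "f \<in> Lp_space M p" for g f
    using A_Lp[OF AI] that by auto
  have BL: "\<beta> g F \<in> Lp_space N q" if "g \<in> carrier G" "F \<in> Lp_space N q" for g F
    unfolding \<beta>_def using lift_Lp[OF AI] that by auto
  have one: "AE y in N. \<beta> \<one>\<^bsub>G\<^esub> F y = F y" if "F \<in> Lp_space N q" for F
    unfolding \<beta>_def using \<alpha> that
    by (intro lift_identity AI) (auto simp: cont_affine_isometric_action_def Lp_eq_def)
  have mult: "AE y in N. \<beta> (g \<otimes>\<^bsub>G\<^esub> h) F y = \<beta> g (\<beta> h F) y"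
    if "F \<in> Lp_space N q" "g \<in> carrier G" "h \<in> carrier G" for F g h
    unfolding \<beta>_def using \<alpha> that
    by (intro lift_compose AI) (auto simp: cont_affine_isometric_action_def Lp_eq_def)
  have iso: "Lp_affine_isometry N q (\<beta> g)" if g: "g \<in> carrier G" for g
    unfolding \<beta>_def
  proof (rule lift_affine_isometry[OF AI[OF g]])
    fix H assume H: "H \<in> Lp_space N q"
    have "AE y in N. \<beta> g (\<beta> (inv\<^bsub>G\<^esub> g) H) y = H y"
      using mult[OF H g inv_closed[OF g]] one[OF H] g by (auto elim!: eventually_elim2)
    then show "\<exists>F\<in>Lp_space N q. AE y in N. lift (\<alpha> g) F y = H y"
      using BL[OF inv_closed[OF g] H] unfolding \<beta>_def by blast
  qed
  have cont: "\<exists>U. openin T U \<and> g0 \<in> U \<and> (\<forall>g\<in>U. Lp_dist N q (\<beta> g F) (\<beta> g0 F) < e)"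
    if F: "F \<in> Lp_space N q" and g0: "g0 \<in> carrier G" and "0 < e" for F g0 e
  proof -
    define d where "d = (if q < 1 then e else e powr q)"
    define k where "k = 2 powr q"
    \<comment> \<open>Solves \<open>k * (r + k * (r + r)) = d\<close>, the total loss of two nested
      quasi-triangle inequalities applied to three errors of size \<open>r\<close>.\<close>
    define r where "r = d / (k * (2 * k + 1)) "
    have k: "0 < k" and d: "0 < d" using \<open>0 < e\<close> by (auto simp: d_def k_def)
    have r: "0 < r" using k d by (simp add: r_def add_pos_pos)
    have kr: "k * (r + k * (r + r)) = d"
    proof -
      have "k * (r + k * (r + r)) = (k * (2 * k + 1)) * r" by (simp add: algebra_simps)
      also have "k * (2 * k + 1) \<noteq> 0" using k by simp
      then have "(k * (2 * k + 1)) * r = d" unfolding r_def by simp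
      finally show ?thesis .
    qed
    obtain s where s: "s \<in> affine_combs" "Lp_int N q (\<lambda>y. comb E s y - F y) < r"
      using affine_combs_dense[OF F r] by blast
    then have sL: "snd ` set s \<subseteq> Lp_space M p" by (simp add: affine_combs_def)
    obtain U where U: "openin T U" "g0 \<in> U"
      "\<And>g. g \<in> U \<Longrightarrow> Lp_int N q (\<lambda>y. comb E (map (apsnd (\<alpha> g)) s) y - comb E (map (apsnd (\<alpha> g0)) s) y) < r"
      using comb_continuous[OF T \<alpha> g0 sL r] by blast
    have "Lp_dist N q (\<beta> g F) (\<beta> g0 F) < e" if "g \<in> U" for g
    proof -
      have g: "g \<in> carrier G" using openin_subset[OF U(1)] that T by auto
      let ?c = "\<lambda>g. comb E (map (apsnd (\<alpha> g)) s)"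
      have L: "?c h \<in> Lp_space N q" if "h \<in> carrier G" for h
        using sL AL[OF that] by (intro comb_Lp) auto
      have near: "Lp_int N q (\<lambda>y. ?c h y - \<beta> h F y) < r" if "h \<in> carrier G" for h
        unfolding \<beta>_def using lift_dist_comb[OF AI[OF that] F s(1)] s(2) by simp
      have "Lp_int N q (\<lambda>y. \<beta> g F y - \<beta> g0 F y)
         \<le> k * (Lp_int N q (\<lambda>y. \<beta> g F y - ?c g y) + Lp_int N q (\<lambda>y. ?c g y - \<beta> g0 F y))"
        unfolding k_def by (intro Lp_int_triangle q BL L g g0 F)
      also have "\<dots> \<le> k * (Lp_int N q (\<lambda>y. ?c g y - \<beta> g F y)
          + k * (Lp_int N q (\<lambda>y. ?c g y - ?c g0 y) + Lp_int N q (\<lambda>y. ?c g0 y - \<beta> g0 F y)))"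
        unfolding k_def Lp_int_minus_commute[of N q "\<beta> g F"]
        by (intro mult_left_mono add_left_mono Lp_int_triangle q BL L g g0 F) auto
      also have "\<dots> < k * (r + k * (r + r))"
        using near[OF g] near[OF g0] U(3)[OF that] k
        by (intro mult_strict_left_mono add_strict_mono) auto
      finally show ?thesis
        unfolding Lp_dist_less_iff[OF q \<open>0 < e\<close>] using kr by (simp add: d_def)
    qed
    then show ?thesis using U(1,2) by blast
  qed
  have "cont_affine_isometric_action G T N q \<beta>"
    unfolding cont_affine_isometric_action_def Lp_eq_def
    by (intro conjI ballI allI impI iso one mult cont)
  moreover have "Lp_int M p (\<alpha> g (\<lambda>x. 0)) = Lp_int N q (\<beta> g (\<lambda>x. 0))" if g: "g \<in> carrier G" for g
  proof -
    have "Lp_int N q (\<beta> g (\<lambda>x. 0)) = Lp_int N q (\<lambda>y. E (\<alpha> g (\<lambda>x. 0)) y - E (\<lambda>x. 0) y)"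
      unfolding \<beta>_def using lift_zero[OF AI[OF g]] E_zero
      by (intro Lp_int_cong_AE) (auto elim!: eventually_elim2)
    then show ?thesis using E_dist[OF AL[OF g Lp_zero] Lp_zero] by simp
  qed
  ultimately show ?thesis by blast
qed

end

section \<open>Density of algebras of bounded functions\<close>

text \<open>A Stone-Weierstrass setting without unit, since on an infinite measure space the
  constants are not in L_q. \<open>\<A>_gen\<close> takes the place of separation of points,
  \<open>\<A>_full\<close> that of having no common zero. Products and conjugates are required only
  up to null sets because functions merely represent elements of L_q.\<close>

locale Lp_algebra =
  fixes N :: "'b measure" and q :: real and \<A> :: "('b \<Rightarrow> complex) set"
  assumes q: "0 < q"
    and \<A>_Lp: "u \<in> \<A> \<Longrightarrow> u \<in> Lp_space N q"
    and \<A>_bdd: "u \<in> \<A> \<Longrightarrow> \<exists>B. AE y in N. cmod (u y) \<le> B"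
    and \<A>_add: "u \<in> \<A> \<Longrightarrow> v \<in> \<A> \<Longrightarrow> (\<lambda>y. u y + v y) \<in> \<A>"
    and \<A>_scale: "u \<in> \<A> \<Longrightarrow> (\<lambda>y. c * u y) \<in> \<A>"
    and \<A>_mult: "u \<in> \<A> \<Longrightarrow> v \<in> \<A> \<Longrightarrow> \<exists>w\<in>\<A>. AE y in N. w y = u y * v y"
    and \<A>_cnj: "u \<in> \<A> \<Longrightarrow> \<exists>w\<in>\<A>. AE y in N. w y = cnj (u y)"
    and \<A>_gen: "B \<in> sets N \<Longrightarrow> \<exists>B'\<in>sigma_sets (space N) {{y \<in> space N. Re (u y) < r} | u r. u \<in> \<A>}.
      AE y in N. y \<in> B \<longleftrightarrow> y \<in> B'"
    and \<A>_full: "\<exists>C :: nat \<Rightarrow> _. range C \<subseteq> \<A> \<and> (AE y in N. \<exists>n. C n y \<noteq> 0)"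
begin

text \<open>\<open>V\<close> is the closure of the algebra and \<open>H\<close> the set of its bounded multipliers. The latter is closed under
  products and bounded limits, so the sets whose indicators lie in \<open>H\<close> form a \<open>\<sigma>\<close>-algebra.\<close>

definition "V = {F \<in> Lp_space N q. \<exists>u :: nat \<Rightarrow> _. range u \<subseteq> \<A> \<and> (\<lambda>n. Lp_int N q (\<lambda>y. u n y - F y)) \<longlonglongrightarrow> 0}"

definition "H = {h \<in> borel_measurable N. (\<exists>B. AE y in N. cmod (h y) \<le> B) \<and> (\<forall>F\<in>V. (\<lambda>y. h y * F y) \<in> V)}"

lemma V_Lp: "F \<in> V \<Longrightarrow> F \<in> Lp_space N q"
  by (simp add: V_def)

lemma \<A>_V: "u \<in> \<A> \<Longrightarrow> u \<in> V"
  using \<A>_Lp by (auto simp: V_def intro!: exI[of _ "\<lambda>_. u"])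

lemma V_closed:
  assumes F: "\<And>n::nat. F n \<in> V" and G: "G \<in> Lp_space N q"
    and lim: "(\<lambda>n. Lp_int N q (\<lambda>y. F n y - G y)) \<longlonglongrightarrow> 0"
  shows "G \<in> V"
proof -
  have "\<exists>u\<in>\<A>. Lp_int N q (\<lambda>y. u y - G y) < e" if "0 < e" for e
  proof -
    define d where "d = e / 2 powr q / 2"
    have d: "0 < d" "2 powr q * (d + d) = e" using that by (auto simp: d_def)
    obtain n where n: "Lp_int N q (\<lambda>y. F n y - G y) < d"
      using order_tendstoD(2)[OF lim d(1)] by (auto simp: eventually_sequentially)
    obtain u where u: "range u \<subseteq> \<A>" "(\<lambda>k::nat. Lp_int N q (\<lambda>y. u k y - F n y)) \<longlonglongrightarrow> 0"
      using F[of n] by (auto simp: V_def)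
    obtain k where k: "Lp_int N q (\<lambda>y. u k y - F n y) < d"
      using order_tendstoD(2)[OF u(2) d(1)] by (auto simp: eventually_sequentially)
    have "u k \<in> \<A>" using u(1) by auto
    have "Lp_int N q (\<lambda>y. u k y - G y) \<le> 2 powr q * (Lp_int N q (\<lambda>y. u k y - F n y) + Lp_int N q (\<lambda>y. F n y - G y))"
      by (intro Lp_int_triangle q \<A>_Lp V_Lp \<open>u k \<in> \<A>\<close> F G)
    also have "\<dots> < 2 powr q * (d + d)" using n k by simp
    finally show ?thesis using d(2) \<open>u k \<in> \<A>\<close> by auto
  qed
  then obtain s where "\<And>n::nat. s n \<in> \<A>" "(\<lambda>n. Lp_int N q (\<lambda>y. s n y - G y)) \<longlonglongrightarrow> 0"
    using null_sequence_exists[of \<A> "\<lambda>u. Lp_int N q (\<lambda>y. u y - G y)"] by force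
  then show ?thesis using G by (auto simp: V_def)
qed

lemma V_AE:
  assumes "F \<in> V" "G \<in> borel_measurable N" "AE y in N. F y = G y"
  shows "G \<in> V"
proof (rule V_closed[of "\<lambda>_. F"])
  show "G \<in> Lp_space N q"
    by (rule Lp_space_bound(1)[OF V_Lp[OF assms(1)] assms(2)]) (use assms(3) in auto)
  have "Lp_int N q (\<lambda>y. F y - G y) = Lp_int N q (\<lambda>y. 0)"
    using assms(3) by (intro Lp_int_cong_AE) auto
  then show "(\<lambda>n. Lp_int N q (\<lambda>y. F y - G y)) \<longlonglongrightarrow> 0" by simp
qed fact

lemma V_add:
  assumes "F \<in> V" "G \<in> V"
  shows "(\<lambda>y. F y + G y) \<in> V"
proof -
  note D = Lp_space_diff[OF q]
  obtain u where u: "range u \<subseteq> \<A>" "(\<lambda>k::nat. Lp_int N q (\<lambda>y. u k y - F y)) \<longlonglongrightarrow> 0"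
    using assms(1) by (auto simp: V_def)
  obtain v where v: "range v \<subseteq> \<A>" "(\<lambda>k::nat. Lp_int N q (\<lambda>y. v k y - G y)) \<longlonglongrightarrow> 0"
    using assms(2) by (auto simp: V_def)
  have uv: "u k \<in> \<A>" "v k \<in> \<A>" for k using u v by auto
  have "(\<lambda>k. Lp_int N q (\<lambda>y. (u k y - F y) + (v k y - G y))) \<longlonglongrightarrow> 0"
    by (intro Lp_null_add q u(2) v(2) D \<A>_Lp uv V_Lp assms)
  then have "(\<lambda>k. Lp_int N q (\<lambda>y. (u k y + v k y) - (F y + G y))) \<longlonglongrightarrow> 0"
    by (simp add: algebra_simps)
  then show ?thesis
    by (rule V_closed[rotated 2]) (intro \<A>_V \<A>_add uv Lp_space_add q V_Lp assms)+
qed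

lemma V_scale:
  assumes "F \<in> V"
  shows "(\<lambda>y. c * F y) \<in> V"
proof -
  note D = Lp_space_diff[OF q]
  obtain u where u: "range u \<subseteq> \<A>" "(\<lambda>k::nat. Lp_int N q (\<lambda>y. u k y - F y)) \<longlonglongrightarrow> 0"
    using assms(1) by (auto simp: V_def)
  have uv: "u k \<in> \<A>" for k using u by auto
  have "(\<lambda>k. Lp_int N q (\<lambda>y. c * (u k y - F y))) \<longlonglongrightarrow> 0"
    by (intro Lp_null_scale u(2) D \<A>_Lp uv V_Lp assms)
  then have "(\<lambda>k. Lp_int N q (\<lambda>y. c * u k y - c * F y)) \<longlonglongrightarrow> 0"
    by (simp add: algebra_simps)
  then show ?thesis
    by (rule V_closed[rotated 2]) (intro \<A>_V \<A>_scale uv Lp_space_scale(1) q V_Lp assms)+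
qed

lemma bounded_mult_Lp:
  assumes "h \<in> borel_measurable N" "AE y in N. cmod (h y) \<le> B" "F \<in> Lp_space N q"
  shows "(\<lambda>y. h y * F y) \<in> Lp_space N q"
    "Lp_int N q (\<lambda>y. h y * F y) \<le> \<bar>B\<bar> powr q * Lp_int N q F"
proof -
  have [measurable]: "h \<in> borel_measurable N" "F \<in> borel_measurable N" using assms by auto
  have "AE y in N. cmod (h y * F y) powr q \<le> cmod (complex_of_real \<bar>B\<bar> * F y) powr q"
    using assms(2)
  proof eventually_elim
    case (elim y)
    then have "cmod (h y * F y) \<le> cmod (complex_of_real \<bar>B\<bar> * F y)"
      by (auto simp: norm_mult intro!: mult_right_mono)
    then show ?case using q by (intro powr_mono2) auto
  qed
  from Lp_space_bound[OF Lp_space_scale(1)[OF assms(3)] _ this] Lp_space_scale(2)[OF assms(3), of "complex_of_real \<bar>B\<bar>"]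
  show "(\<lambda>y. h y * F y) \<in> Lp_space N q" "Lp_int N q (\<lambda>y. h y * F y) \<le> \<bar>B\<bar> powr q * Lp_int N q F"
    by auto
qed

lemma H_I:
  assumes "h \<in> borel_measurable N" "AE y in N. cmod (h y) \<le> B" "\<And>F. F \<in> V \<Longrightarrow> (\<lambda>y. h y * F y) \<in> V"
  shows "h \<in> H"
  using assms by (auto simp: H_def)

lemma H_measurable: "h \<in> H \<Longrightarrow> h \<in> borel_measurable N"
  by (simp add: H_def)

lemma H_bdd: "h \<in> H \<Longrightarrow> \<exists>B. AE y in N. cmod (h y) \<le> B"
  by (simp add: H_def)

lemma H_mult_V: "h \<in> H \<Longrightarrow> F \<in> V \<Longrightarrow> (\<lambda>y. h y * F y) \<in> V"
  by (simp add: H_def)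

lemma H_const: "(\<lambda>y. c) \<in> H"
  by (auto simp: H_def V_scale)

lemma H_add:
  assumes "h \<in> H" "k \<in> H"
  shows "(\<lambda>y. h y + k y) \<in> H"
proof -
  obtain B C where "AE y in N. cmod (h y) \<le> B" "AE y in N. cmod (k y) \<le> C"
    using assms H_bdd by blast
  then have "AE y in N. cmod (h y + k y) \<le> B + C"
    by eventually_elim (rule norm_triangle_mono)
  moreover have "(\<lambda>y. (h y + k y) * F y) \<in> V" if "F \<in> V" for F
    using V_add[OF H_mult_V[OF assms(1) that] H_mult_V[OF assms(2) that]] by (simp add: algebra_simps)
  moreover have "(\<lambda>y. h y + k y) \<in> borel_measurable N"
    using H_measurable[OF assms(1)] H_measurable[OF assms(2)] by measurable
  ultimately show ?thesis by (rule H_I[rotated])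
qed

lemma H_mult:
  assumes "h \<in> H" "k \<in> H"
  shows "(\<lambda>y. h y * k y) \<in> H"
proof -
  obtain B C where "AE y in N. cmod (h y) \<le> B" "AE y in N. cmod (k y) \<le> C"
    using assms H_bdd by blast
  then have "AE y in N. cmod (h y * k y) \<le> B * C"
  proof eventually_elim
    case (elim y)
    then show ?case unfolding norm_mult by (intro mult_mono) (auto intro: order_trans[OF norm_ge_zero])
  qed
  moreover have "(\<lambda>y. (h y * k y) * F y) \<in> V" if "F \<in> V" for F
    using H_mult_V[OF assms(1) H_mult_V[OF assms(2) that]] by (simp add: algebra_simps)
  moreover have "(\<lambda>y. h y * k y) \<in> borel_measurable N"
    using H_measurable[OF assms(1)] H_measurable[OF assms(2)] by measurable
  ultimately show ?thesis by (rule H_I[rotated])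
qed

lemma H_limit:
  assumes h: "\<And>n::nat. h n \<in> H" and k: "k \<in> borel_measurable N"
    and B: "\<And>n. AE y in N. cmod (h n y) \<le> B" and lim: "AE y in N. (\<lambda>n. h n y) \<longlonglongrightarrow> k y"
  shows "k \<in> H"
proof -
  note [measurable] = H_measurable[OF h] k
  have "AE y in N. \<forall>n. cmod (h n y) \<le> B" using B by (simp add: AE_all_countable)
  then have "AE y in N. cmod (k y) \<le> B"
    using lim
  proof eventually_elim
    case (elim x)
    then show ?case by (intro tendsto_upperbound[OF tendsto_norm[OF elim(2)]]) auto
  qed
  moreover have "(\<lambda>y. k y * F y) \<in> V" if F: "F \<in> V" for F
  proof -
    have [measurable]: "F \<in> borel_measurable N" using V_Lp[OF F] by auto
    have "AE y in N. (\<lambda>n. h n y * F y) \<longlonglongrightarrow> k y * F y"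
      using lim by eventually_elim (intro tendsto_intros)
    moreover have "AE y in N. cmod (h n y * F y) \<le> cmod (complex_of_real \<bar>B\<bar> * F y)" for n
      using B[of n] by eventually_elim (auto simp: norm_mult intro!: mult_right_mono)
    ultimately have "(\<lambda>y. k y * F y) \<in> Lp_space N q"
       "(\<lambda>n. Lp_int N q (\<lambda>y. h n y * F y - k y * F y)) \<longlonglongrightarrow> 0"
      using Lp_int_dominated[where M = N and f = "\<lambda>n y. h n y * F y" and g = "\<lambda>y. k y * F y" and w = "\<lambda>y. complex_of_real \<bar>B\<bar> * F y"]
        Lp_space_scale(1)[OF V_Lp[OF F]] q by auto
    then show ?thesis
      using V_closed[of "\<lambda>n y. h n y * F y"] H_mult_V[OF h F] by blast
  qed
  ultimately show ?thesis using k by (auto simp: H_def)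
qed

lemma H_AE:
  assumes "h \<in> H" "k \<in> borel_measurable N" "AE y in N. h y = k y"
  shows "k \<in> H"
proof -
  obtain B where "AE y in N. cmod (h y) \<le> B" using H_bdd assms by blast
  moreover have "AE y in N. (\<lambda>n. h y) \<longlonglongrightarrow> k y"
    using assms(3) by eventually_elim simp
  ultimately show ?thesis by (rule H_limit[OF assms(1,2)])
qed

text \<open>Multiplication by a bounded function is continuous on L_q and maps \<open>\<A>\<close>
  into \<open>V\<close>, so it maps the closure \<open>V\<close> into itself.\<close>

lemma \<A>_H:
  assumes u: "u \<in> \<A>"
  shows "u \<in> H"
proof -
  obtain B where B: "AE y in N. cmod (u y) \<le> B" using \<A>_bdd[OF u] by blast
  have um: "u \<in> borel_measurable N" using \<A>_Lp[OF u] by auto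
  have "(\<lambda>y. u y * F y) \<in> V" if F: "F \<in> V" for F
  proof -
    obtain v where v: "range v \<subseteq> \<A>" "(\<lambda>k::nat. Lp_int N q (\<lambda>y. v k y - F y)) \<longlonglongrightarrow> 0"
      using F by (auto simp: V_def)
    have vA: "v k \<in> \<A>" for k using v by auto
    have uv: "(\<lambda>y. u y * v k y) \<in> V" for k
    proof -
      obtain w where "w \<in> \<A>" "AE y in N. w y = u y * v k y" using \<A>_mult[OF u vA] by blast
      then show ?thesis using um \<A>_Lp[OF vA[of k]] by (intro V_AE[OF \<A>_V]) auto
    qed
    have "(\<lambda>k. Lp_int N q (\<lambda>y. u y * v k y - u y * F y)) \<longlonglongrightarrow> 0"
    proof (rule real_tendsto_sandwich[where f = "\<lambda>_. 0"])
      show "(\<lambda>k. \<bar>B\<bar> powr q * Lp_int N q (\<lambda>y. v k y - F y)) \<longlonglongrightarrow> 0"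
        using tendsto_mult[OF tendsto_const v(2), of "\<bar>B\<bar> powr q"] by simp
      have "Lp_int N q (\<lambda>y. u y * v k y - u y * F y) \<le> \<bar>B\<bar> powr q * Lp_int N q (\<lambda>y. v k y - F y)" for k
        using bounded_mult_Lp(2)[OF um B Lp_space_diff[OF q \<A>_Lp[OF vA[of k]] V_Lp[OF F]]]
        by (simp add: algebra_simps)
      then show "\<forall>\<^sub>F k in sequentially. Lp_int N q (\<lambda>y. u y * v k y - u y * F y) \<le> \<bar>B\<bar> powr q * Lp_int N q (\<lambda>y. v k y - F y)"
        by simp
    qed auto
    then show ?thesis
      using uv bounded_mult_Lp(1)[OF um B V_Lp[OF F]] V_closed[of "\<lambda>k y. u y * v k y"] by blast
  qed
  then show ?thesis using um B by (auto simp: H_def)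
qed

lemma cnj_H:
  assumes u: "u \<in> \<A>"
  shows "(\<lambda>y. cnj (u y)) \<in> H"
proof -
  obtain w where "w \<in> \<A>" "AE y in N. w y = cnj (u y)" using \<A>_cnj[OF u] by blast
  moreover have "(\<lambda>y. cnj (u y)) \<in> borel_measurable N"
    by (rule measurable_compose[OF Lp_space_measurable[OF \<A>_Lp[OF u]]])
       (intro borel_measurable_continuous_onI continuous_intros)
  ultimately show ?thesis using H_AE[OF \<A>_H] by blast
qed

text \<open>Multipliers always include the constants, while \<open>\<A>\<close> may not; this admits
  polynomials with a constant term.\<close>

lemma H_polynomial:
  fixes \<rho> :: "'b \<Rightarrow> real"
  assumes "real_polynomial_function g" "(\<lambda>y. complex_of_real (\<rho> y)) \<in> H"
  shows "(\<lambda>y. complex_of_real (g (\<rho> y))) \<in> H"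
  using assms(1)
proof (induction g)
  case (linear f)
  then interpret f: bounded_linear f .
  have "f x = f 1 * x" for x using f.scaleR[of x 1] by simp
  then have "(\<lambda>y. complex_of_real (f (\<rho> y))) = (\<lambda>y. complex_of_real (f 1) * complex_of_real (\<rho> y))"
    by (metis of_real_mult)
  then show ?case using H_mult[OF H_const assms(2)] by simp
next
  case (const c)
  then show ?case by (simp add: H_const)
next
  case (add f g)
  then show ?case using H_add by simp
next
  case (mult f g)
  then show ?case using H_mult by simp
qed

text \<open>Weierstrass approximation on an interval that contains almost all values of
  \<open>\<rho>\<close>.\<close>

lemma H_continuous:
  fixes \<rho> \<psi> :: "_ \<Rightarrow> real"
  assumes \<rho>: "(\<lambda>y. complex_of_real (\<rho> y)) \<in> H" and \<psi>: "continuous_on UNIV \<psi>" "\<And>x. \<bar>\<psi> x\<bar> \<le> 1"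
  shows "(\<lambda>y. complex_of_real (\<psi> (\<rho> y))) \<in> H"
proof -
  obtain B where "AE y in N. cmod (complex_of_real (\<rho> y)) \<le> B" using H_bdd[OF \<rho>] by blast
  then have B: "AE y in N. \<rho> y \<in> {-B..B}" by eventually_elim auto
  have "\<exists>g. real_polynomial_function g \<and> (\<forall>x\<in>{-B..B}. \<bar>\<psi> x - g x\<bar> < 1 / Suc n)" for n :: nat
  proof -
    have "continuous_on {-B..B} \<psi>" using \<psi>(1) by (rule continuous_on_subset) simp
    then show ?thesis
      using Stone_Weierstrass_real_polynomial_function[of "{-B..B}" \<psi> "1 / Suc n"] by (metis compact_Icc of_nat_0_less_iff zero_less_Suc zero_less_divide_1_iff)
  qed
  then obtain g where g: "\<And>n. real_polynomial_function (g n)"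
    "\<And>n x. x \<in> {-B..B} \<Longrightarrow> \<bar>\<psi> x - g n x\<bar> < 1 / Suc n" by metis
  have [measurable]: "\<rho> \<in> borel_measurable N"
    using H_measurable[OF \<rho>] by (simp add: borel_measurable_complex_iff)
  have [measurable]: "\<psi> \<in> borel_measurable borel"
    using \<psi>(1) by (rule borel_measurable_continuous_onI)
  show ?thesis
  proof (rule H_limit[OF H_polynomial[OF g(1) \<rho>], where B = 2])
    show "(\<lambda>y. complex_of_real (\<psi> (\<rho> y))) \<in> borel_measurable N" by measurable
    show "AE y in N. cmod (complex_of_real (g n (\<rho> y))) \<le> 2" for n
      using B
    proof eventually_elim
      case (elim y)
      have "1 / real (Suc n) \<le> 1" by simp
      then show ?case using g(2)[OF elim, of n] \<psi>(2)[of "\<rho> y"] unfolding norm_of_real by linarith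
    qed
    show "AE y in N. (\<lambda>n. complex_of_real (g n (\<rho> y))) \<longlonglongrightarrow> complex_of_real (\<psi> (\<rho> y))"
      using B
    proof eventually_elim
      case (elim y)
      have "(\<lambda>n. \<psi> (\<rho> y) - g n (\<rho> y)) \<longlonglongrightarrow> 0"
        by (rule Lim_null_comparison[OF _ LIMSEQ_Suc[OF lim_1_over_n]])
           (use g(2)[OF elim] in \<open>auto intro!: always_eventually less_imp_le\<close>)
      then have "(\<lambda>n. \<psi> (\<rho> y) - (\<psi> (\<rho> y) - g n (\<rho> y))) \<longlonglongrightarrow> \<psi> (\<rho> y) - 0"
        by (intro tendsto_intros)
      then show ?case by (intro tendsto_of_real) simp
    qed
  qed
qed

lemma indicator_Re_H:
  assumes u: "u \<in> \<A>"
  shows "{y \<in> space N. Re (u y) < r} \<in> sets N"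
    "(\<lambda>y. indicator {y \<in> space N. Re (u y) < r} y :: complex) \<in> H"
proof -
  have [measurable]: "u \<in> borel_measurable N" using \<A>_Lp[OF u] by auto
  have [measurable]: "(\<lambda>y. Re (u y)) \<in> borel_measurable N" by measurable
  show [measurable]: "{y \<in> space N. Re (u y) < r} \<in> sets N" by measurable
  have "(\<lambda>y. (1/2) * (u y + cnj (u y))) \<in> H" by (intro H_mult H_const H_add \<A>_H cnj_H u)
  then have \<rho>: "(\<lambda>y. complex_of_real (Re (u y))) \<in> H" by (simp add: complex_add_cnj)
  \<comment> \<open>Continuous ramps increasing to the indicator of \<open>{..<r}\<close>; they
    vanish at \<open>r\<close>, as the strict inequality demands.\<close>
  define \<psi> where "\<psi> n x = min 1 (max 0 (real n * (r - x)))" for n :: nat and x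
  have \<psi>H: "(\<lambda>y. complex_of_real (\<psi> n (Re (u y)))) \<in> H" for n
    by (intro H_continuous[OF \<rho>]) (auto simp: \<psi>_def intro!: continuous_intros)
  have lim: "(\<lambda>n. \<psi> n x) \<longlonglongrightarrow> indicator {..<r} x" for x
  proof (cases "x < r")
    case True
    obtain n0 :: nat where n0: "1 / (r - x) < n0" using reals_Archimedean2 by blast
    have "\<psi> n x = 1" if "n \<ge> n0" for n
    proof -
      have "1 / (r - x) < n" using n0 that by simp
      then have "1 < n * (r - x)" using True by (simp add: field_simps)
      then show ?thesis by (simp add: \<psi>_def)
    qed
    then show ?thesis using True
      by (intro tendsto_eventually) (auto simp: eventually_sequentially)
  next
    case False
    then have "\<psi> n x = 0" for n by (simp add: \<psi>_def mult_nonneg_nonpos max.absorb1)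
    then show ?thesis using False by simp
  qed
  show "(\<lambda>y. indicator {y \<in> space N. Re (u y) < r} y :: complex) \<in> H"
  proof (rule H_limit[OF \<psi>H, where B = 1])
    show "AE y in N. cmod (complex_of_real (\<psi> n (Re (u y)))) \<le> 1" for n
      by (auto simp: \<psi>_def)
    have "(\<lambda>n. complex_of_real (\<psi> n (Re (u y)))) \<longlonglongrightarrow> indicator {y \<in> space N. Re (u y) < r} y" if "y \<in> space N" for y
    proof -
      have "complex_of_real (indicator {..<r} (Re (u y))) = indicator {y \<in> space N. Re (u y) < r} y"
        using that by (auto simp: indicator_def)
      then show ?thesis using tendsto_of_real[OF lim[of "Re (u y)"]] by metis
    qed
    then show "AE y in N. (\<lambda>n. complex_of_real (\<psi> n (Re (u y)))) \<longlonglongrightarrow> indicator {y \<in> space N. Re (u y) < r} y"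
      by auto
  qed measurable
qed

lemma indicator_sigma_sets_H:
  assumes "S \<in> sigma_sets (space N) {{y \<in> space N. Re (u y) < r} | u r. u \<in> \<A>}"
  shows "S \<in> sets N \<and> (\<lambda>y. indicator S y :: complex) \<in> H"
  using assms
proof (induction rule: sigma_sets.induct)
  case (Basic a)
  then show ?case using indicator_Re_H by blast
next
  case Empty
  then show ?case using H_const[of 0] by simp
next
  case (Compl a)
  then have "(\<lambda>y. 1 + (-1) * (indicator a y :: complex)) \<in> H"
    by (intro H_add H_mult H_const) auto
  then have "(\<lambda>y. indicator (space N - a) y :: complex) \<in> H"
    by (rule H_AE) (use Compl in \<open>auto simp: indicator_def\<close>)
  then show ?case using Compl by auto
next
  case (Union a)
  have [measurable]: "a i \<in> sets N" for i using Union.IH by blast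
  have part: "(\<lambda>y. indicator (\<Union>i<n. a i) y :: complex) \<in> H" for n :: nat
  proof (induction n)
    case 0
    then show ?case using H_const[of 0] by simp
  next
    case (Suc n)
    have "(\<lambda>y. indicator (\<Union>i<n. a i) y + (1 + (-1) * indicator (\<Union>i<n. a i) y) * (indicator (a n) y :: complex)) \<in> H"
      using Suc Union by (intro H_add H_mult H_const) auto
    moreover have "(\<lambda>y. indicator (\<Union>i<n. a i) y + (1 + (-1) * indicator (\<Union>i<n. a i) y) * (indicator (a n) y :: complex))
       = (\<lambda>y. indicator (\<Union>i<Suc n. a i) y)"
      by (auto simp: fun_eq_iff indicator_def less_Suc_eq)
    ultimately show ?case by simp
  qed
  have lim: "(\<lambda>n. indicator (\<Union>i<n. a i) y :: complex) \<longlonglongrightarrow> indicator (\<Union>i. a i) y" for y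
    by (rule LIMSEQ_indicator_UN)
  have "(\<lambda>y. indicator (\<Union>i. a i) y :: complex) \<in> H"
  proof (rule H_limit[of "\<lambda>n y. indicator (\<Union>i<n. a i) y" _ 1, OF part])
    show "(\<lambda>y. indicator (\<Union>i. a i) y :: complex) \<in> borel_measurable N"
      by measurable
    show "AE y in N. cmod (indicator (\<Union>i<n. a i) y) \<le> 1" for n by (simp add: indicator_def)
    show "AE y in N. (\<lambda>n. indicator (\<Union>i<n. a i) y :: complex) \<longlonglongrightarrow> indicator (\<Union>i. a i) y"
      using lim by simp
  qed
  then show ?case by simp
qed

lemma indicator_H:
  assumes [measurable]: "S \<in> sets N"
  shows "(\<lambda>y. indicator S y :: complex) \<in> H"
proof -
  obtain S' where S': "S' \<in> sigma_sets (space N) {{y \<in> space N. Re (u y) < r} | u r. u \<in> \<A>}"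
    "AE y in N. y \<in> S \<longleftrightarrow> y \<in> S'"
    using \<A>_gen[OF assms] by blast
  show ?thesis
    by (rule H_AE[OF conjunct2[OF indicator_sigma_sets_H[OF S'(1)]]])
       (use S'(2) in \<open>auto elim!: eventually_mono simp: indicator_def\<close>)
qed

lemma H_sum:
  assumes "finite I" "\<And>i. i \<in> I \<Longrightarrow> h i \<in> H"
  shows "(\<lambda>y. \<Sum>i\<in>I. h i y) \<in> H"
  using assms
proof (induction I rule: finite_induct)
  case empty
  then show ?case using H_const[of 0] by simp
next
  case (insert i I)
  then have "(\<lambda>y. h i y + (\<Sum>i\<in>I. h i y)) \<in> H" by (intro H_add) auto
  then show ?case using insert by simp
qed

lemma bounded_H:
  assumes [measurable]: "h \<in> borel_measurable N" and B: "\<And>y. y \<in> space N \<Longrightarrow> cmod (h y) \<le> B"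
  shows "h \<in> H"
proof -
  obtain F where F: "\<And>i. simple_function N (F i)"
    "\<And>x. x \<in> space N \<Longrightarrow> (\<lambda>i. F i x) \<longlonglongrightarrow> h x"
    "\<And>i x. x \<in> space N \<Longrightarrow> dist (F i x) 0 \<le> 2 * dist (h x) 0"
    using borel_measurable_implies_sequence_metric[OF assms(1), of 0] by blast
  have FH: "F i \<in> H" for i
  proof -
    have [measurable]: "F i \<in> borel_measurable N" by (rule borel_measurable_simple_function[OF F(1)])
    have "(\<lambda>y. \<Sum>c\<in>F i ` space N. c * indicator (F i -` {c} \<inter> space N) y) \<in> H"
      using simple_functionD[OF F(1)] by (intro H_sum H_mult H_const indicator_H) auto
    then show ?thesis
    proof (rule H_AE)
      have "(\<Sum>c\<in>F i ` space N. c * indicator (F i -` {c} \<inter> space N) y) = F i y" if y: "y \<in> space N" for y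
      proof -
        have "(\<Sum>c\<in>F i ` space N. c * indicator (F i -` {c} \<inter> space N) y) = (\<Sum>c\<in>F i ` space N. if c = F i y then F i y else 0)"
          using y by (intro sum.cong) (auto simp: indicator_def)
        also have "\<dots> = F i y" using y simple_functionD(1)[OF F(1)[of i]] by simp
        finally show ?thesis .
      qed
      then show "AE y in N. (\<Sum>c\<in>F i ` space N. c * indicator (F i -` {c} \<inter> space N) y) = F i y" by auto
    qed measurable
  qed
  have "cmod (F i y) \<le> 2 * B" if "y \<in> space N" for i y
    using F(3)[OF that, of i] B[OF that] by simp
  then show ?thesis using F(2) by (intro H_limit[of F h "2 * B", OF FH]) auto
qed

text \<open>Bounded functions are multipliers, but a multiplier needs an element of \<open>V\<close>
  to act on. The sums \<open>w k\<close> of \<open>|C n|^2\<close> lie in \<open>V\<close>, and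
  \<open>F\<close> truncated to \<open>S k\<close> is the bounded function \<open>h k\<close> times
  \<open>w k\<close>. By \<open>\<A>_full\<close> the sets \<open>S k\<close> exhaust almost
  everything, and dominated convergence finishes the argument.\<close>

lemma V_UNIV:
  assumes F: "F \<in> Lp_space N q"
  shows "F \<in> V"
proof -
  have [measurable]: "F \<in> borel_measurable N" using F by auto
  obtain C :: "nat \<Rightarrow> _" where C: "\<And>n. C n \<in> \<A>" "AE y in N. \<exists>n. C n y \<noteq> 0"
    using \<A>_full by blast
  have [measurable]: "C n \<in> borel_measurable N" for n using \<A>_Lp[OF C(1)] by auto
  define w where "w k y = (\<Sum>n<k. (cmod (C n y))\<^sup>2)" for k y
  have [measurable]: "w k \<in> borel_measurable N" for k unfolding w_def by measurable
  have w0: "0 \<le> w k y" for k y by (simp add: w_def sum_nonneg)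
  have wV: "(\<lambda>y. complex_of_real (w k y)) \<in> V" for k
  proof (induction k)
    case 0
    then show ?case using V_scale[OF \<A>_V[OF C(1)], of 0] by (simp add: w_def)
  next
    case (Suc k)
    have "(\<lambda>y. complex_of_real (w k y) + cnj (C k y) * C k y) \<in> V"
      by (intro V_add Suc H_mult_V cnj_H \<A>_V C)
    moreover have "cnj (C k y) * C k y = complex_of_real ((cmod (C k y))\<^sup>2)" for y
      by (simp add: complex_norm_square mult.commute del: of_real_power)
    ultimately show ?case by (simp add: w_def)
  qed
  \<comment> \<open>The two conditions together bound \<open>F / w k\<close> by
    \<open>k * Suc k\<close>.\<close>
  define S where "S k y \<longleftrightarrow> cmod (F y) \<le> real k \<and> 1 / Suc k \<le> w k y" for k :: nat and y
  define h where "h k y = (if S k y then F y / complex_of_real (w k y) else 0)" for k y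
  have [measurable]: "Measurable.pred N (S k)" for k unfolding S_def by measurable
  have [measurable]: "h k \<in> borel_measurable N" for k unfolding h_def by measurable
  have "cmod (h k y) \<le> real k * real (Suc k)" for k y
  proof (cases "S k y")
    case True
    then have k: "cmod (F y) \<le> real k" "1 / real (Suc k) \<le> w k y" by (auto simp: S_def)
    then have "cmod (F y) / w k y \<le> real k / (1 / real (Suc k))"
      by (intro frac_le) auto
    then show ?thesis using True w0[of k y] by (simp add: h_def norm_divide)
  next
    case False
    then show ?thesis by (simp add: h_def)
  qed
  then have hH: "h k \<in> H" for k by (intro bounded_H) auto
  have hw: "h k y * complex_of_real (w k y) = (if S k y then F y else 0)" for k y
  proof -
    have "w k y \<noteq> 0" if "S k y"
    proof -
      have "0 < 1 / real (Suc k)" by simp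
      also have "\<dots> \<le> w k y" using that by (simp add: S_def)
      finally show ?thesis by simp
    qed
    then show ?thesis by (simp add: h_def)
  qed
  have mem: "(\<lambda>y. if S k y then F y else 0) \<in> V" for k
    using H_mult_V[OF hH[of k] wV[of k]] by (simp add: hw)
  have "AE y in N. (\<lambda>k. if S k y then F y else 0) \<longlonglongrightarrow> F y"
    using C(2)
  proof eventually_elim
    case (elim y)
    then obtain n where n: "C n y \<noteq> 0" by blast
    define \<delta> where "\<delta> = w (Suc n) y"
    have "0 < (cmod (C n y))\<^sup>2" using n by simp
    moreover have "\<delta> = w n y + (cmod (C n y))\<^sup>2" by (simp add: \<delta>_def w_def)
    ultimately have \<delta>: "0 < \<delta>" using w0[of n y] by linarith
    obtain k0 :: nat where k0: "max (1 / \<delta>) (cmod (F y)) < k0" using reals_Archimedean2 by blast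
    have "S k y" if "k \<ge> k0" "k \<ge> Suc n" for k
    proof -
      have "real k0 \<le> real k" using that by simp
      then have "1 / \<delta> < real (Suc k)" using k0 by auto
      then have "1 / real (Suc k) \<le> \<delta>" using \<delta> by (simp add: field_simps)
      also have "\<delta> \<le> w k y" unfolding \<delta>_def w_def using that by (intro sum_mono2) auto
      finally show ?thesis using k0 \<open>real k0 \<le> real k\<close> by (auto simp: S_def)
    qed
    then have "\<forall>\<^sub>F k in sequentially. (if S k y then F y else 0) = F y"
      by (intro eventually_sequentiallyI[of "max k0 (Suc n)"]) auto
    then show ?case by (rule tendsto_eventually)
  qed
  then have "(\<lambda>k. Lp_int N q (\<lambda>y. (if S k y then F y else 0) - F y)) \<longlonglongrightarrow> 0"
    by (intro Lp_int_dominated(2)[OF _ _ F q]) (auto simp: if_distrib)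
  then show ?thesis by (rule V_closed[OF mem F])
qed

theorem dense:
  assumes "F \<in> Lp_space N q" "0 < e"
  shows "\<exists>u\<in>\<A>. Lp_int N q (\<lambda>y. u y - F y) < e"
proof -
  obtain u where u: "range u \<subseteq> \<A>" "(\<lambda>n::nat. Lp_int N q (\<lambda>y. u n y - F y)) \<longlonglongrightarrow> 0"
    using V_UNIV[OF assms(1)] by (auto simp: V_def)
  then have "\<forall>\<^sub>F n in sequentially. Lp_int N q (\<lambda>y. u n y - F y) < e"
    using assms(2) by (intro order_tendstoD(2)[OF u(2)])
  then obtain n where "Lp_int N q (\<lambda>y. u n y - F y) < e" by (auto simp: eventually_sequentially)
  then show ?thesis using u(1) by blast
qed

end

text \<open>The product of a semigroup ring with operation \<open>m\<close>; \<open>cconj\<close> is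
  the matching involution. The operation is a parameter because it is intersection for indicators of
  sets and addition for exponentials.\<close>

definition cprod :: "('f \<Rightarrow> 'f \<Rightarrow> 'f) \<Rightarrow> (complex \<times> 'f) list \<Rightarrow> (complex \<times> 'f) list \<Rightarrow> (complex \<times> 'f) list" where
  "cprod m s t = concat (map (\<lambda>(a, f). map (\<lambda>(b, g). (a * b, m f g)) t) s)"

definition cconj :: "('f \<Rightarrow> 'f) \<Rightarrow> (complex \<times> 'f) list \<Rightarrow> (complex \<times> 'f) list" where
  "cconj i s = map (\<lambda>(a, f). (cnj a, i f)) s"

lemma comb_cprod:
  assumes "\<And>f g. f \<in> snd ` set s \<Longrightarrow> g \<in> snd ` set t \<Longrightarrow> E (m f g) y = E f y * E g y"
  shows "comb E (cprod m s t) y = comb E s y * comb E t y"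
  using assms
proof (induction s)
  case (Cons af s)
  obtain a f where af: "af = (a, f)" by fastforce
  have "comb E (map (\<lambda>(b, g). (a * b, m f g)) t) y = a * E f y * comb E t y"
    using Cons.prems unfolding af by (induction t) (auto simp: algebra_simps)
  moreover have "comb E (cprod m s t) y = comb E s y * comb E t y"
    using Cons by auto
  ultimately show ?case by (simp add: af cprod_def algebra_simps)
qed (simp add: cprod_def)

text \<open>The weight is evaluation at the trivial character, so it inherits multiplicativity from
  \<open>comb_cprod\<close>.\<close>

lemma weight_eq_comb: "weight s = comb (\<lambda>_ _. 1) s ()"
  by (simp add: weight_def comb_def)

lemma weight_cprod: "weight (cprod m s t) = weight s * weight t"
  unfolding weight_eq_comb by (rule comb_cprod) simp

lemma snd_set_cprod: "snd ` set (cprod m s t) = {m f g | f g. f \<in> snd ` set s \<and> g \<in> snd ` set t}"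
  by (force simp: cprod_def)

lemma comb_cconj:
  assumes "\<And>f. f \<in> snd ` set s \<Longrightarrow> E (i f) y = cnj (E f y)"
  shows "comb E (cconj i s) y = cnj (comb E s y)"
  using assms by (induction s) (auto simp: cconj_def)

lemma weight_cconj: "weight (cconj i s) = cnj (weight s)"
  by (induction s) (auto simp: cconj_def)

lemma snd_set_cconj: "snd ` set (cconj i s) = i ` snd ` set s"
  by (force simp: cconj_def)

text \<open>Together with a countable set of generators, a countable dense set of coefficients
  leaves only countably many combinations.\<close>

lemma comb_coeff_dense:
  assumes "0 < q" "\<And>f. f \<in> \<F> \<Longrightarrow> E f \<in> Lp_space N q"
    and Q: "\<And>X. open X \<Longrightarrow> X \<noteq> {} \<Longrightarrow> \<exists>d\<in>Q. d \<in> (X :: complex set)"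
    and "snd ` set s \<subseteq> \<F>" "0 < e"
  shows "\<exists>t. set t \<subseteq> Q \<times> \<F> \<and> Lp_int N q (\<lambda>y. comb E t y - comb E s y) < e"
  using assms(4,5)
proof (induction s arbitrary: e)
  case Nil
  then show ?case by (intro exI[of _ "[]"]) auto
next
  case (Cons af s)
  obtain a f where af: "af = (a, f)" by fastforce
  have f: "f \<in> \<F>" and s: "snd ` set s \<subseteq> \<F>" using Cons af by auto
  define d where "d = e / 2 powr q / 2"
  have d: "0 < d" "2 powr q * (d + d) = e" using Cons.prems by (auto simp: d_def)
  obtain t where t: "set t \<subseteq> Q \<times> \<F>" "Lp_int N q (\<lambda>y. comb E t y - comb E s y) < d"
    using Cons.IH[OF s d(1)] by blast
  \<comment> \<open>The \<open>+ 1\<close> allows division also when \<open>E f\<close> vanishes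
    almost everywhere.\<close>
  define L where "L = Lp_int N q (E f) + 1"
  have L: "0 < L" by (simp add: L_def add_nonneg_pos)
  define r where "r = (d / L) powr (1 / q)"
  have r: "0 < r" "r powr q = d / L" using d L \<open>0 < q\<close> by (auto simp: r_def powr_powr)
  obtain b where b: "b \<in> Q" "b \<in> ball a r" using Q[of "ball a r"] r by auto
  have tL: "comb E t \<in> Lp_space N q" "comb E s \<in> Lp_space N q"
    using t s assms(2) by (auto intro!: comb_Lp_space[OF \<open>0 < q\<close>])
  have "cmod (b - a) powr q * Lp_int N q (E f) < d"
  proof -
    have "cmod (b - a) powr q \<le> r powr q"
      using b(2) \<open>0 < q\<close> by (intro powr_mono2) (auto simp: dist_norm norm_minus_commute)
    then have "cmod (b - a) powr q * Lp_int N q (E f) \<le> d / L * Lp_int N q (E f)"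
      using r by (intro mult_right_mono) auto
    also have "\<dots> < d / L * L" using d L by (intro mult_strict_left_mono) (auto simp: L_def)
    finally show ?thesis using L by simp
  qed
  then have 1: "Lp_int N q (\<lambda>y. (b - a) * E f y) < d"
    using Lp_space_scale(2)[OF assms(2)[OF f]] by simp
  have "Lp_int N q (\<lambda>y. comb E ((b, f) # t) y - comb E (af # s) y)
      = Lp_int N q (\<lambda>y. (b - a) * E f y + (comb E t y - comb E s y))"
    by (simp add: af algebra_simps)
  also have "\<dots> \<le> 2 powr q * (Lp_int N q (\<lambda>y. (b - a) * E f y) + Lp_int N q (\<lambda>y. comb E t y - comb E s y))"
    by (intro Lp_int_add_le Lp_space_diff Lp_space_scale(1) assms(1,2) f tL)
  also have "\<dots> < 2 powr q * (d + d)" using 1 t(2) by simp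
  finally show ?case using d(2) b t(1) f by (intro exI[of _ "(b, f) # t"]) auto
qed

section \<open>Separability\<close>

text \<open>The indicators of a countable intersection-stable family of sets of finite measure span
  an algebra to which the density theorem applies; coefficients are then taken from a countable
  dense subset of the plane.\<close>

lemma Lp_separable:
  fixes M :: "'a::polish_space measure"
  assumes M: "standard_measure_space M" and p: "0 < p"
  obtains D :: "nat \<Rightarrow> 'a \<Rightarrow> complex" where "\<And>n. D n \<in> Lp_space M p"
    "\<And>f e. f \<in> Lp_space M p \<Longrightarrow> 0 < e \<Longrightarrow> \<exists>n. Lp_int M p (\<lambda>x. D n x - f x) < e"
proof -
  interpret sigma_finite_measure M using M by (simp add: standard_measure_space_def)
  obtain S where S: "countable S" "S \<subseteq> sets M" "\<Union>S = space M" "\<And>A. A \<in> S \<Longrightarrow> emeasure M A \<noteq> \<infinity>"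
    using sigma_finite_countable by blast
  obtain \<B> :: "'a set set" where \<B>: "countable \<B>" "topological_basis \<B>"
    using ex_countable_basis by blast
  have sets_borel: "sets (borel :: 'a measure) = sigma_sets UNIV \<B>"
    by (subst borel_eq_countable_basis[OF \<B>]) (rule sets_measure_of, simp)
  have sets_M: "sets M = (\<inter>) (space M) ` sigma_sets UNIV \<B>"
    using M unfolding standard_measure_space_def by (metis sets_restrict_space sets_borel)
  have \<B>_M: "B \<inter> space M \<in> sets M" if "B \<in> \<B>" for B
    unfolding sets_M using that by (intro image_eqI[of _ _ B]) (auto intro: sigma_sets.Basic)
  \<comment> \<open>Cutting basic open sets by sets of finite measure puts their indicators into
    L_p. The finite intersections in \<open>\<C>\<close> make the span closed under products; the
    empty family is excluded there, since its intersection is the whole type.\<close>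
  define \<G> where "\<G> = (\<lambda>(B, A). B \<inter> A) ` (\<B> \<times> S)"
  define \<C> where "\<C> = Inter ` {F. finite F \<and> F \<subseteq> \<G> \<and> F \<noteq> {}}"
  have "countable \<G>" unfolding \<G>_def using \<B>(1) S(1) by auto
  then have "countable {F. finite F \<and> F \<subseteq> \<G>}" by (rule countable_Collect_finite_subset)
  then have "countable {F. finite F \<and> F \<subseteq> \<G> \<and> F \<noteq> {}}" by (rule countable_subset[rotated]) auto
  then have C_count: "countable \<C>" unfolding \<C>_def by auto
  have G: "C \<in> sets M" "emeasure M C < \<infinity>" if "C \<in> \<G>" for C
  proof -
    obtain B A where BA: "B \<in> \<B>" "A \<in> S" "C = B \<inter> A" using \<open>C \<in> \<G>\<close> by (auto simp: \<G>_def)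
    have A: "A \<in> sets M" using S BA by auto
    then have "C = (B \<inter> space M) \<inter> A" using BA sets.sets_into_space by blast
    then show "C \<in> sets M" using \<B>_M[OF BA(1)] A by auto
    have "emeasure M C \<le> emeasure M A" using A BA by (intro emeasure_mono) auto
    then show "emeasure M C < \<infinity>" using S(4)[OF BA(2)] by (auto simp: less_top intro: le_less_trans)
  qed
  have C: "C \<in> sets M" "emeasure M C < \<infinity>" if "C \<in> \<C>" for C
  proof -
    obtain F where F: "finite F" "F \<subseteq> \<G>" "F \<noteq> {}" "C = \<Inter>F" using \<open>C \<in> \<C>\<close> by (auto simp: \<C>_def)
    then have "(\<Inter>A\<in>F. A) \<in> sets M" using G by (intro sets.finite_INT) auto
    then show "C \<in> sets M" using F by simp
    obtain A where "A \<in> F" using F by auto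
    then have "emeasure M C \<le> emeasure M A" using F G by (intro emeasure_mono) auto
    also have "\<dots> < \<infinity>" using G \<open>A \<in> F\<close> F by auto
    finally show "emeasure M C < \<infinity>" .
  qed
  have C_Int: "C \<inter> C' \<in> \<C>" if "C \<in> \<C>" "C' \<in> \<C>" for C C'
  proof -
    obtain F F' where "finite F" "F \<subseteq> \<G>" "F \<noteq> {}" "C = \<Inter>F" "finite F'" "F' \<subseteq> \<G>" "F' \<noteq> {}" "C' = \<Inter>F'"
      using \<open>C \<in> \<C>\<close> \<open>C' \<in> \<C>\<close> by (auto simp: \<C>_def)
    then show ?thesis unfolding \<C>_def by (intro image_eqI[of _ _ "F \<union> F'"]) auto
  qed
  have GC: "\<G> \<subseteq> \<C>"
    unfolding \<C>_def by (auto intro!: image_eqI[of _ Inter "{_}"])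
  have \<B>_cover: "\<exists>B\<in>\<B>. x \<in> B" for x
    using topological_basisE[OF \<B>(2) open_UNIV, of x] by auto
  define I where "I C x = (indicator C x :: complex)" for C and x :: 'a
  have I_Lp: "I C \<in> Lp_space M p" if "C \<in> \<C>" for C
  proof (rule Lp_spaceI)
    show "I C \<in> borel_measurable M" unfolding I_def using C(1)[OF that] by measurable
    have "(\<integral>\<^sup>+ x. ennreal (cmod (I C x) powr p) \<partial>M) = (\<integral>\<^sup>+ x. indicator C x \<partial>M)"
      using p by (intro nn_integral_cong) (auto simp: I_def indicator_def)
    then show "(\<integral>\<^sup>+ x. ennreal (cmod (I C x) powr p) \<partial>M) < \<infinity>" using C[OF that] by simp
  qed
  define \<A> where "\<A> = {comb I s | s. snd ` set s \<subseteq> \<C>}"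
  have comb_\<A>: "comb I s \<in> \<A>" if "snd ` set s \<subseteq> \<C>" for s
    unfolding \<A>_def using that by blast
  interpret Lp_algebra M p \<A>
  proof
    show "0 < p" by fact
    show "u \<in> Lp_space M p" if "u \<in> \<A>" for u
      using that I_Lp by (auto simp: \<A>_def intro!: comb_Lp_space[OF p])
    show "\<exists>B. AE y in M. cmod (u y) \<le> B" if "u \<in> \<A>" for u
    proof -
      obtain s where s: "u = comb I s" using \<open>u \<in> \<A>\<close> by (auto simp: \<A>_def)
      have "cmod (comb I s y) \<le> (\<Sum>(a, f)\<leftarrow>s. cmod a)" for y
      proof (induction s)
        case (Cons af s)
        obtain a f where af: "af = (a, f)" by fastforce
        have "cmod (a * I f y) \<le> cmod a" by (auto simp: I_def norm_mult indicator_def)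
        then show ?case using Cons norm_triangle_mono[of "a * I f y" "cmod a" "comb I s y"] by (simp add: af)
      qed simp
      then show ?thesis using s by auto
    qed
    show "(\<lambda>y. u y + v y) \<in> \<A>" if uv: "u \<in> \<A>" "v \<in> \<A>" for u v
    proof -
      obtain s t where "u = comb I s" "v = comb I t" "snd ` set s \<subseteq> \<C>" "snd ` set t \<subseteq> \<C>"
        using uv by (auto simp: \<A>_def)
      then show ?thesis unfolding \<A>_def by (intro CollectI exI[of _ "s @ t"]) auto
    qed
    show "(\<lambda>y. c * u y) \<in> \<A>" if u: "u \<in> \<A>" for u c
    proof -
      obtain s where "u = comb I s" "snd ` set s \<subseteq> \<C>"
        using u by (auto simp: \<A>_def)
      then show ?thesis unfolding \<A>_def by (intro CollectI exI[of _ "scale c s"]) auto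
    qed
    show "\<exists>w\<in>\<A>. AE y in M. w y = u y * v y" if uv: "u \<in> \<A>" "v \<in> \<A>" for u v
    proof -
      obtain s t where st: "u = comb I s" "v = comb I t" "snd ` set s \<subseteq> \<C>" "snd ` set t \<subseteq> \<C>"
        using uv by (auto simp: \<A>_def)
      then have "snd ` set (cprod (\<inter>) s t) \<subseteq> \<C>" unfolding snd_set_cprod using C_Int by blast
      then have "comb I (cprod (\<inter>) s t) \<in> \<A>" by (auto simp: \<A>_def)
      moreover have "comb I (cprod (\<inter>) s t) y = u y * v y" for y
        unfolding st by (rule comb_cprod) (auto simp: I_def indicator_def)
      ultimately show ?thesis by auto
    qed
    show "\<exists>w\<in>\<A>. AE y in M. w y = cnj (u y)" if u: "u \<in> \<A>" for u
    proof -
      obtain s where s: "u = comb I s" "snd ` set s \<subseteq> \<C>"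
        using u by (auto simp: \<A>_def)
      then have "comb I (cconj id s) \<in> \<A>" by (intro comb_\<A>) (simp add: snd_set_cconj)
      moreover have "comb I (cconj id s) y = cnj (u y)" for y
        unfolding s by (rule comb_cconj) (auto simp: I_def indicator_def)
      ultimately show ?thesis by auto
    qed
    show "\<exists>C :: nat \<Rightarrow> _. range C \<subseteq> \<A> \<and> (AE y in M. \<exists>n. C n y \<noteq> 0)"
    \<comment> \<open>An empty \<open>\<G>\<close> cannot be enumerated by
      \<open>from_nat_into\<close>, but then the space is empty and any sequence will do.\<close>
    proof (cases "\<G> = {}")
      case True
      have "space M = {}"
        using True S(3) \<B>_cover by (auto simp: \<G>_def)
      moreover have "comb I [] \<in> \<A>" by (auto simp: \<A>_def)
      ultimately show ?thesis by (intro exI[of _ "\<lambda>_. comb I []"]) (auto intro!: AE_I2)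
    next
      case False
      define C where "C n = comb I [(1, from_nat_into \<G> n)]" for n
      have "C n \<in> \<A>" for n
        using from_nat_into[OF False, of n] GC unfolding C_def
        by (intro comb_\<A>) auto
      moreover have "\<exists>n. C n y \<noteq> 0" if "y \<in> space M" for y
      proof -
        obtain B A where "B \<in> \<B>" "A \<in> S" "y \<in> B" "y \<in> A" using \<B>_cover[of y] \<open>y \<in> space M\<close> S(3) by blast
        then have "B \<inter> A \<in> \<G>" "y \<in> B \<inter> A" by (auto simp: \<G>_def)
        then obtain n where "y \<in> from_nat_into \<G> n"
          using from_nat_into_surj[OF \<open>countable \<G>\<close>] by metis
        then have "C n y \<noteq> 0" by (simp add: C_def I_def)
        then show ?thesis by blast
      qed
      ultimately show ?thesis by (intro exI[of _ C]) auto
    qed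
    let ?\<Sigma> = "sigma_sets (space M) {{y \<in> space M. Re (u y) < r} | u r. u \<in> \<A>}"
    interpret \<Sigma>: sigma_algebra "space M" ?\<Sigma>
      by (rule sigma_algebra_sigma_sets) auto
    have CS: "C \<in> ?\<Sigma>" if "C \<in> \<C>" for C
    proof -
      have "comb I [(1, C)] \<in> \<A>" using that by (intro comb_\<A>) auto
      \<comment> \<open>Any threshold in \<open>(0, 1]\<close> would separate the two values of an
        indicator; the sublevel set is the complement of \<open>C\<close>.\<close>
      then have "{y \<in> space M. Re (comb I [(1, C)] y) < 1 / 2} \<in> ?\<Sigma>" by (intro sigma_sets.Basic) blast
      moreover have "{y \<in> space M. Re (comb I [(1, C)] y) < 1 / 2} = space M - C"
        by (auto simp: I_def indicator_def split: if_splits)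
      ultimately have "space M - C \<in> ?\<Sigma>" by simp
      then have "space M - (space M - C) \<in> ?\<Sigma>" by (rule \<Sigma>.compl_sets)
      then show ?thesis using sets.sets_into_space[OF C(1)[OF that]] by (simp add: double_diff)
    qed
    have BS: "B \<inter> space M \<in> ?\<Sigma>" if "B \<in> \<B>" for B
    proof -
      have "B \<inter> space M = (\<Union>A\<in>S. B \<inter> A)" using S(3) by auto
      moreover have "(\<Union>A\<in>S. B \<inter> A) \<in> ?\<Sigma>"
      proof (rule \<Sigma>.countable_UN'[OF S(1)])
        have "B \<inter> A \<in> ?\<Sigma>" if "A \<in> S" for A
          using \<open>B \<in> \<B>\<close> that GC by (intro CS) (force simp: \<G>_def)
        then show "(\<lambda>A. B \<inter> A) ` S \<subseteq> ?\<Sigma>" by blast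
      qed
      ultimately show ?thesis by simp
    qed
    have gen: "B' \<inter> space M \<in> ?\<Sigma>" if "B' \<in> sigma_sets UNIV \<B>" for B'
      using that
    proof (induction rule: sigma_sets.induct)
      case (Compl a)
      have eq: "(UNIV - a) \<inter> space M = space M - a \<inter> space M" by auto
      show ?case unfolding eq by (rule \<Sigma>.compl_sets[OF Compl.IH])
    next
      case (Union a)
      have "(\<Union>i. a i) \<inter> space M = (\<Union>i. a i \<inter> space M)" by auto
      moreover have "(\<Union>i. a i \<inter> space M) \<in> ?\<Sigma>" using Union by (intro \<Sigma>.countable_UN) auto
      ultimately show ?case by simp
    qed (use BS in \<open>auto intro: sigma_sets.Empty\<close>)
    show "\<exists>B'\<in>?\<Sigma>. AE y in M. y \<in> B \<longleftrightarrow> y \<in> B'" if "B \<in> sets M" for B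
    proof -
      obtain B' where "B' \<in> sigma_sets UNIV \<B>" "B = B' \<inter> space M"
        using \<open>B \<in> sets M\<close> unfolding sets_M by blast
      then have "B \<in> ?\<Sigma>" using gen by simp
      then show ?thesis by (intro bexI[of _ B]) auto
    qed
  qed
  obtain Q :: "complex set" where Q: "countable Q" "\<And>X. open X \<Longrightarrow> X \<noteq> {} \<Longrightarrow> \<exists>d\<in>Q. d \<in> X"
    using countable_dense_exists[where 'a = complex] by auto
  define L where "L = lists (Q \<times> \<C>)"
  have L: "countable L" "L \<noteq> {}" unfolding L_def using Q(1) C_count by auto
  define D where "D n = comb I (from_nat_into L n)" for n
  have Ln: "set (from_nat_into L n) \<subseteq> Q \<times> \<C>" for n
    using from_nat_into[OF L(2), of n] by (auto simp: L_def)
  show ?thesis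
  proof
    show "D n \<in> Lp_space M p" for n
      unfolding D_def using Ln[of n] I_Lp by (intro comb_Lp_space p) auto
    fix f e assume f: "f \<in> Lp_space M p" and e: "(0::real) < e"
    define d where "d = e / 2 powr p / 2"
    have d: "0 < d" "2 powr p * (d + d) = e" using e by (auto simp: d_def)
    obtain s where s: "snd ` set s \<subseteq> \<C>" "Lp_int M p (\<lambda>y. comb I s y - f y) < d"
      using dense[OF f d(1)] by (auto simp: \<A>_def)
    obtain t where t: "set t \<subseteq> Q \<times> \<C>" "Lp_int M p (\<lambda>y. comb I t y - comb I s y) < d"
      using comb_coeff_dense[where E = I and \<F> = \<C>, OF p I_Lp Q(2) s(1) d(1)] by blast
    have "t \<in> L" using t by (auto simp: L_def)
    then obtain n where n: "from_nat_into L n = t" using from_nat_into_surj[OF L(1)] by blast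
    have L: "comb I s \<in> Lp_space M p" "comb I t \<in> Lp_space M p"
      using s t I_Lp by (auto intro!: comb_Lp_space[OF p])
    have "Lp_int M p (\<lambda>y. comb I t y - f y) \<le> 2 powr p * (Lp_int M p (\<lambda>y. comb I t y - comb I s y) + Lp_int M p (\<lambda>y. comb I s y - f y))"
      by (intro Lp_int_triangle p L f)
    also have "\<dots> < 2 powr p * (d + d)" using s(2) t(2) by simp
    finally show "\<exists>n. Lp_int M p (\<lambda>x. D n x - f x) < e" using n d(2) by (auto simp: D_def)
  qed
qed

section \<open>Coding countably many functions by a single real function\<close>

text \<open>Binary digits are read in base 3, so that no two digit sequences have the same value.\<close>

definition code3 :: "(nat \<Rightarrow> bool) \<Rightarrow> real" where
  "code3 b = (\<Sum>k. of_bool (b k) / 3 ^ Suc k)"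

lemma summable_geometric_third: "summable (\<lambda>k. 1 / 3 ^ Suc k :: real)"
proof -
  have "summable (\<lambda>k. (1/3::real) * (1/3) ^ k)"
    by (intro summable_mult summable_geometric) simp
  then show ?thesis by (simp add: power_one_over)
qed

lemma suminf_geometric_third: "(\<Sum>k. 1 / 3 ^ Suc k :: real) = 1 / 2"
proof -
  have "(\<Sum>k. (1/3::real) * (1/3) ^ k) = (1/3) * (1 / (1 - 1/3))"
    by (subst suminf_mult) (auto simp: suminf_geometric summable_geometric)
  then show ?thesis by (simp add: power_one_over)
qed

lemma code3_summable: "summable (\<lambda>k. of_bool (b k) / 3 ^ Suc k :: real)"
  by (rule summable_comparison_test'[OF summable_geometric_third]) auto

lemma code3_bounds: "0 \<le> code3 b" "code3 b < 1"
proof -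
  show "0 \<le> code3 b"
    unfolding code3_def by (intro suminf_nonneg code3_summable) auto
  have "code3 b \<le> (\<Sum>k. 1 / 3 ^ Suc k)"
    unfolding code3_def by (intro suminf_le code3_summable summable_geometric_third) auto
  then show "code3 b < 1" using suminf_geometric_third by simp
qed

lemma code3_rec: "3 * code3 b = of_bool (b 0) + code3 (\<lambda>k. b (Suc k))"
proof -
  have "code3 b = of_bool (b 0) / 3 + (\<Sum>k. of_bool (b (Suc k)) / 3 ^ Suc (Suc k))"
    unfolding code3_def using suminf_split_head[OF code3_summable[of b]] by simp
  also have "(\<Sum>k. of_bool (b (Suc k)) / 3 ^ Suc (Suc k) :: real) = (\<Sum>k. (1/3) * (of_bool (b (Suc k)) / 3 ^ Suc k))"
    by (intro suminf_cong) simp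
  also have "\<dots> = (1/3) * code3 (\<lambda>k. b (Suc k))"
    unfolding code3_def by (intro suminf_mult code3_summable)
  finally show ?thesis by simp
qed

text \<open>After scaling by \<open>3^(n+1)\<close> the digits beyond \<open>n\<close> contribute
  less than 1, so the floor cuts exactly there; the digits before \<open>n\<close> contribute
  multiples of 3.\<close>

lemma code3_digit: "\<lfloor>3 ^ Suc n * code3 b\<rfloor> mod 3 = 1 \<longleftrightarrow> b n"
proof (induction n arbitrary: b)
  case 0
  have "\<lfloor>3 * code3 b\<rfloor> = of_bool (b 0)"
    using code3_bounds[of "\<lambda>k. b (Suc k)"] unfolding code3_rec by (intro floor_unique) auto
  then show ?case by simp
next
  case (Suc n)
  let ?c = "code3 (\<lambda>k. b (Suc k))"
  have "3 ^ Suc (Suc n) * code3 b = 3 ^ Suc n * (3 * code3 b)" by simp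
  also have "\<dots> = 3 ^ Suc n * ?c + of_int (3 ^ Suc n * of_bool (b 0))"
    unfolding code3_rec by (simp add: algebra_simps)
  finally have "\<lfloor>3 ^ Suc (Suc n) * code3 b\<rfloor> = \<lfloor>3 ^ Suc n * ?c\<rfloor> + 3 * (3 ^ n * of_bool (b 0))"
    by (simp only: floor_add_int[symmetric]) simp
  then have "\<lfloor>3 ^ Suc (Suc n) * code3 b\<rfloor> mod 3 = \<lfloor>3 ^ Suc n * ?c\<rfloor> mod 3"
    by (simp only: mod_mult_self2)
  then show ?case using Suc.IH[of "\<lambda>k. b (Suc k)"] by simp
qed

lemma code3_measurable:
  assumes "\<And>k. {x \<in> space M. b k x} \<in> sets M"
  shows "(\<lambda>x. code3 (\<lambda>k. b k x)) \<in> borel_measurable M"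
proof -
  have [measurable]: "Measurable.pred M (b k)" for k using assms by (simp add: pred_def)
  show ?thesis unfolding code3_def by measurable
qed

text \<open>\<open>\<theta>\<close> stores, for every \<open>n\<close> and every rational, whether
  \<open>v n y\<close> lies below that rational. Its range need not be Borel, so it is not inverted.
  Instead \<open>\<tau>\<close> is a Borel map that depends on the \<open>w n\<close> alone and
  fixes the values of \<open>\<theta>\<close>. Hence a Borel set and its preimage under
  \<open>\<tau>\<close> agree on the range of \<open>\<theta>\<close>, and the \<open>w n\<close>
  generate the Borel sets up to null sets of any image measure under
  \<open>\<theta>\<close>.\<close>

lemma real_coding:
  fixes v :: "nat \<Rightarrow> 'y \<Rightarrow> real"
  assumes v[measurable]: "\<And>n. v n \<in> borel_measurable Y" and bound: "\<And>n y. \<bar>v n y\<bar> \<le> 1"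
  obtains \<theta> :: "'y \<Rightarrow> real" and w :: "nat \<Rightarrow> real \<Rightarrow> real" and \<tau> :: "real \<Rightarrow> real" where
    "\<theta> \<in> borel_measurable Y" "\<And>n. w n \<in> borel_measurable borel" "\<And>n y. w n (\<theta> y) = v n y"
    "\<And>y. \<tau> (\<theta> y) = \<theta> y"
    "\<And>B. B \<in> sets borel \<Longrightarrow> \<tau> -` B \<in> sigma_sets UNIV {{x. w n x < r} | n r. True}"
    "\<tau> \<in> borel_measurable borel"
proof -
  define \<rho> where "\<rho> m = real_of_rat (nat_to_rat_surj m)" for m
  have \<rho>: "\<exists>m. a < \<rho> m \<and> \<rho> m < b" if ab: "a < b" for a b
  proof -
    obtain r where r: "a < real_of_rat r" "real_of_rat r < b" using of_rat_dense[OF ab] by blast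
    obtain m where "nat_to_rat_surj m = r" using surj_nat_to_rat_surj by (metis surj_def)
    then show ?thesis using r by (auto simp: \<rho>_def)
  qed
  \<comment> \<open>Question number \<open>k\<close> is about the pair of an index and a rational
    that \<open>k\<close> encodes.\<close>
  define c where "c k f = (f (fst (prod_decode k)) < \<rho> (snd (prod_decode k)))" for k and f :: "nat \<Rightarrow> real"
  define \<theta> where "\<theta> y = code3 (\<lambda>k. c k (\<lambda>n. v n y))" for y
  define B where "B k = {x::real. \<lfloor>3 ^ Suc k * x\<rfloor> mod 3 = 1}" for k
  have [measurable]: "B k \<in> sets borel" for k
  proof -
    have "B k = (\<lambda>x. \<lfloor>3 ^ Suc k * x\<rfloor>) -` {i. i mod 3 = 1} \<inter> space borel" by (auto simp: B_def)
    also have "\<dots> \<in> sets borel"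
      by (rule measurable_sets[where A = "count_space UNIV"]) auto
    finally show ?thesis .
  qed
  have B: "\<theta> y \<in> B (prod_encode (n, m)) \<longleftrightarrow> v n y < \<rho> m" for y n m
    unfolding B_def \<theta>_def using code3_digit by (simp add: c_def)
  \<comment> \<open>A real number is the infimum of the rationals above it. Clamping to
    \<open>[-1, 1]\<close> and the default value 1 keep the infimum bounded off the range of
    \<open>\<theta>\<close> as well, and they do not disturb values in
    \<open>[-1, 1]\<close>.\<close>
  define w where "w n x = (INF m. if x \<in> B (prod_encode (n, m)) then max (-1) (min 1 (\<rho> m)) else 1)" for n x
  have bdd: "bdd_below (range (\<lambda>m. if x \<in> B (prod_encode (n, m)) then max (-1) (min 1 (\<rho> m)) else 1))" for n x
    by (intro bdd_belowI[of _ "-1"]) auto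
  have wm: "w n \<in> borel_measurable borel" for n
    unfolding w_def by (intro borel_measurable_cINF bdd) auto
  have w\<theta>: "w n (\<theta> y) = v n y" for n y
  proof (rule antisym)
    show "w n (\<theta> y) \<le> v n y"
    proof (rule field_le_epsilon)
      fix e :: real assume "0 < e"
      then obtain m where m: "v n y < \<rho> m" "\<rho> m < v n y + e" using \<rho>[of "v n y" "v n y + e"] by auto
      have "w n (\<theta> y) \<le> (if \<theta> y \<in> B (prod_encode (n, m)) then max (-1) (min 1 (\<rho> m)) else 1)"
        unfolding w_def by (intro cINF_lower bdd) auto
      also have "\<dots> \<le> v n y + e" using m bound[of n y] B[of y n m] by auto
      finally show "w n (\<theta> y) \<le> v n y + e" .
    qed
    show "v n y \<le> w n (\<theta> y)"
      unfolding w_def using bound[of n y] B[of y n] by (intro cINF_greatest) auto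
  qed
  define \<tau> where "\<tau> x = code3 (\<lambda>k. c k (\<lambda>n. w n x))" for x
  have \<tau>_sets: "\<tau> -` C \<in> sigma_sets UNIV {{x. w n x < r} | n r. True}" if C: "C \<in> sets borel" for C
  proof -
    define S where "S = sigma UNIV {{x. w n x < r} | n r. True}"
    have S: "space S = UNIV" "sets S = sigma_sets UNIV {{x. w n x < r} | n r. True}"
      by (auto simp: S_def)
    have "\<tau> \<in> borel_measurable S"
      unfolding \<tau>_def
    proof (rule code3_measurable)
      show "{x \<in> space S. c k (\<lambda>n. w n x)} \<in> sets S" for k
        unfolding S c_def by (intro sigma_sets.Basic) auto
    qed
    from measurable_sets[OF this C] show ?thesis using S by simp
  qed
  have "\<tau> \<in> borel_measurable borel"
    unfolding \<tau>_def using wm by (intro code3_measurable) (auto simp: c_def)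
  moreover have "\<theta> \<in> borel_measurable Y"
    unfolding \<theta>_def by (intro code3_measurable) (auto simp: c_def)
  moreover have "\<tau> (\<theta> y) = \<theta> y" for y
    unfolding \<tau>_def w\<theta> by (simp add: \<theta>_def)
  ultimately show ?thesis using that wm w\<theta> \<tau>_sets by blast
qed

section \<open>Multiplicative embeddings\<close>

lemma snd_set_map_apsnd: "snd ` set (map (apsnd A) s) = A ` snd ` set s"
  by force

text \<open>\<open>u f\<close> stands for the phase \<open>exp(i \<xi> f)\<close>. These assumptions
  already give continuity of combinations in the functions involved, which helps to verify the
  further assumptions of \<open>Lp_phase\<close> from a dense set.\<close>

locale Lp_phase_map =
  fixes M :: "'a measure" and p :: real and Y :: "'y measure" and q :: real
    and u :: "('a \<Rightarrow> complex) \<Rightarrow> 'y \<Rightarrow> complex"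
  assumes p: "0 < p" and q: "0 < q"
    and u_measurable: "f \<in> Lp_space M p \<Longrightarrow> u f \<in> borel_measurable Y"
    and u_unit: "cmod (u f y) = 1"
    and u_dist: "f \<in> Lp_space M p \<Longrightarrow> g \<in> Lp_space M p \<Longrightarrow>
      (\<integral>\<^sup>+ y. ennreal (cmod (u f y - u g y) powr q) \<partial>Y) = ennreal (Lp_int M p (\<lambda>x. f x - g x))"
begin

lemma u_diff_Lp:
  assumes "f \<in> Lp_space M p" "g \<in> Lp_space M p"
  shows "(\<lambda>y. u f y - u g y) \<in> Lp_space Y q"
    "Lp_int Y q (\<lambda>y. u f y - u g y) = Lp_int M p (\<lambda>x. f x - g x)"
proof -
  have "(\<lambda>y. u f y - u g y) \<in> borel_measurable Y"
    using u_measurable[OF assms(1)] u_measurable[OF assms(2)] by measurable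
  then show "(\<lambda>y. u f y - u g y) \<in> Lp_space Y q"
    by (rule Lp_spaceI) (simp add: u_dist[OF assms])
  show "Lp_int Y q (\<lambda>y. u f y - u g y) = Lp_int M p (\<lambda>x. f x - g x)"
    unfolding Lp_int_def[of Y] u_dist[OF assms] by simp
qed

lemma u_cong:
  assumes f: "f \<in> Lp_space M p" and g: "g \<in> Lp_space M p" and eq: "AE x in M. f x = g x"
  shows "AE y in Y. u f y = u g y"
proof -
  have "Lp_int M p (\<lambda>x. f x - g x) = Lp_int M p (\<lambda>x. 0)"
    using eq by (intro Lp_int_cong_AE) auto
  then have "Lp_int Y q (\<lambda>y. u f y - u g y) = 0" using u_diff_Lp[OF f g] by simp
  then show ?thesis using Lp_int_eq_0_iff[OF u_diff_Lp(1)[OF f g]] by simp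
qed

text \<open>With total coefficient 0 each \<open>u f\<close> may be replaced by its difference from
  the phase of 0, which lies in L_q. A single phase does not when \<open>Y\<close> has infinite
  measure.\<close>

lemma comb_u_Lp:
  assumes "snd ` set s \<subseteq> Lp_space M p" "weight s = 0"
  shows "comb u s \<in> Lp_space Y q"
proof -
  have "comb (\<lambda>f y. u f y - u (\<lambda>x. 0) y) s y = comb u s y - weight s * u (\<lambda>x. 0) y" for y
    by (induction s) (auto simp: algebra_simps)
  then have "comb u s = comb (\<lambda>f y. u f y - u (\<lambda>x. 0) y) s" using assms(2) by auto
  also have "\<dots> \<in> Lp_space Y q"
    using assms(1) by (intro comb_Lp_space q u_diff_Lp(1) Lp_zero) auto
  finally show ?thesis .
qed

lemma comb_u_tendsto:
  assumes A: "\<And>m f. f \<in> snd ` set s \<Longrightarrow> A m f \<in> Lp_space M p" "\<And>f. f \<in> snd ` set s \<Longrightarrow> B f \<in> Lp_space M p"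
    and lim: "\<And>f. f \<in> snd ` set s \<Longrightarrow> (\<lambda>m::nat. Lp_int M p (\<lambda>x. A m f x - B f x)) \<longlonglongrightarrow> 0"
    and "weight s = 0"
  shows "(\<lambda>m. Lp_int Y q (comb u (map (apsnd (A m)) s))) \<longlonglongrightarrow> Lp_int Y q (comb u (map (apsnd B) s))"
proof (rule Lp_int_tendsto[OF q])
  show "comb u (map (apsnd (A m)) s) \<in> Lp_space Y q" for m
    using A assms(4) by (intro comb_u_Lp) (auto simp only: snd_set_map_apsnd weight_map_apsnd)
  show "comb u (map (apsnd B) s) \<in> Lp_space Y q"
    using A assms(4) by (intro comb_u_Lp) (auto simp only: snd_set_map_apsnd weight_map_apsnd)
  have "(\<forall>m. (\<lambda>y. comb u (map (apsnd (A m)) s) y - comb u (map (apsnd B) s) y) \<in> Lp_space Y q) \<and>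
    (\<lambda>m. Lp_int Y q (\<lambda>y. comb u (map (apsnd (A m)) s) y - comb u (map (apsnd B) s) y)) \<longlonglongrightarrow> 0"
    using A lim
  proof (induction s)
    case (Cons af s)
    obtain a f where af: "af = (a, f)" by fastforce
    let ?d = "\<lambda>m y. comb u (map (apsnd (A m)) s) y - comb u (map (apsnd B) s) y"
    let ?e = "\<lambda>m y. u (A m f) y - u (B f) y"
    have IH: "?d m \<in> Lp_space Y q" "(\<lambda>m. Lp_int Y q (?d m)) \<longlonglongrightarrow> 0" for m
      using Cons.IH Cons.prems by auto
    have f: "A m f \<in> Lp_space M p" "B f \<in> Lp_space M p" for m using Cons.prems af by auto
    have e: "?e m \<in> Lp_space Y q" for m by (intro u_diff_Lp f)
    have "(\<lambda>m. Lp_int M p (\<lambda>x. A m f x - B f x)) \<longlonglongrightarrow> 0" using Cons.prems(3)[of f] af by simp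
    then have "(\<lambda>m. Lp_int Y q (?e m)) \<longlonglongrightarrow> 0" using u_diff_Lp(2)[OF f] by simp
    then have "(\<lambda>m. Lp_int Y q (\<lambda>y. a * ?e m y + ?d m y)) \<longlonglongrightarrow> 0"
      by (intro Lp_null_add q Lp_null_scale Lp_space_scale(1) e IH)
    moreover have "(\<lambda>y. a * ?e m y + ?d m y) \<in> Lp_space Y q" for m
      by (intro Lp_space_add q Lp_space_scale(1) e IH)
    moreover have "(\<lambda>y. comb u (map (apsnd (A m)) (af # s)) y - comb u (map (apsnd B) (af # s)) y) = (\<lambda>y. a * ?e m y + ?d m y)" for m
      by (auto simp: af algebra_simps)
    ultimately show ?case by simp
  qed simp
  then show "(\<lambda>m. Lp_int Y q (\<lambda>y. comb u (map (apsnd (A m)) s) y - comb u (map (apsnd B) s) y)) \<longlonglongrightarrow> 0"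
    by blast
qed

text \<open>Both sides depend continuously on the functions occurring in \<open>s\<close>, and
  \<open>P\<close> is itself continuous.\<close>

lemma u_isometry_by_density:
  assumes P: "Lp_linear_isometry M p P"
    and S: "\<And>f. f \<in> Lp_space M p \<Longrightarrow>
      \<exists>g :: nat \<Rightarrow> _. (\<forall>n. g n \<in> S \<inter> Lp_space M p) \<and> (\<lambda>n. Lp_int M p (\<lambda>x. g n x - f x)) \<longlonglongrightarrow> 0"
    and iso: "\<And>s. snd ` set s \<subseteq> S \<inter> Lp_space M p \<Longrightarrow> weight s = 0 \<Longrightarrow>
      Lp_int Y q (comb u (map (apsnd P) s)) = Lp_int Y q (comb u s)"
    and s: "snd ` set s \<subseteq> Lp_space M p" "weight s = 0"
  shows "Lp_int Y q (comb u (map (apsnd P) s)) = Lp_int Y q (comb u s)"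
proof -
  obtain g :: "_ \<Rightarrow> nat \<Rightarrow> _" where g: "\<And>f n. f \<in> Lp_space M p \<Longrightarrow> g f n \<in> S \<inter> Lp_space M p"
    "\<And>f. f \<in> Lp_space M p \<Longrightarrow> (\<lambda>n. Lp_int M p (\<lambda>x. g f n x - f x)) \<longlonglongrightarrow> 0"
    using S by metis
  have PL: "P f \<in> Lp_space M p" if "f \<in> Lp_space M p" for f
    using P that by (simp add: Lp_linear_isometry_def)
  have Pd: "Lp_int M p (\<lambda>x. P f x - P h x) = Lp_int M p (\<lambda>x. f x - h x)" if "f \<in> Lp_space M p" "h \<in> Lp_space M p" for f h
    using P that unfolding Lp_linear_isometry_def Lp_dist_eq_iff[OF p] by blast
  have "(\<lambda>n. Lp_int Y q (comb u (map (apsnd (\<lambda>f. g f n)) s))) \<longlonglongrightarrow> Lp_int Y q (comb u (map (apsnd (\<lambda>f. f)) s))"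
    using g s by (intro comb_u_tendsto) auto
  moreover have "(\<lambda>n. Lp_int Y q (comb u (map (apsnd (\<lambda>f. P (g f n))) s))) \<longlonglongrightarrow> Lp_int Y q (comb u (map (apsnd P) s))"
  proof (rule comb_u_tendsto)
    fix f assume "f \<in> snd ` set s"
    then have f: "f \<in> Lp_space M p" using s by auto
    then show "P (g f n) \<in> Lp_space M p" "P f \<in> Lp_space M p" for n using g PL by auto
    have "Lp_int M p (\<lambda>x. P (g f n) x - P f x) = Lp_int M p (\<lambda>x. g f n x - f x)" for n
      using g(1)[OF f, of n] f by (intro Pd) auto
    then show "(\<lambda>n. Lp_int M p (\<lambda>x. P (g f n) x - P f x)) \<longlonglongrightarrow> 0" using g(2)[OF f] by simp
  qed (rule s)
  moreover have "Lp_int Y q (comb u (map (apsnd (\<lambda>f. P (g f n))) s)) = Lp_int Y q (comb u (map (apsnd (\<lambda>f. g f n)) s))" for n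
  proof -
    have "map (apsnd (\<lambda>f. P (g f n))) s = map (apsnd P) (map (apsnd (\<lambda>f. g f n)) s)" by auto
    moreover have "snd ` set (map (apsnd (\<lambda>f. g f n)) s) \<subseteq> S \<inter> Lp_space M p" using g s by auto
    ultimately show ?thesis using iso[of "map (apsnd (\<lambda>f. g f n)) s"] s(2) by (metis weight_map_apsnd)
  qed
  moreover have "map (apsnd (\<lambda>f. f)) s = s" by (induction s) auto
  ultimately show ?thesis using LIMSEQ_unique by fastforce
qed

end

text \<open>The countable dense family \<open>D\<close> makes coding by one real function possible.
  Additivity is required only almost everywhere, which is all that a Gaussian field offers.\<close>

locale Lp_phase = Lp_phase_map +
  fixes D :: "nat \<Rightarrow> 'a \<Rightarrow> complex"
  assumes u_add: "f \<in> Lp_space M p \<Longrightarrow> g \<in> Lp_space M p \<Longrightarrow> AE y in Y. u (\<lambda>x. f x + g x) y = u f y * u g y"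
    and u_isometry: "Lp_linear_isometry M p P \<Longrightarrow> snd ` set s \<subseteq> Lp_space M p \<Longrightarrow> weight s = 0 \<Longrightarrow>
      Lp_int Y q (comb u (map (apsnd P) s)) = Lp_int Y q (comb u s)"
    and D_Lp: "D n \<in> Lp_space M p"
    and D_dense: "f \<in> Lp_space M p \<Longrightarrow> 0 < e \<Longrightarrow> \<exists>n. Lp_int M p (\<lambda>x. D n x - f x) < e"
begin

lemma u_zero: "AE y in Y. u (\<lambda>x. 0) y = 1"
  using u_add[OF Lp_zero Lp_zero]
proof eventually_elim
  case (elim y)
  have "u (\<lambda>x. 0) y \<noteq> 0" using u_unit[of "\<lambda>x. 0" y] by auto
  then show ?case using elim by simp
qed

lemma u_uminus:
  assumes f: "f \<in> Lp_space M p"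
  shows "AE y in Y. u (\<lambda>x. - f x) y = cnj (u f y)"
  using u_add[OF f Lp_space_uminus[OF f]] u_zero
proof eventually_elim
  case (elim y)
  have "u f y * cnj (u f y) = 1" using u_unit[of f y] by (simp add: complex_norm_square[symmetric])
  moreover have "u f y * u (\<lambda>x. - f x) y = 1" using elim by simp
  ultimately show ?case using u_unit[of f y] by (metis mult_cancel_left norm_zero zero_neq_one)
qed

text \<open>If \<open>A\<close> is \<open>P\<close> followed by translation by \<open>c\<close>,
  every phase acquires the same unimodular factor \<open>u c\<close>, which the modulus of a
  combination does not see.\<close>

lemma u_affine_isometry:
  assumes A: "Lp_affine_isometry M p A" and s: "snd ` set s \<subseteq> Lp_space M p" "weight s = 0"
  shows "Lp_int Y q (comb u (map (apsnd A) s)) = Lp_int Y q (comb u s)"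
proof -
  obtain P c where P: "Lp_linear_isometry M p P" and c: "c \<in> Lp_space M p"
    and eq: "\<And>f. f \<in> Lp_space M p \<Longrightarrow> AE x in M. A f x = P f x + c x"
    using A unfolding Lp_affine_isometry_def Lp_eq_def by blast
  have AL: "A f \<in> Lp_space M p" and PL: "P f \<in> Lp_space M p" if "f \<in> Lp_space M p" for f
    using A P that by (auto simp: Lp_affine_isometry_def Lp_linear_isometry_def)
  have "AE y in Y. comb u (map (apsnd A) s) y = u c y * comb u (map (apsnd P) s) y"
    using s(1)
  proof (induction s)
    case (Cons af s)
    obtain a f where af: "af = (a, f)" by fastforce
    have f: "f \<in> Lp_space M p" using Cons af by auto
    have "AE y in Y. u (A f) y = u (\<lambda>x. P f x + c x) y"
      by (intro u_cong AL f Lp_space_add p PL c eq)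
    moreover have "AE y in Y. u (\<lambda>x. P f x + c x) y = u (P f) y * u c y"
      by (intro u_add PL f c)
    moreover have "AE y in Y. comb u (map (apsnd A) s) y = u c y * comb u (map (apsnd P) s) y"
      using Cons by auto
    ultimately show ?case by eventually_elim (simp add: af algebra_simps)
  qed simp
  then have "Lp_int Y q (comb u (map (apsnd A) s)) = Lp_int Y q (\<lambda>y. u c y * comb u (map (apsnd P) s) y)"
    by (rule Lp_int_cong_AE)
  also have "\<dots> = Lp_int Y q (comb u (map (apsnd P) s))"
    by (simp add: Lp_int_def norm_mult u_unit)
  finally show ?thesis using u_isometry[OF P s] by simp
qed

text \<open>\<open>Y\<close> is replaced by the line, with an image measure under a coding
  \<open>\<theta>\<close> of the countably many phases \<open>u (D n)\<close>. The remaining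
  \<open>u f\<close> are not factored through \<open>\<theta>\<close> one by one: \<open>E f\<close>
  arises from the \<open>e n\<close> by equidistant extension, and its pullback to \<open>Y\<close>
  is identified with \<open>u f - 1\<close> afterwards.\<close>

theorem real_embedding:
  "\<exists>(N :: real measure) E. standard_measure_space N \<and> Lp_embedding M p N q E"
proof -
  note uD[measurable] = u_measurable[OF D_Lp]
  \<comment> \<open>Real parts sit at even indices, imaginary parts at odd ones.\<close>
  define v where "v k y = (if even k then Re (u (D (k div 2)) y) else Im (u (D (k div 2)) y))" for k y
  have vm: "v k \<in> borel_measurable Y" for k
    by (cases "even k") (auto simp: v_def[abs_def])
  have vb: "\<bar>v k y\<bar> \<le> 1" for k y
    using abs_Re_le_cmod[of "u (D (k div 2)) y"] abs_Im_le_cmod[of "u (D (k div 2)) y"] u_unit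
    by (auto simp: v_def)
  obtain \<theta> :: "'b \<Rightarrow> real" and w :: "nat \<Rightarrow> real \<Rightarrow> real" and \<tau> :: "real \<Rightarrow> real" where
    \<theta>[measurable]: "\<theta> \<in> borel_measurable Y" and w[measurable]: "\<And>n. w n \<in> borel_measurable borel"
    and w\<theta>: "\<And>n y. w n (\<theta> y) = v n y" and \<tau>\<theta>: "\<And>y. \<tau> (\<theta> y) = \<theta> y"
    and \<tau>s: "\<And>B. B \<in> sets borel \<Longrightarrow> \<tau> -` B \<in> sigma_sets UNIV {{x. w n x < r} | n r. True}"
    and \<tau>[measurable]: "\<tau> \<in> borel_measurable borel"
    by (rule real_coding[of v Y, OF vm vb]) (rule that)
  define e where "e n x = Complex (w (2 * n) x) (w (Suc (2 * n)) x) - 1" for n x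
  have [measurable]: "e n \<in> borel_measurable borel" for n
    unfolding e_def by (simp add: borel_measurable_complex_iff)
  have e\<theta>: "e n (\<theta> y) = u (D n) y - 1" for n y
    by (simp add: e_def w\<theta> v_def complex_eq_iff)
  \<comment> \<open>Where all the phases \<open>u (D n)\<close> equal 1, \<open>\<theta>\<close> has
    a single value, possibly an atom of infinite mass. No difference of phases is seen there, so
    \<open>N\<close> gives it measure 0.\<close>
  define B1 where "B1 = {x. \<exists>n. e n x \<noteq> 0}"
  have [measurable]: "B1 \<in> sets borel" unfolding B1_def by measurable
  define N where "N = density (distr Y borel \<theta>) (indicator B1)"
  have sets_N[simp, measurable_cong]: "sets N = sets borel" and space_N[simp]: "space N = UNIV"
    by (auto simp: N_def)
  have nn_N: "(\<integral>\<^sup>+ x. \<phi> x \<partial>N) = (\<integral>\<^sup>+ y. indicator B1 (\<theta> y) * \<phi> (\<theta> y) \<partial>Y)"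
    if [measurable]: "\<phi> \<in> borel_measurable borel" for \<phi>
    unfolding N_def by (subst nn_integral_density) (auto simp: nn_integral_distr)
  have AE_N: "(AE x in N. R x) \<longleftrightarrow> (AE y in Y. \<theta> y \<in> B1 \<longrightarrow> R (\<theta> y))"
    if [measurable]: "Measurable.pred borel R" for R
    unfolding N_def by (subst AE_density) (auto simp: AE_distr_iff indicator_def)
  \<comment> \<open>Pullback from the line to \<open>Y\<close>, with value 0 outside the preimage of
    \<open>B1\<close>; it preserves q-th power integrals.\<close>
  define sh where "sh h y = (indicator B1 (\<theta> y) * h (\<theta> y) :: complex)" for h y
  have sh_measurable: "sh h \<in> borel_measurable Y" if [measurable]: "h \<in> borel_measurable borel" for h
    unfolding sh_def by measurable
  have sh_nn: "(\<integral>\<^sup>+ y. ennreal (cmod (sh h y) powr q) \<partial>Y) = (\<integral>\<^sup>+ x. ennreal (cmod (h x) powr q) \<partial>N)"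
    if [measurable]: "h \<in> borel_measurable borel" for h
    by (subst nn_N) (auto simp: sh_def indicator_def intro!: nn_integral_cong)
  have sh_Lp: "sh h \<in> Lp_space Y q \<longleftrightarrow> h \<in> Lp_space N q" "Lp_int Y q (sh h) = Lp_int N q h"
    if h: "h \<in> borel_measurable borel" for h
    using h sh_measurable[OF h] sh_nn[OF h] by (auto simp: Lp_space_def Lp_int_def)
  have sh_e: "sh (e n) y = u (D n) y - 1" for n y
    by (auto simp: sh_def e\<theta>[symmetric] indicator_def B1_def)
  have u1: "(\<lambda>y. u f y - 1) \<in> Lp_space Y q" if f: "f \<in> Lp_space M p" for f
    using u_zero u_measurable[OF f]
    by (intro Lp_space_bound(1)[OF u_diff_Lp(1)[OF f Lp_zero]]) (auto elim!: eventually_mono)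
  have eL: "e n \<in> Lp_space N q" for n
  proof -
    have "sh (e n) = (\<lambda>y. u (D n) y - 1)" by (auto simp: sh_e)
    then show ?thesis using u1[OF D_Lp] sh_Lp(1)[of "e n"] by simp
  qed
  have e_dist: "Lp_int N q (\<lambda>x. e n x - e m x) = Lp_int M p (\<lambda>x. D n x - D m x)" for n m
  proof -
    have "sh (\<lambda>x. e n x - e m x) = (\<lambda>y. u (D n) y - u (D m) y)"
    proof
      fix y
      have "sh (\<lambda>x. e n x - e m x) y = sh (e n) y - sh (e m) y" by (simp add: sh_def algebra_simps)
      then show "sh (\<lambda>x. e n x - e m x) y = u (D n) y - u (D m) y" by (simp add: sh_e)
    qed
    then show ?thesis using sh_Lp(2)[of "\<lambda>x. e n x - e m x"] u_diff_Lp(2)[OF D_Lp D_Lp] by simp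
  qed
  define E where "E f = (SOME H. H \<in> Lp_space N q \<and> (\<forall>n. Lp_int N q (\<lambda>x. e n x - H x) = Lp_int M p (\<lambda>x. D n x - f x)))" for f
  have E: "E f \<in> Lp_space N q" "Lp_int N q (\<lambda>x. e n x - E f x) = Lp_int M p (\<lambda>x. D n x - f x)"
    if f: "f \<in> Lp_space M p" for f n
  proof -
    have "\<exists>H\<in>Lp_space N q. \<forall>n\<in>UNIV. Lp_int N q (\<lambda>x. e n x - H x) = Lp_int M p (\<lambda>x. D n x - f x)"
      using D_dense[OF f] by (intro Lp_equidistant_extension p q D_Lp eL e_dist f) auto
    then have "\<exists>H. H \<in> Lp_space N q \<and> (\<forall>n. Lp_int N q (\<lambda>x. e n x - H x) = Lp_int M p (\<lambda>x. D n x - f x))"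
      by blast
    from someI_ex[OF this] show "E f \<in> Lp_space N q" "Lp_int N q (\<lambda>x. e n x - E f x) = Lp_int M p (\<lambda>x. D n x - f x)"
      unfolding E_def by auto
  qed
  have Em[measurable]: "E f \<in> borel_measurable borel" if "f \<in> Lp_space M p" for f
    using Lp_space_measurable[OF E(1)[OF that]] by (simp add: measurable_cong_sets[OF sets_N refl])
  \<comment> \<open>Along \<open>D (k n)\<close> tending to \<open>f\<close>, both sides are limits
    in L_q of the same functions \<open>u (D (k n)) - 1\<close>.\<close>
  have sh_E: "AE y in Y. sh (E f) y = u f y - 1" if f: "f \<in> Lp_space M p" for f
  proof -
    obtain k where k: "(\<lambda>n. Lp_int M p (\<lambda>x. D (k n) x - f x)) \<longlonglongrightarrow> 0"
      using null_sequence_exists[of UNIV "\<lambda>n. Lp_int M p (\<lambda>x. D n x - f x)"] D_dense[OF f] by auto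
    have m: "e n \<in> borel_measurable borel" "E f \<in> borel_measurable borel" for n using Em[OF f] by auto
    have L: "(\<lambda>y. sh (e n) y - sh (E f) y) \<in> Lp_space Y q" for n
      using sh_Lp(1)[OF m(1)] sh_Lp(1)[OF m(2)] eL E(1)[OF f] by (intro Lp_space_diff q) auto
    have "Lp_int Y q (\<lambda>y. sh (e n) y - sh (E f) y) = Lp_int M p (\<lambda>x. D n x - f x)" for n
    proof -
      have "sh (\<lambda>x. e n x - E f x) = (\<lambda>y. sh (e n) y - sh (E f) y)"
        by (auto simp: sh_def algebra_simps)
      then show ?thesis using sh_Lp(2)[of "\<lambda>x. e n x - E f x"] m E(2)[OF f] by simp
    qed
    then have 1: "(\<lambda>n. Lp_int Y q (\<lambda>y. sh (e (k n)) y - sh (E f) y)) \<longlonglongrightarrow> 0" using k by simp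
    have 2: "(\<lambda>n. Lp_int Y q (\<lambda>y. u (D (k n)) y - u f y)) \<longlonglongrightarrow> 0"
      using k u_diff_Lp(2)[OF D_Lp f] by simp
    have "(\<lambda>n. Lp_int Y q (\<lambda>y. (sh (e (k n)) y - sh (E f) y) + (-1) * (u (D (k n)) y - u f y))) \<longlonglongrightarrow> 0"
      by (intro Lp_null_add Lp_null_scale 1 2 q L Lp_space_scale(1) u_diff_Lp(1) D_Lp f)
    then have "Lp_int Y q (\<lambda>y. u f y - 1 - sh (E f) y) = 0"
      by (simp add: sh_e LIMSEQ_const_iff algebra_simps)
    moreover have "(\<lambda>y. u f y - 1 - sh (E f) y) \<in> Lp_space Y q"
      using sh_Lp(1)[OF m(2)] E(1)[OF f] by (intro Lp_space_diff[OF q u1[OF f]]) simp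
    ultimately have "AE y in Y. u f y - 1 - sh (E f) y = 0" using Lp_int_eq_0_iff by blast
    then show ?thesis by eventually_elim simp
  qed
  have E_\<theta>: "AE y in Y. \<theta> y \<in> B1 \<longrightarrow> E f (\<theta> y) = u f y - 1" if f: "f \<in> Lp_space M p" for f
    using sh_E[OF f] by eventually_elim (auto simp: sh_def)
  have sh_comb: "AE y in Y. sh (comb E s) y = comb u s y - weight s" if "snd ` set s \<subseteq> Lp_space M p" for s
    using that
  proof (induction s)
    case (Cons af s)
    obtain a f where af: "af = (a, f)" by fastforce
    have "AE y in Y. sh (E f) y = u f y - 1" using Cons af by (intro sh_E) auto
    moreover have "AE y in Y. sh (comb E s) y = comb u s y - weight s" using Cons by auto
    ultimately show ?case
    proof eventually_elim
      case (elim y)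
      have "sh (comb E (af # s)) y = a * sh (E f) y + sh (comb E s) y"
        by (simp add: af sh_def algebra_simps)
      also have "\<dots> = comb u (af # s) y - weight (af # s)"
        unfolding elim by (simp add: af algebra_simps)
      finally show ?case .
    qed
  qed (simp add: sh_def)
  have comb_m: "comb E s \<in> borel_measurable borel" if "snd ` set s \<subseteq> Lp_space M p" for s
    using that Em by (intro comb_measurable) auto
  have comb_int: "Lp_int N q (comb E s) = Lp_int Y q (comb u s)" if s: "snd ` set s \<subseteq> Lp_space M p" "weight s = 0" for s
    using sh_Lp(2)[OF comb_m[OF s(1)]] Lp_int_cong_AE[OF sh_comb[OF s(1)]] s(2) by simp
  \<comment> \<open>\<open>E\<close> is not multiplicative, but \<open>E + 1\<close> is, for it
    corresponds to the phase itself.\<close>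
  define U where "U f x = E f x + 1" for f x
  have U_comb: "comb U s x = comb E s x + weight s" for s x
    by (induction s) (auto simp: U_def algebra_simps)
  have U_add: "AE x in N. U (\<lambda>z. f z + g z) x = U f x * U g x" if f: "f \<in> Lp_space M p" and g: "g \<in> Lp_space M p" for f g
  proof -
    have fg: "(\<lambda>z. f z + g z) \<in> Lp_space M p" by (intro Lp_space_add p f g)
    note [measurable] = Em[OF f] Em[OF g] Em[OF fg]
    have "AE y in Y. \<theta> y \<in> B1 \<longrightarrow> U (\<lambda>z. f z + g z) (\<theta> y) = U f (\<theta> y) * U g (\<theta> y)"
      using E_\<theta>[OF f] E_\<theta>[OF g] E_\<theta>[OF fg] u_add[OF f g] by eventually_elim (auto simp: U_def)
    then show ?thesis by (subst AE_N) (auto simp: U_def)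
  qed
  have U_cnj: "AE x in N. U (\<lambda>z. - f z) x = cnj (U f x)" if f: "f \<in> Lp_space M p" for f
  proof -
    have mf: "(\<lambda>z. - f z) \<in> Lp_space M p" by (intro Lp_space_uminus f)
    note [measurable] = Em[OF f] Em[OF mf]
    have [measurable]: "(cnj :: complex \<Rightarrow> _) \<in> borel_measurable borel"
      by (intro borel_measurable_continuous_onI continuous_intros)
    have "AE y in Y. \<theta> y \<in> B1 \<longrightarrow> U (\<lambda>z. - f z) (\<theta> y) = cnj (U f (\<theta> y))"
      using E_\<theta>[OF f] E_\<theta>[OF mf] u_uminus[OF f] by eventually_elim (auto simp: U_def)
    then show ?thesis by (subst AE_N) (auto simp: U_def)
  qed
  have U_bdd: "AE x in N. cmod (U f x) \<le> 1" if f: "f \<in> Lp_space M p" for f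
  proof -
    note [measurable] = Em[OF f]
    have "AE y in Y. \<theta> y \<in> B1 \<longrightarrow> cmod (U f (\<theta> y)) \<le> 1"
      using E_\<theta>[OF f] by eventually_elim (auto simp: U_def u_unit)
    then show ?thesis by (subst AE_N) (auto simp: U_def)
  qed
  have E_e: "AE x in N. e n x = E (D n) x" for n
  proof -
    note [measurable] = Em[OF D_Lp]
    have "AE y in Y. \<theta> y \<in> B1 \<longrightarrow> e n (\<theta> y) = E (D n) (\<theta> y)"
      using E_\<theta>[OF D_Lp[of n]] by eventually_elim (auto simp: e\<theta>)
    then show ?thesis by (subst AE_N) auto
  qed
  have E_zero: "AE x in N. E (\<lambda>x. 0) x = 0"
  proof -
    note [measurable] = Em[OF Lp_zero]
    have "AE y in Y. \<theta> y \<in> B1 \<longrightarrow> E (\<lambda>x. 0) (\<theta> y) = 0"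
      using E_\<theta>[OF Lp_zero] u_zero by eventually_elim auto
    then show ?thesis by (subst AE_N) auto
  qed
  \<comment> \<open>For weight 0 the combinations of \<open>U\<close> and of \<open>E\<close>
    coincide, hence lie in L_q; weight 0 survives products because the weight is multiplicative.
    Equality almost everywhere is built in, since \<open>U\<close> is multiplicative only up to null
    sets.\<close>
  define \<A> where "\<A> = {h \<in> borel_measurable N. \<exists>s. snd ` set s \<subseteq> Lp_space M p \<and> weight s = 0 \<and> (AE x in N. h x = comb U s x)}"
  have \<A>I: "h \<in> \<A>" if "h \<in> borel_measurable N" "snd ` set s \<subseteq> Lp_space M p" "weight s = 0" "AE x in N. h x = comb U s x" for h s
    using that by (auto simp: \<A>_def)
  have \<A>E: "\<exists>s. h \<in> borel_measurable N \<and> snd ` set s \<subseteq> Lp_space M p \<and> weight s = 0 \<and> (AE x in N. h x = comb U s x)" if "h \<in> \<A>" for h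
    using that by (auto simp: \<A>_def)
  have e_\<A>: "e n \<in> \<A>" for n
  proof (rule \<A>I[of _ "[(1, D n), (-1, \<lambda>x. 0)]"])
    show "AE x in N. e n x = comb U [(1, D n), (-1, \<lambda>x. 0)] x"
      using E_e[of n] E_zero by eventually_elim (simp add: U_def)
  qed (auto simp: D_Lp measurable_cong_sets[OF sets_N refl])
  interpret A: Lp_algebra N q \<A>
  proof
    show "0 < q" by (rule q)
    show "h \<in> Lp_space N q" if "h \<in> \<A>" for h
    proof -
      obtain s where s: "h \<in> borel_measurable N" "snd ` set s \<subseteq> Lp_space M p" "weight s = 0" "AE x in N. h x = comb U s x"
        using \<A>E[OF \<open>h \<in> \<A>\<close>] by blast
      have "comb E s \<in> Lp_space N q" using s E by (intro comb_Lp_space q) auto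
      then show ?thesis
        by (rule Lp_space_bound(1)[OF _ s(1)]) (use s(3,4) in \<open>auto elim!: eventually_mono simp: U_comb\<close>)
    qed
    show "\<exists>B. AE x in N. cmod (h x) \<le> B" if "h \<in> \<A>" for h
    proof -
      obtain s where s: "snd ` set s \<subseteq> Lp_space M p" "AE x in N. h x = comb U s x"
        using \<A>E[OF \<open>h \<in> \<A>\<close>] by blast
      have "AE x in N. cmod (comb U s x) \<le> (\<Sum>(a, f)\<leftarrow>s. cmod a)"
        using s(1)
      proof (induction s)
        case (Cons af s)
        obtain a f where af: "af = (a, f)" by fastforce
        have "AE x in N. cmod (U f x) \<le> 1" using Cons af by (intro U_bdd) auto
        moreover have "AE x in N. cmod (comb U s x) \<le> (\<Sum>(a, f)\<leftarrow>s. cmod a)" using Cons by auto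
        ultimately show ?case
        proof eventually_elim
          case (elim x)
          have "cmod (a * U f x) \<le> cmod a" using elim(1) by (simp add: norm_mult mult_left_le)
          then show ?case using elim(2) norm_triangle_mono[of "a * U f x" "cmod a" "comb U s x"] by (simp add: af)
        qed
      qed simp
      with s(2) have "AE x in N. cmod (h x) \<le> (\<Sum>(a, f)\<leftarrow>s. cmod a)" by eventually_elim simp
      then show ?thesis by blast
    qed
    show "(\<lambda>x. h x + k x) \<in> \<A>" if hk: "h \<in> \<A>" "k \<in> \<A>" for h k
    proof -
      obtain s where s: "h \<in> borel_measurable N" "snd ` set s \<subseteq> Lp_space M p" "weight s = 0" "AE x in N. h x = comb U s x"
        using \<A>E[OF hk(1)] by blast
      obtain t where t: "k \<in> borel_measurable N" "snd ` set t \<subseteq> Lp_space M p" "weight t = 0" "AE x in N. k x = comb U t x"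
        using \<A>E[OF hk(2)] by blast
      show ?thesis
      proof (rule \<A>I[of _ "s @ t"])
        show "AE x in N. h x + k x = comb U (s @ t) x" using s(4) t(4) by eventually_elim simp
      qed (use s t in auto)
    qed
    show "(\<lambda>x. c * h x) \<in> \<A>" if h: "h \<in> \<A>" for h c
    proof -
      obtain s where s: "h \<in> borel_measurable N" "snd ` set s \<subseteq> Lp_space M p" "weight s = 0" "AE x in N. h x = comb U s x"
        using \<A>E[OF h] by blast
      show ?thesis
      proof (rule \<A>I[of _ "scale c s"])
        show "AE x in N. c * h x = comb U (scale c s) x" using s(4) by eventually_elim simp
      qed (use s in auto)
    qed
    show "\<exists>w\<in>\<A>. AE x in N. w x = h x * k x" if hk: "h \<in> \<A>" "k \<in> \<A>" for h k
    proof -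
      obtain s where s: "h \<in> borel_measurable N" "snd ` set s \<subseteq> Lp_space M p" "weight s = 0" "AE x in N. h x = comb U s x"
        using \<A>E[OF hk(1)] by blast
      obtain t where t: "k \<in> borel_measurable N" "snd ` set t \<subseteq> Lp_space M p" "weight t = 0" "AE x in N. k x = comb U t x"
        using \<A>E[OF hk(2)] by blast
      let ?st = "cprod (\<lambda>f g x. f x + g x) s t"
      have "AE x in N. \<forall>f\<in>snd ` set s. \<forall>g\<in>snd ` set t. U (\<lambda>z. f z + g z) x = U f x * U g x"
        by (intro AE_finite_allI U_add subsetD[OF s(2)] subsetD[OF t(2)]) simp_all
      then have "AE x in N. comb U ?st x = comb U s x * comb U t x"
        by eventually_elim (intro comb_cprod, auto)
      then have "AE x in N. h x * k x = comb U ?st x"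
        using s(4) t(4) by eventually_elim simp
      moreover have "snd ` set ?st \<subseteq> Lp_space M p"
        unfolding snd_set_cprod using s(2) t(2) Lp_space_add[OF p] by blast
      ultimately have "(\<lambda>x. h x * k x) \<in> \<A>"
        using s t by (intro \<A>I[of _ ?st]) (auto simp: weight_cprod)
      then show ?thesis by (intro bexI[of _ "\<lambda>x. h x * k x"]) auto
    qed
    show "\<exists>w\<in>\<A>. AE x in N. w x = cnj (h x)" if h: "h \<in> \<A>" for h
    proof -
      obtain s where s: "h \<in> borel_measurable N" "snd ` set s \<subseteq> Lp_space M p" "weight s = 0" "AE x in N. h x = comb U s x"
        using \<A>E[OF h] by blast
      let ?s = "cconj (\<lambda>f x. - f x) s"
      have "AE x in N. \<forall>f\<in>snd ` set s. U (\<lambda>z. - f z) x = cnj (U f x)"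
        by (intro AE_finite_allI U_cnj subsetD[OF s(2)]) simp_all
      then have "AE x in N. comb U ?s x = cnj (comb U s x)"
        by eventually_elim (intro comb_cconj, auto)
      then have "AE x in N. cnj (h x) = comb U ?s x"
        using s(4) by eventually_elim simp
      moreover have "snd ` set ?s \<subseteq> Lp_space M p"
        unfolding snd_set_cconj using s(2) Lp_space_uminus by blast
      moreover have "(\<lambda>x. cnj (h x)) \<in> borel_measurable N"
        by (rule measurable_compose[OF s(1)]) (intro borel_measurable_continuous_onI continuous_intros)
      ultimately have "(\<lambda>x. cnj (h x)) \<in> \<A>"
        using s by (intro \<A>I[of _ ?s]) (auto simp: weight_cconj)
      then show ?thesis by (intro bexI[of _ "\<lambda>x. cnj (h x)"]) auto
    qed
    then have i_\<A>: "(\<lambda>x. (-\<i>) * e n x) \<in> \<A>" for n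
      using \<open>\<And>h c. h \<in> \<A> \<Longrightarrow> (\<lambda>x. c * h x) \<in> \<A>\<close> e_\<A> by blast
    \<comment> \<open>The real part of \<open>e k\<close> is \<open>w (2 * k) - 1\<close>, and that
      of \<open>(-\<i>) * e k\<close> is \<open>w (Suc (2 * k))\<close>.\<close>
    have gens: "{x. w n x < r} \<in> {{x \<in> space N. Re (h x) < r} | h r. h \<in> \<A>}" for n r
    proof (cases "even n")
      case True
      then obtain k where k: "n = 2 * k" by auto
      then have "{x. w n x < r} = {x \<in> space N. Re (e k x) < r - 1}" by (auto simp: e_def)
      then show ?thesis using e_\<A> by blast
    next
      case False
      then obtain k where k: "n = Suc (2 * k)" by (auto elim: oddE)
      then have "{x. w n x < r} = {x \<in> space N. Re ((-\<i>) * e k x) < r}" by (auto simp: e_def)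
      then show ?thesis
        using i_\<A>[of k] by (intro CollectI exI[of _ "\<lambda>x. (-\<i>) * e k x"] exI[of _ r] conjI)
    qed
    show "\<exists>B'\<in>sigma_sets (space N) {{x \<in> space N. Re (h x) < r} | h r. h \<in> \<A>}. AE x in N. x \<in> B \<longleftrightarrow> x \<in> B'"
      if B: "B \<in> sets N" for B
    \<comment> \<open>The preimage of \<open>B\<close> under \<open>\<tau>\<close> is generated by
      the \<open>w n\<close>. It agrees with \<open>B\<close> at all values of
      \<open>\<theta>\<close>, and \<open>N\<close> sees no others.\<close>
    proof (rule bexI[of _ "\<tau> -` B"])
      have [measurable]: "B \<in> sets borel" using B by simp
      show "AE x in N. x \<in> B \<longleftrightarrow> x \<in> \<tau> -` B"
        by (subst AE_N) (auto simp: \<tau>\<theta>)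
      have "{{x. w n x < r} | n r. True} \<subseteq> {{x \<in> space N. Re (h x) < r} | h r. h \<in> \<A>}"
        using gens by blast
      then have "sigma_sets UNIV {{x. w n x < r} | n r. True} \<subseteq> sigma_sets UNIV {{x \<in> space N. Re (h x) < r} | h r. h \<in> \<A>}"
        by (rule sigma_sets_mono')
      then show "\<tau> -` B \<in> sigma_sets (space N) {{x \<in> space N. Re (h x) < r} | h r. h \<in> \<A>}"
        using \<tau>s[of B] B by auto
    qed
    show "\<exists>C :: nat \<Rightarrow> _. range C \<subseteq> \<A> \<and> (AE x in N. \<exists>n. C n x \<noteq> 0)"
      using e_\<A> by (intro exI[of _ e] conjI) (auto simp: AE_N B1_def)
  qed
  have "Lp_embedding M p N q E"
  proof
    show "0 < p" "0 < q" by (fact p, fact q)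
    show "E f \<in> Lp_space N q" if "f \<in> Lp_space M p" for f by (rule E(1)[OF that])
    show "Lp_int N q (\<lambda>x. E f x - E g x) = Lp_int M p (\<lambda>x. f x - g x)"
      if f: "f \<in> Lp_space M p" and g: "g \<in> Lp_space M p" for f g
    proof -
      have "Lp_int N q (comb E [(1, f), (-1, g)]) = Lp_int Y q (comb u [(1, f), (-1, g)])"
        using f g by (intro comb_int) auto
      moreover have "comb E [(1, f), (-1, g)] = (\<lambda>x. E f x - E g x)" "comb u [(1, f), (-1, g)] = (\<lambda>x. u f x - u g x)"
        by auto
      ultimately show ?thesis using u_diff_Lp(2)[OF f g] by simp
    qed
    show "AE x in N. E (\<lambda>x. 0) x = 0" by (rule E_zero)
    show "\<exists>s. snd ` set s \<subseteq> Lp_space M p \<and> Lp_int N q (\<lambda>x. comb E s x - F x) < \<epsilon>"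
      if F: "F \<in> Lp_space N q" and \<epsilon>: "0 < \<epsilon>" for F \<epsilon>
    proof -
      obtain h where h: "h \<in> \<A>" "Lp_int N q (\<lambda>x. h x - F x) < \<epsilon>" using A.dense[OF F \<epsilon>] by blast
      obtain s where s: "snd ` set s \<subseteq> Lp_space M p" "weight s = 0" "AE x in N. h x = comb U s x"
        using \<A>E[OF h(1)] by blast
      have "Lp_int N q (\<lambda>x. comb E s x - F x) = Lp_int N q (\<lambda>x. h x - F x)"
        using s(2,3) by (intro Lp_int_cong_AE) (auto elim!: eventually_mono simp: U_comb)
      then show ?thesis using s(1) h(2) by (intro exI[of _ s]) simp
    qed
    show "Lp_int N q (comb E (map (apsnd A) s)) = Lp_int N q (comb E s)"
      if A: "Lp_affine_isometry M p A" and s: "snd ` set s \<subseteq> Lp_space M p" "weight s = 0" for A s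
    proof -
      have "snd ` set (map (apsnd A) s) \<subseteq> Lp_space M p"
        using A s(1) by (auto simp: Lp_affine_isometry_def)
      then show ?thesis
        using comb_int[of s] comb_int[of "map (apsnd A) s"] u_affine_isometry[OF A s] s by simp
    qed
  qed
  moreover have "standard_measure_space N"
    unfolding standard_measure_space_def
  proof (intro conjI)
    show "sets N = sets (restrict_space borel (space N))"
      by (simp add: sets_restrict_space)
    \<comment> \<open>Markov's inequality: as \<open>e n\<close> is in L_q, these sets have finite
      measure, and together they cover \<open>B1\<close>.\<close>
    define S where "S n m = {x. 1 / real (Suc m) < cmod (e n x)}" for n m
    have [measurable]: "S n m \<in> sets borel" for n m unfolding S_def by measurable
    have S_fin: "emeasure N (S n m) \<noteq> \<infinity>" for n m
    proof -
      have "ennreal ((1 / Suc m) powr q) * emeasure N (S n m) = (\<integral>\<^sup>+ x. ennreal ((1 / Suc m) powr q) * indicator (S n m) x \<partial>N)"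
        by (subst nn_integral_cmult_indicator) auto
      also have "\<dots> \<le> (\<integral>\<^sup>+ x. ennreal (cmod (e n x) powr q) \<partial>N)"
        using q by (intro nn_integral_mono) (auto simp: S_def indicator_def intro!: ennreal_leI powr_mono2)
      also have "\<dots> < \<infinity>" using eL[of n] by (simp add: Lp_space_def)
      finally show ?thesis by (auto simp: ennreal_mult_less_top)
    qed
    have "emeasure N (- B1) = 0"
      unfolding N_def by (subst emeasure_density) (auto simp: nn_integral_0_iff_AE indicator_def)
    then have fin: "emeasure N a \<noteq> \<infinity>" if "a \<in> insert (- B1) (range (\<lambda>(n, m). S n m))" for a
      using that S_fin by auto
    have "x \<in> - B1 \<or> (\<exists>n m. x \<in> S n m)" for x
    proof (cases "x \<in> B1")
      case True
      then obtain n where "0 < cmod (e n x)" by (auto simp: B1_def)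
      then obtain m where "1 / real (Suc m) < cmod (e n x)" using nat_approx_posE by blast
      then show ?thesis by (auto simp: S_def)
    qed simp
    then have cover: "\<Union>(insert (- B1) (range (\<lambda>(n, m). S n m))) = space N" by auto
    show "sigma_finite_measure N"
    proof
      show "\<exists>A. countable A \<and> A \<subseteq> sets N \<and> \<Union>A = space N \<and> (\<forall>a\<in>A. emeasure N a \<noteq> \<infinity>)"
        using fin cover by (intro exI[of _ "insert (- B1) (range (\<lambda>(n, m). S n m))"]) auto
    qed
  qed simp
  ultimately show ?thesis by blast
qed

end

section \<open>Homogeneous measures\<close>

text \<open>In polar coordinates \<open>|z|^(-2-p) dz\<close> has the radial part
  \<open>t^(-1-p) dt\<close>, whence the exponent; the factor \<open>c\<close> is reserved for
  normalisation.\<close>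

definition radial :: "real \<Rightarrow> real \<Rightarrow> real measure" where
  "radial c p = density lborel (\<lambda>t. ennreal (c * (indicator {0<..} t * t powr (- 1 - p))))"

lemma sets_radial [simp, measurable_cong]: "sets (radial c p) = sets borel"
  by (simp add: radial_def)

lemma space_radial [simp]: "space (radial c p) = UNIV"
  by (simp add: radial_def)

lemma sigma_finite_radial: "sigma_finite_measure (radial c p)"
  unfolding radial_def by (subst sigma_finite_measure.sigma_finite_iff_density_finite[OF sigma_finite_lborel]) auto

lemma nn_integral_radial:
  assumes [measurable]: "\<phi> \<in> borel_measurable borel"
  shows "(\<integral>\<^sup>+ t. \<phi> t \<partial>radial c p) = (\<integral>\<^sup>+ t. ennreal (c * (indicator {0<..} t * t powr (- 1 - p))) * \<phi> t \<partial>lborel)"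
  unfolding radial_def by (subst nn_integral_density) auto

text \<open>The substitution contributes a factor \<open>s\<close> and the density
  \<open>s powr (- 1 - p)\<close>, together \<open>s powr (- p)\<close>.\<close>

lemma radial_scale:
  fixes \<phi> :: "real \<Rightarrow> ennreal"
  assumes [measurable]: "\<phi> \<in> borel_measurable borel" and s: "0 < s" and c: "0 \<le> c"
  shows "(\<integral>\<^sup>+ t. \<phi> (s * t) \<partial>radial c p) = ennreal (s powr p) * (\<integral>\<^sup>+ t. \<phi> t \<partial>radial c p)"
proof -
  let ?w = "\<lambda>t::real. c * (indicator {0<..} t * t powr (- 1 - p))"
  have w: "?w (s * t) = s powr (- 1 - p) * ?w t" for t
    using s by (auto simp: indicator_def powr_mult zero_less_mult_iff)
  have "(\<integral>\<^sup>+ t. \<phi> t \<partial>radial c p) = (\<integral>\<^sup>+ t. ennreal (?w t) * \<phi> t \<partial>lborel)"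
    by (rule nn_integral_radial) measurable
  also have "\<dots> = ennreal s * (\<integral>\<^sup>+ t. ennreal (?w (s * t)) * \<phi> (s * t) \<partial>lborel)"
    using nn_integral_real_affine[of "\<lambda>t. ennreal (?w t) * \<phi> t" s 0] s by simp
  also have "(\<integral>\<^sup>+ t. ennreal (?w (s * t)) * \<phi> (s * t) \<partial>lborel)
      = (\<integral>\<^sup>+ t. ennreal (s powr (- 1 - p)) * (ennreal (?w t) * \<phi> (s * t)) \<partial>lborel)"
    unfolding w using c by (intro nn_integral_cong) (simp add: ennreal_mult mult.assoc)
  also have "\<dots> = ennreal (s powr (- 1 - p)) * (\<integral>\<^sup>+ t. ennreal (?w t) * \<phi> (s * t) \<partial>lborel)"
    by (rule nn_integral_cmult) measurable
  also have "(\<integral>\<^sup>+ t. ennreal (?w t) * \<phi> (s * t) \<partial>lborel) = (\<integral>\<^sup>+ t. \<phi> (s * t) \<partial>radial c p)"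
    by (subst nn_integral_radial) auto
  finally have "ennreal (s powr p) * (\<integral>\<^sup>+ t. \<phi> t \<partial>radial c p)
      = ennreal (s powr p) * (ennreal s * (ennreal (s powr (- 1 - p)) * (\<integral>\<^sup>+ t. \<phi> (s * t) \<partial>radial c p)))"
    by simp
  also have "\<dots> = ennreal (s powr p * s * s powr (- 1 - p)) * (\<integral>\<^sup>+ t. \<phi> (s * t) \<partial>radial c p)"
    using s by (simp add: ennreal_mult mult.assoc)
  also have "s powr p * s * s powr (- 1 - p) = s powr (p + 1 + (- 1 - p))"
    using s by (simp only: powr_add powr_one)
  finally show ?thesis using s by simp
qed

section \<open>The normalising constant of the phases\<close>

lemma cmod_cis_minus_one_le: "cmod (cis t - 1) \<le> \<bar>t\<bar>" "cmod (cis t - 1) \<le> 2"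
proof -
  show "cmod (cis t - 1) \<le> \<bar>t\<bar>"
    using iexp_approx1[of t 0] by (simp add: cis_conv_exp)
  show "cmod (cis t - 1) \<le> 2"
    using norm_triangle_ineq4[of "cis t" 1] by simp
qed

definition phase_const :: "real \<Rightarrow> real \<Rightarrow> real \<Rightarrow> ennreal" where
  "phase_const q c p = (\<integral>\<^sup>+ t. ennreal (cmod (cis t - 1) powr q) \<partial>radial c p)"

lemma measurable_cis [measurable]: "cis \<in> borel_measurable borel"
  by (intro borel_measurable_continuous_onI continuous_intros)

lemma phase_const_scale:
  assumes "0 \<le> c"
  shows "phase_const q c p = ennreal c * phase_const q 1 p"
proof -
  have "phase_const q c p = (\<integral>\<^sup>+ t. ennreal c * (ennreal (1 * (indicator {0<..} t * t powr (- 1 - p))) * ennreal (cmod (cis t - 1) powr q)) \<partial>lborel)"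
    unfolding phase_const_def using assms
    by (subst nn_integral_radial) (auto intro!: nn_integral_cong simp: ennreal_mult mult.assoc)
  also have "\<dots> = ennreal c * phase_const q 1 p"
    unfolding phase_const_def by (subst nn_integral_radial) (auto intro!: nn_integral_cmult)
  finally show ?thesis .
qed

text \<open>Near 0 the integrand is at most \<open>t^(q-1-p)\<close>, which requires
  \<open>p < q\<close>; near infinity it is at most a multiple of \<open>t^(-1-p)\<close>, which
  requires \<open>0 < p\<close>.\<close>

lemma phase_const_finite:
  assumes "0 < p" "p < q" "0 \<le> c"
  shows "phase_const q c p < \<infinity>"
proof -
  have f1: "(\<integral>\<^sup>+ t. ennreal (t powr (q - 1 - p)) * indicator {0..1} t \<partial>lborel) < \<infinity>"
    using nn_integral_has_integral_lebesgue'[OF _ has_integral_powr_from_0[of "q - 1 - p" 1]] assms by simp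
  have f2: "(\<integral>\<^sup>+ t. ennreal (t powr (- 1 - p)) * indicator {1..} t \<partial>lborel) < \<infinity>"
    using nn_integral_has_integral_lebesgue'[OF _ has_integral_powr_to_inf[of "- 1 - p" 1]] assms by simp
  have "phase_const q 1 p = (\<integral>\<^sup>+ t. ennreal (1 * (indicator {0<..} t * t powr (- 1 - p))) * ennreal (cmod (cis t - 1) powr q) \<partial>lborel)"
    unfolding phase_const_def by (rule nn_integral_radial) measurable
  also have "\<dots> \<le> (\<integral>\<^sup>+ t. ennreal (t powr (q - 1 - p)) * indicator {0..1} t + ennreal (2 powr q) * (ennreal (t powr (- 1 - p)) * indicator {1..} t) \<partial>lborel)"
  proof (rule nn_integral_mono)
    fix t :: real
    consider "t \<le> 0" | "0 < t" "t \<le> 1" | "1 < t" by linarith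
    then show "ennreal (1 * (indicator {0<..} t * t powr (- 1 - p))) * ennreal (cmod (cis t - 1) powr q)
      \<le> ennreal (t powr (q - 1 - p)) * indicator {0..1} t + ennreal (2 powr q) * (ennreal (t powr (- 1 - p)) * indicator {1..} t)"
    proof cases
      case 1
      then show ?thesis by simp
    next
      case 2
      have "t powr (- 1 - p) * cmod (cis t - 1) powr q \<le> t powr (- 1 - p) * t powr q"
        using 2 assms cmod_cis_minus_one_le(1)[of t] by (intro mult_left_mono powr_mono2) auto
      also have "\<dots> = t powr (q - 1 - p)" by (simp flip: powr_add add: algebra_simps)
      finally have "ennreal (t powr (- 1 - p)) * ennreal (cmod (cis t - 1) powr q) \<le> ennreal (t powr (q - 1 - p))"
        by (simp flip: ennreal_mult add: ennreal_leI)
      then show ?thesis using 2 by (simp add: indicator_def add_increasing2)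
    next
      case 3
      have "t powr (- 1 - p) * cmod (cis t - 1) powr q \<le> t powr (- 1 - p) * 2 powr q"
        using 3 assms cmod_cis_minus_one_le(2)[of t] by (intro mult_left_mono powr_mono2) auto
      then have "ennreal (t powr (- 1 - p)) * ennreal (cmod (cis t - 1) powr q) \<le> ennreal (2 powr q) * ennreal (t powr (- 1 - p))"
        by (simp flip: ennreal_mult add: ennreal_leI mult.commute)
      then show ?thesis using 3 by simp
    qed
  qed
  also have "\<dots> = (\<integral>\<^sup>+ t. ennreal (t powr (q - 1 - p)) * indicator {0..1} t \<partial>lborel)
      + ennreal (2 powr q) * (\<integral>\<^sup>+ t. ennreal (t powr (- 1 - p)) * indicator {1..} t \<partial>lborel)"
    by (subst nn_integral_add) (auto simp: nn_integral_cmult)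
  also have "\<dots> < \<infinity>" using f1 f2 by (simp add: ennreal_mult_less_top)
  finally show ?thesis by (subst phase_const_scale[OF assms(3)]) (simp add: ennreal_mult_less_top)
qed

lemma phase_const_pos:
  assumes "0 < c"
  shows "0 < phase_const q c p"
proof (rule ccontr)
  assume "\<not> 0 < phase_const q c p"
  then have "phase_const q 1 p = 0" using assms phase_const_scale[of c q p] by (simp add: zero_less_iff_neq_zero)
  then have "AE t in lborel. ennreal (1 * (indicator {0<..} t * t powr (- 1 - p))) * ennreal (cmod (cis t - 1) powr q) = 0"
    unfolding phase_const_def by (subst (asm) nn_integral_radial) (auto simp: nn_integral_0_iff_AE)
  then have "AE t::real in lborel. t \<notin> {0<..<1}"
  proof eventually_elim
    case (elim t)
    show ?case
    proof
      assume t: "t \<in> {0<..<1}"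
      then have "cis t \<noteq> 1" using sin_gt_zero[of t] pi_gt3 by (auto simp: complex_eq_iff)
      then show False using elim t by auto
    qed
  qed
  then have "{0<..<1::real} \<in> null_sets lborel"
    by (subst AE_iff_null_sets) auto
  then have "emeasure lborel {0<..<1::real} = 0" by auto
  then show False by simp
qed

text \<open>Homogeneity applies to \<open>\<bar>s\<bar>\<close>; a negative sign only replaces the
  phase by its conjugate.\<close>

lemma phase_radial:
  assumes "0 \<le> c" "0 < p"
  shows "(\<integral>\<^sup>+ t. ennreal (cmod (cis (t * s) - 1) powr q) \<partial>radial c p) = ennreal (\<bar>s\<bar> powr p) * phase_const q c p"
proof -
  have abs: "cmod (cis (t * s) - 1) = cmod (cis (\<bar>s\<bar> * t) - 1)" for t
  proof (cases "0 \<le> s")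
    case False
    then have "cis (t * s) - 1 = cnj (cis (\<bar>s\<bar> * t) - 1)" by (simp add: cis_cnj mult.commute)
    then show ?thesis by (metis complex_mod_cnj)
  qed (simp add: mult.commute)
  show ?thesis
  proof (cases "s = 0")
    case False
    then show ?thesis
      unfolding abs phase_const_def
      using radial_scale[of "\<lambda>t. ennreal (cmod (cis t - 1) powr q)" "\<bar>s\<bar>" c p] assms by simp
  qed (use assms in simp)
qed

text \<open>The part of the shifted interval that overhangs \<open>a\<close> is moved back by one
  period.\<close>

lemma nn_integral_periodic_shift:
  fixes \<Psi> :: "real \<Rightarrow> ennreal"
  assumes [measurable]: "\<Psi> \<in> borel_measurable borel" and per: "\<And>x. \<Psi> (x + a) = \<Psi> x" and b: "0 \<le> b" "b \<le> a"
  shows "(\<integral>\<^sup>+ x. indicator {0..<a} x * \<Psi> (x + b) \<partial>lborel) = (\<integral>\<^sup>+ x. indicator {0..<a} x * \<Psi> x \<partial>lborel)"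
proof -
  have shift: "(\<integral>\<^sup>+ x. f x \<partial>lborel) = (\<integral>\<^sup>+ x. f (x + r) \<partial>lborel)" if "f \<in> borel_measurable borel" for f :: "real \<Rightarrow> ennreal" and r
    using nn_integral_real_affine[OF that, of 1 r] by (simp add: add.commute)
  have "(\<integral>\<^sup>+ x. indicator {0..<a} x * \<Psi> (x + b) \<partial>lborel) = (\<integral>\<^sup>+ x. indicator {b..<a+b} x * \<Psi> x \<partial>lborel)"
    by (subst shift[of "\<lambda>x. indicator {b..<a+b} x * \<Psi> x" b]) (auto intro!: nn_integral_cong simp: indicator_def)
  also have "\<dots> = (\<integral>\<^sup>+ x. indicator {b..<a} x * \<Psi> x + indicator {a..<a+b} x * \<Psi> x \<partial>lborel)"
    using b by (intro nn_integral_cong) (auto simp: indicator_def)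
  also have "\<dots> = (\<integral>\<^sup>+ x. indicator {b..<a} x * \<Psi> x \<partial>lborel) + (\<integral>\<^sup>+ x. indicator {a..<a+b} x * \<Psi> x \<partial>lborel)"
    by (rule nn_integral_add) auto
  also have "(\<integral>\<^sup>+ x. indicator {a..<a+b} x * \<Psi> x \<partial>lborel) = (\<integral>\<^sup>+ x. indicator {0..<b} x * \<Psi> x \<partial>lborel)"
    by (subst shift[of "\<lambda>x. indicator {a..<a+b} x * \<Psi> x" a]) (auto intro!: nn_integral_cong simp: indicator_def per)
  also have "(\<integral>\<^sup>+ x. indicator {b..<a} x * \<Psi> x \<partial>lborel) + (\<integral>\<^sup>+ x. indicator {0..<b} x * \<Psi> x \<partial>lborel)
     = (\<integral>\<^sup>+ x. indicator {b..<a} x * \<Psi> x + indicator {0..<b} x * \<Psi> x \<partial>lborel)"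
    by (rule nn_integral_add[symmetric]) auto
  also have "\<dots> = (\<integral>\<^sup>+ x. indicator {0..<a} x * \<Psi> x \<partial>lborel)"
    using b by (intro nn_integral_cong) (auto simp: indicator_def)
  finally show ?thesis .
qed

text \<open>The plane measure is built as a product of angle and radius. Multiplication by
  \<open>h\<close> then splits into scaling the radius and rotating the angle, and no change of
  variables in the plane is needed. The condition \<open>\<phi> 0 = 0\<close> handles
  \<open>h = 0\<close>, as \<open>W\<close> has infinite mass.\<close>

lemma complex_homogeneous_measure:
  fixes p q :: real
  assumes p: "0 < p" "p < q"
  obtains W :: "(real \<times> real) measure" and z :: "real \<times> real \<Rightarrow> complex" where
    "sigma_finite_measure W" "z \<in> borel_measurable W"
    "\<And>\<phi> h. \<phi> \<in> borel_measurable borel \<Longrightarrow> \<phi> 0 = 0 \<Longrightarrow>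
       (\<integral>\<^sup>+ \<omega>. \<phi> (z \<omega> * h) \<partial>W) = ennreal (cmod h powr p) * (\<integral>\<^sup>+ \<omega>. \<phi> (z \<omega>) \<partial>W)"
    "(\<integral>\<^sup>+ \<omega>. ennreal (cmod (cis (Re (z \<omega>)) - 1) powr q) \<partial>W) = 1"
proof -
  define C :: "real measure" where "C = density lborel (indicator {0..<2 * pi})"
  have [simp, measurable_cong]: "sets C = sets borel" by (simp add: C_def)
  have nn_C: "(\<integral>\<^sup>+ x. \<phi> x \<partial>C) = (\<integral>\<^sup>+ x. indicator {0..<2 * pi} x * \<phi> x \<partial>lborel)"
    if [measurable]: "\<phi> \<in> borel_measurable borel" for \<phi>
    unfolding C_def by (subst nn_integral_density) auto
  have sC: "sigma_finite_measure C"
    unfolding C_def by (subst sigma_finite_measure.sigma_finite_iff_density_finite[OF sigma_finite_lborel]) (auto simp: indicator_def)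
  define z where "z \<omega> = complex_of_real (snd \<omega>) * cis (fst \<omega>)" for \<omega> :: "real \<times> real"
  \<comment> \<open>The contribution of the angle to the normalising integral, since the real part
    of \<open>t * cis \<theta>\<close> is \<open>t * cos \<theta>\<close>.\<close>
  define K where "K = (\<integral>\<^sup>+ \<theta>. ennreal (\<bar>cos \<theta>\<bar> powr p) \<partial>C)"
  have K_fin: "K < \<infinity>"
  proof -
    have "K = (\<integral>\<^sup>+ \<theta>. indicator {0..<2 * pi} \<theta> * ennreal (\<bar>cos \<theta>\<bar> powr p) \<partial>lborel)"
      unfolding K_def by (rule nn_C) measurable
    also have "\<dots> \<le> (\<integral>\<^sup>+ \<theta>. indicator {0..<2 * pi} \<theta> \<partial>lborel)"
    proof (rule nn_integral_mono)
      fix \<theta> :: real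
      have "ennreal (\<bar>cos \<theta>\<bar> powr p) \<le> 1" using p by (simp add: powr_le1)
      then show "indicator {0..<2 * pi} \<theta> * ennreal (\<bar>cos \<theta>\<bar> powr p) \<le> indicator {0..<2 * pi} \<theta>"
        by (simp add: indicator_def)
    qed
    also have "\<dots> < \<infinity>" by simp
    finally show ?thesis .
  qed
  have K_pos: "K \<noteq> 0"
  proof
    assume "K = 0"
    then have "AE \<theta> in lborel. indicator {0..<2 * pi} \<theta> * ennreal (\<bar>cos \<theta>\<bar> powr p) = 0"
      unfolding K_def by (subst (asm) nn_C) (auto simp: nn_integral_0_iff_AE)
    then have "AE \<theta>::real in lborel. \<theta> \<notin> {0<..<1}"
    proof eventually_elim
      case (elim \<theta>)
      show ?case
      proof
        assume t: "\<theta> \<in> {0<..<1}"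
        then have "0 < cos \<theta>" using pi_gt3 by (intro cos_gt_zero) auto
        then show False using elim t pi_gt3 by (auto simp: indicator_def split: if_splits)
      qed
    qed
    then have "{0<..<1::real} \<in> null_sets lborel"
      by (subst AE_iff_null_sets) auto
    then have "emeasure lborel {0<..<1::real} = 0" by auto
    then show False by simp
  qed
  \<comment> \<open>Without normalisation the integral is the product of the angular and the radial
    constant; dividing the radial density by it gives the value 1.\<close>
  define k where "k = enn2real (K * phase_const q 1 p)"
  have k: "ennreal k = K * phase_const q 1 p" "0 < k"
  proof -
    have "K * phase_const q 1 p < \<infinity>" using K_fin phase_const_finite[OF p, of 1] by (simp add: ennreal_mult_less_top)
    then show *: "ennreal k = K * phase_const q 1 p" by (simp add: k_def)
    have "K * phase_const q 1 p \<noteq> 0" using K_pos phase_const_pos[of 1 q p] by simp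
    then have "k \<noteq> 0" using * by (metis ennreal_0)
    then show "0 < k" by (simp add: k_def less_le)
  qed
  define R where "R = radial (1 / k) p"
  have [simp, measurable_cong]: "sets R = sets borel" by (simp add: R_def)
  interpret R: sigma_finite_measure R unfolding R_def by (rule sigma_finite_radial)
  interpret C: sigma_finite_measure C by (rule sC)
  interpret CR: pair_sigma_finite C R ..
  define W where "W = C \<Otimes>\<^sub>M R"
  have zm: "z \<in> borel_measurable W" unfolding z_def W_def by measurable
  have nn_W: "(\<integral>\<^sup>+ \<omega>. \<phi> (z \<omega> * h) \<partial>W) = (\<integral>\<^sup>+ \<theta>. (\<integral>\<^sup>+ t. \<phi> (complex_of_real t * cis \<theta> * h) \<partial>R) \<partial>C)"
    if [measurable]: "\<phi> \<in> borel_measurable borel" for \<phi> :: "complex \<Rightarrow> ennreal" and h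
  proof -
    have "(\<lambda>\<omega>. \<phi> (z \<omega> * h)) \<in> borel_measurable (C \<Otimes>\<^sub>M R)"
      unfolding z_def by measurable
    from R.nn_integral_fst[OF this] show ?thesis by (simp add: W_def z_def)
  qed
  show ?thesis
  proof
    show "sigma_finite_measure W" unfolding W_def by (rule CR.sigma_finite_measure_axioms)
    show "z \<in> borel_measurable W" by fact
    show "(\<integral>\<^sup>+ \<omega>. \<phi> (z \<omega> * h) \<partial>W) = ennreal (cmod h powr p) * (\<integral>\<^sup>+ \<omega>. \<phi> (z \<omega>) \<partial>W)"
      if \<phi>[measurable]: "\<phi> \<in> borel_measurable borel" and \<phi>0: "\<phi> 0 = 0" for \<phi> h
    proof (cases "h = 0")
      case False
      define \<Psi> where "\<Psi> \<theta> = (\<integral>\<^sup>+ t. \<phi> (complex_of_real t * cis \<theta>) \<partial>R)" for \<theta>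
      have [measurable]: "\<Psi> \<in> borel_measurable borel"
        unfolding \<Psi>_def by measurable
      have "complex_of_real t * cis \<theta> * h = complex_of_real (cmod h * t) * cis (\<theta> + Arg2pi h)" for t \<theta>
      proof -
        have "h = complex_of_real (cmod h) * cis (Arg2pi h)" using Arg2pi_eq[of h] by (simp add: cis_conv_exp)
        then have "complex_of_real t * cis \<theta> * h = complex_of_real t * cis \<theta> * (complex_of_real (cmod h) * cis (Arg2pi h))"
          by simp
        also have "\<dots> = complex_of_real (cmod h * t) * (cis \<theta> * cis (Arg2pi h))" by simp
        finally show ?thesis by (simp only: cis_mult)
      qed
      then have "(\<integral>\<^sup>+ \<omega>. \<phi> (z \<omega> * h) \<partial>W) = (\<integral>\<^sup>+ \<theta>. (\<integral>\<^sup>+ t. \<phi> (complex_of_real (cmod h * t) * cis (\<theta> + Arg2pi h)) \<partial>R) \<partial>C)"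
        by (simp only: nn_W[OF \<phi>])
      also have "\<dots> = (\<integral>\<^sup>+ \<theta>. ennreal (cmod h powr p) * \<Psi> (\<theta> + Arg2pi h) \<partial>C)"
        unfolding R_def \<Psi>_def using False k(2)
        by (intro nn_integral_cong radial_scale[of "\<lambda>t. \<phi> (complex_of_real t * cis (_ + Arg2pi h))"]) auto
      also have "\<dots> = ennreal (cmod h powr p) * (\<integral>\<^sup>+ \<theta>. \<Psi> (\<theta> + Arg2pi h) \<partial>C)"
        by (rule nn_integral_cmult) measurable
      also have "(\<integral>\<^sup>+ \<theta>. \<Psi> (\<theta> + Arg2pi h) \<partial>C) = (\<integral>\<^sup>+ x. indicator {0..<2 * pi} x * \<Psi> (x + Arg2pi h) \<partial>lborel)"
        by (rule nn_C) measurable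
      also have "\<dots> = (\<integral>\<^sup>+ x. indicator {0..<2 * pi} x * \<Psi> x \<partial>lborel)"
      proof (rule nn_integral_periodic_shift)
        show "\<Psi> (x + 2 * pi) = \<Psi> x" for x
          by (simp add: \<Psi>_def cis_mult[symmetric])
      qed (use Arg2pi[of h] in auto)
      also have "\<dots> = (\<integral>\<^sup>+ \<theta>. \<Psi> \<theta> \<partial>C)" by (rule nn_C[symmetric]) measurable
      also have "\<dots> = (\<integral>\<^sup>+ \<omega>. \<phi> (z \<omega>) \<partial>W)" using nn_W[OF \<phi>, of 1] by (simp add: \<Psi>_def)
      finally show ?thesis .
    qed (use \<phi>0 p in simp)
    have "(\<integral>\<^sup>+ \<omega>. ennreal (cmod (cis (Re (z \<omega>)) - 1) powr q) \<partial>W)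
       = (\<integral>\<^sup>+ \<theta>. (\<integral>\<^sup>+ t. ennreal (cmod (cis (t * cos \<theta>) - 1) powr q) \<partial>R) \<partial>C)"
      using nn_W[of "\<lambda>w. ennreal (cmod (cis (Re w) - 1) powr q)" 1] by simp
    also have "\<dots> = (\<integral>\<^sup>+ \<theta>. ennreal (\<bar>cos \<theta>\<bar> powr p) * phase_const q (1 / k) p \<partial>C)"
      unfolding R_def using k(2) p by (simp add: phase_radial)
    also have "\<dots> = K * phase_const q (1 / k) p"
      unfolding K_def by (rule nn_integral_multc) measurable
    also have "\<dots> = ennreal (1 / k) * ennreal k"
      unfolding k(1) using k(2) by (subst phase_const_scale) (auto simp: mult_ac)
    also have "\<dots> = 1" using k(2) by (simp flip: ennreal_mult)
    finally show "(\<integral>\<^sup>+ \<omega>. ennreal (cmod (cis (Re (z \<omega>)) - 1) powr q) \<partial>W) = 1" .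
  qed
qed

section \<open>Linear isometries preserve disjointness\<close>

lemma midpoint_powr_le:
  fixes x y :: real
  assumes "0 \<le> x" "0 \<le> y" "1 \<le> k"
  shows "2 * ((x + y) / 2) powr k \<le> x powr k + y powr k"
proof -
  have half: "2 * (t / 2) powr k \<le> t powr k" if "0 \<le> t" for t
  proof -
    have "2 powr 1 \<le> (2::real) powr k" using assms(3) by (intro powr_mono) auto
    then have "2 * t powr k \<le> 2 powr k * t powr k" by (intro mult_right_mono) auto
    then show ?thesis using that by (simp add: powr_divide field_simps)
  qed
  consider "x = 0" | "y = 0" | "0 < x" "0 < y" using assms by linarith
  then show ?thesis
  proof cases
    case 3
    then have "((1/2) *\<^sub>R x + (1/2) *\<^sub>R y) powr k \<le> (1/2) * x powr k + (1/2) * y powr k"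
      using convex_onD[OF powr_convex[OF assms(3)], of "1/2" x y] by simp
    then show ?thesis by (simp add: add_divide_distrib)
  qed (use half assms in auto)
qed

text \<open>Concavity for \<open>k \<le> 1\<close>, reduced to the convex case with exponent
  \<open>1 / k\<close> at the points \<open>x powr k\<close> and \<open>y powr k\<close>.\<close>

lemma midpoint_powr_ge:
  fixes x y :: real
  assumes "0 \<le> x" "0 \<le> y" "0 < k" "k \<le> 1"
  shows "x powr k + y powr k \<le> 2 * ((x + y) / 2) powr k"
proof -
  have "2 * ((x powr k + y powr k) / 2) powr (1 / k) \<le> (x powr k) powr (1 / k) + (y powr k) powr (1 / k)"
    using assms by (intro midpoint_powr_le) auto
  then have "((x powr k + y powr k) / 2) powr (1 / k) \<le> (x + y) / 2"
    using assms by (simp add: powr_powr)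
  then have "(((x powr k + y powr k) / 2) powr (1 / k)) powr k \<le> ((x + y) / 2) powr k"
    using assms by (intro powr_mono2) auto
  then show ?thesis using assms by (simp add: powr_powr)
qed

text \<open>Write \<open>z^k\<close> as \<open>z * z^(k-1)\<close> and, in the second factor,
  compare \<open>x\<close> and \<open>y\<close> with \<open>x + y\<close>.\<close>

lemma powr_add_strict:
  fixes x y :: real
  assumes "0 < x" "0 < y"
  shows "1 < k \<Longrightarrow> x powr k + y powr k < (x + y) powr k"
    and "k < 1 \<Longrightarrow> (x + y) powr k < x powr k + y powr k"
proof -
  have split: "z powr k = z * z powr (k - 1)" if "0 < z" for z :: real
    using that by (simp add: powr_diff)
  have sum: "(x + y) powr k = x * (x + y) powr (k - 1) + y * (x + y) powr (k - 1)"
    using assms by (subst split) (auto simp: algebra_simps)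
  show "x powr k + y powr k < (x + y) powr k" if "1 < k"
    unfolding sum split[OF assms(1)] split[OF assms(2)] using assms that
    by (intro add_strict_mono mult_strict_left_mono powr_less_mono2) auto
  show "(x + y) powr k < x powr k + y powr k" if "k < 1"
    unfolding sum split[OF assms(1)] split[OF assms(2)] using assms that
    by (intro add_strict_mono mult_strict_left_mono powr_less_mono2_neg) auto
qed

text \<open>With \<open>|z|^p = (|z|^2)^(p/2)\<close>, the mean of \<open>|a + b|^2\<close> and
  \<open>|a - b|^2\<close> is \<open>|a|^2 + |b|^2\<close>. Convexity or concavity of the power
  \<open>p / 2\<close> handles the mean; strict super- or subadditivity at two positive numbers
  supplies the strictness. At \<open>p = 2\<close> everything is an equality.\<close>

lemma parallelogram_powr_strict:
  fixes a b :: complex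
  assumes "a \<noteq> 0" "b \<noteq> 0"
  shows "2 < p \<Longrightarrow> 2 * cmod a powr p + 2 * cmod b powr p < cmod (a + b) powr p + cmod (a - b) powr p"
    and "0 < p \<Longrightarrow> p < 2 \<Longrightarrow> cmod (a + b) powr p + cmod (a - b) powr p < 2 * cmod a powr p + 2 * cmod b powr p"
proof -
  have sq: "cmod z powr p = ((cmod z)\<^sup>2) powr (p / 2)" for z
    by (simp add: powr_powr flip: powr_numeral)
  have par: "((cmod (a + b))\<^sup>2 + (cmod (a - b))\<^sup>2) / 2 = (cmod a)\<^sup>2 + (cmod b)\<^sup>2"
    unfolding cmod_power2 by (simp add: power2_eq_square algebra_simps)
  have pos: "0 < (cmod a)\<^sup>2" "0 < (cmod b)\<^sup>2" using assms by auto
  show "2 * cmod a powr p + 2 * cmod b powr p < cmod (a + b) powr p + cmod (a - b) powr p" if "2 < p"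
    using midpoint_powr_le[of "(cmod (a + b))\<^sup>2" "(cmod (a - b))\<^sup>2" "p / 2"] powr_add_strict(1)[OF pos, of "p / 2"] that
    unfolding sq par by simp
  show "cmod (a + b) powr p + cmod (a - b) powr p < 2 * cmod a powr p + 2 * cmod b powr p" if "0 < p" "p < 2"
    using midpoint_powr_ge[of "(cmod (a + b))\<^sup>2" "(cmod (a - b))\<^sup>2" "p / 2"] powr_add_strict(2)[OF pos, of "p / 2"] that
    unfolding sq par by simp
qed

section \<open>Basic properties of linear isometries\<close>

lemma Lp_integrable:
  assumes f: "f \<in> Lp_space M p"
  shows "integrable M (\<lambda>x. cmod (f x) powr p)" "(\<integral>x. cmod (f x) powr p \<partial>M) = Lp_int M p f"
proof -
  have [measurable]: "f \<in> borel_measurable M" using f by auto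
  show "integrable M (\<lambda>x. cmod (f x) powr p)"
    using f by (intro integrableI_nonneg) (auto simp: Lp_space_def)
  show "(\<integral>x. cmod (f x) powr p \<partial>M) = Lp_int M p f"
    by (subst integral_eq_nn_integral) (auto simp: Lp_int_def)
qed

lemma linear_isometry_ident: "Lp_linear_isometry M p (\<lambda>f. f)"
  by (auto simp: Lp_linear_isometry_def Lp_eq_def)

lemma linear_isometry_Lp:
  assumes "Lp_linear_isometry M p P" "f \<in> Lp_space M p"
  shows "P f \<in> Lp_space M p"
  using assms by (simp add: Lp_linear_isometry_def)

lemma linear_isometry_cong:
  assumes "Lp_linear_isometry M p P" "f \<in> Lp_space M p" "g \<in> Lp_space M p" "AE x in M. f x = g x"
  shows "AE x in M. P f x = P g x"
  using assms by (simp add: Lp_linear_isometry_def Lp_eq_def)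

lemma linear_isometry_add:
  assumes "Lp_linear_isometry M p P" "f \<in> Lp_space M p" "g \<in> Lp_space M p"
  shows "AE x in M. P (\<lambda>x. f x + g x) x = P f x + P g x"
  using assms by (simp add: Lp_linear_isometry_def Lp_eq_def)

lemma linear_isometry_scale:
  assumes "Lp_linear_isometry M p P" "f \<in> Lp_space M p"
  shows "AE x in M. P (\<lambda>x. a * f x) x = a * P f x"
  using assms by (simp add: Lp_linear_isometry_def Lp_eq_def)

lemma linear_isometry_diff:
  assumes P: "Lp_linear_isometry M p P" and f: "f \<in> Lp_space M p" and g: "g \<in> Lp_space M p"
  shows "AE x in M. P (\<lambda>x. f x - g x) x = P f x - P g x"
  using linear_isometry_add[OF P f Lp_space_scale(1)[OF g], of "-1"] linear_isometry_scale[OF P g, of "-1"]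
  by eventually_elim simp

lemma linear_isometry_int:
  assumes "0 < p" and P: "Lp_linear_isometry M p P" and f: "f \<in> Lp_space M p"
  shows "Lp_int M p (P f) = Lp_int M p f"
proof -
  have "Lp_dist M p (P f) (P (\<lambda>x. 0)) = Lp_dist M p f (\<lambda>x. 0)"
    using P f by (simp add: Lp_linear_isometry_def)
  then have "Lp_int M p (\<lambda>x. P f x - P (\<lambda>x. 0) x) = Lp_int M p f"
    unfolding Lp_dist_eq_iff[OF assms(1)] by simp
  moreover have "AE x in M. P (\<lambda>x. 0) x = 0"
    using linear_isometry_scale[OF P f, of 0] by simp
  then have "Lp_int M p (\<lambda>x. P f x - P (\<lambda>x. 0) x) = Lp_int M p (P f)"
    by (intro Lp_int_cong_AE) auto
  ultimately show ?thesis by simp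
qed

lemma linear_isometry_sum:
  assumes p: "0 < p" and P: "Lp_linear_isometry M p P" and "finite I" and "\<And>i. i \<in> I \<Longrightarrow> f i \<in> Lp_space M p"
  shows "AE x in M. P (\<lambda>x. \<Sum>i\<in>I. c i * f i x) x = (\<Sum>i\<in>I. c i * P (f i) x)"
  using assms(3,4)
proof (induction I rule: finite_induct)
  case empty
  have "AE x in M. P (\<lambda>x. 0 * 0) x = 0 * P (\<lambda>x. 0) x"
    by (rule linear_isometry_scale[OF P Lp_zero])
  then show ?case by simp
next
  case (insert i I)
  let ?g = "\<lambda>x. \<Sum>i\<in>I. c i * f i x"
  have g: "?g \<in> Lp_space M p"
    using insert by (intro Lp_space_sum p Lp_space_scale(1)) auto
  have f: "f i \<in> Lp_space M p" using insert by auto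
  have "AE x in M. P ?g x = (\<Sum>i\<in>I. c i * P (f i) x)" using insert by auto
  then show ?case
    using linear_isometry_add[OF P Lp_space_scale(1)[OF f] g, of "c i"] linear_isometry_scale[OF P f, of "c i"]
    by eventually_elim (simp add: insert(1,2))
qed

text \<open>The defect in the parallelogram law for p-th powers has a constant sign and vanishes only where one of
  the two functions does, so having zero integral of this defect characterises disjointness of supports.\<close>

lemma linear_isometry_disjoint:
  assumes p: "0 < p" "p \<noteq> 2" and P: "Lp_linear_isometry M p P"
    and f: "f \<in> Lp_space M p" and g: "g \<in> Lp_space M p" and disj: "AE x in M. f x * g x = 0"
  shows "AE x in M. P f x * P g x = 0"
proof -
  have fg: "(\<lambda>x. f x + g x) \<in> Lp_space M p" "(\<lambda>x. f x - g x) \<in> Lp_space M p"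
    by (intro Lp_space_add Lp_space_diff p f g)+
  have PL: "P f \<in> Lp_space M p" "P g \<in> Lp_space M p"
    using linear_isometry_Lp[OF P] f g by auto
  have Pfg: "(\<lambda>x. P f x + P g x) \<in> Lp_space M p" "(\<lambda>x. P f x - P g x) \<in> Lp_space M p"
    by (intro Lp_space_add Lp_space_diff p PL)+
  have "Lp_int M p (\<lambda>x. P f x + P g x) = Lp_int M p (\<lambda>x. f x + g x)"
    using linear_isometry_int[OF p(1) P fg(1)] Lp_int_cong_AE[OF linear_isometry_add[OF P f g]] by metis
  moreover have "Lp_int M p (\<lambda>x. P f x - P g x) = Lp_int M p (\<lambda>x. f x - g x)"
    using linear_isometry_int[OF p(1) P fg(2)] Lp_int_cong_AE[OF linear_isometry_diff[OF P f g]] by metis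
  moreover have "Lp_int M p (\<lambda>x. f x + g x) = Lp_int M p f + Lp_int M p g"
  proof -
    have "Lp_int M p (\<lambda>x. f x + g x) = (\<integral>x. cmod (f x) powr p + cmod (g x) powr p \<partial>M)"
      unfolding Lp_integrable(2)[OF fg(1), symmetric]
      using disj Lp_space_measurable[OF f] Lp_space_measurable[OF g] by (intro integral_cong_AE) (auto elim!: eventually_mono)
    also have "\<dots> = Lp_int M p f + Lp_int M p g"
      using Lp_integrable[OF f] Lp_integrable[OF g] by simp
    finally show ?thesis .
  qed
  moreover have "Lp_int M p (\<lambda>x. f x - g x) = Lp_int M p f + Lp_int M p g"
  proof -
    have "Lp_int M p (\<lambda>x. f x - g x) = (\<integral>x. cmod (f x) powr p + cmod (g x) powr p \<partial>M)"
      unfolding Lp_integrable(2)[OF fg(2), symmetric]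
      using disj Lp_space_measurable[OF f] Lp_space_measurable[OF g] by (intro integral_cong_AE) (auto elim!: eventually_mono)
    also have "\<dots> = Lp_int M p f + Lp_int M p g"
      using Lp_integrable[OF f] Lp_integrable[OF g] by simp
    finally show ?thesis .
  qed
  ultimately have eq: "Lp_int M p (\<lambda>x. P f x + P g x) + Lp_int M p (\<lambda>x. P f x - P g x)
      - (2 * Lp_int M p (P f) + 2 * Lp_int M p (P g)) = 0"
    using linear_isometry_int[OF p(1) P f] linear_isometry_int[OF p(1) P g] by simp
  define \<sigma> :: real where "\<sigma> = (if 2 < p then 1 else -1)"
  define \<delta> where "\<delta> x = \<sigma> * (cmod (P f x + P g x) powr p + cmod (P f x - P g x) powr p
      - (2 * cmod (P f x) powr p + 2 * cmod (P g x) powr p))" for x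
  have \<delta>0: "0 < \<delta> x" if "P f x \<noteq> 0" "P g x \<noteq> 0" for x
    using parallelogram_powr_strict[OF that, of p] p by (auto simp: \<delta>_def \<sigma>_def)
  have \<delta>1: "\<delta> x = 0" if "P f x = 0 \<or> P g x = 0" for x
    using that by (auto simp: \<delta>_def)
  have int: "integrable M \<delta>"
    unfolding \<delta>_def using Lp_integrable(1)[OF Pfg(1)] Lp_integrable(1)[OF Pfg(2)] Lp_integrable(1)[OF PL(1)] Lp_integrable(1)[OF PL(2)]
    by (intro integrable_mult_right integrable_diff integrable_add) auto
  have "(\<integral>x. \<delta> x \<partial>M) = 0"
    unfolding \<delta>_def using Lp_integrable[OF Pfg(1)] Lp_integrable[OF Pfg(2)] Lp_integrable[OF PL(1)] Lp_integrable[OF PL(2)] eq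
    by simp
  moreover have "AE x in M. 0 \<le> \<delta> x"
    using \<delta>0 \<delta>1 by (intro AE_I2) (metis less_imp_le order_refl)
  ultimately have "AE x in M. \<delta> x = 0"
    using integral_nonneg_eq_0_iff_AE[OF int] by simp
  then show ?thesis
    by eventually_elim (metis \<delta>0 less_irrefl mult_eq_0_iff)
qed

section \<open>The case of exponents different from 2\<close>

lemma comb_nth: "comb E s y = (\<Sum>j<length s. fst (s ! j) * E (snd (s ! j)) y)"
  by (simp add: comb_def sum_list_sum_nth case_prod_beta atLeast0LessThan)

lemma weight_nth: "weight s = (\<Sum>j<length s. fst (s ! j))"
  by (simp add: weight_def sum_list_sum_nth case_prod_beta atLeast0LessThan)

locale Lp_homogeneous =
  M: sigma_finite_measure M + W: sigma_finite_measure W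
  for M :: "'a measure" and W :: "'w measure" +
  fixes p q :: real and z :: "'w \<Rightarrow> complex"
  assumes p_pos: "0 < p" and p_neq_2: "p \<noteq> 2" and q_pos: "0 < q"
    and z[measurable]: "z \<in> borel_measurable W"
    and homogeneous: "\<phi> \<in> borel_measurable borel \<Longrightarrow> \<phi> 0 = 0 \<Longrightarrow>
       (\<integral>\<^sup>+ \<omega>. \<phi> (z \<omega> * h) \<partial>W) = ennreal (cmod h powr p) * (\<integral>\<^sup>+ \<omega>. \<phi> (z \<omega>) \<partial>W)"
    and normalised: "(\<integral>\<^sup>+ \<omega>. ennreal (cmod (cis (Re (z \<omega>)) - 1) powr q) \<partial>W) = 1"
begin

definition u :: "('a \<Rightarrow> complex) \<Rightarrow> 'a \<times> 'w \<Rightarrow> complex" where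
  "u f y = cis (Re (z (snd y) * f (fst y)))"

lemma u_borel [measurable]:
  assumes [measurable]: "f \<in> borel_measurable M"
  shows "u f \<in> borel_measurable (M \<Otimes>\<^sub>M W)"
  unfolding u_def by measurable

text \<open>Taking out the unimodular factor \<open>u g\<close> leaves the modulus of
  \<open>exp(i Re (z (f - g))) - 1\<close>, to which homogeneity with \<open>h = f x - g x\<close>
  applies at each point \<open>x\<close>.\<close>

sublocale Lp_phase_map M p "M \<Otimes>\<^sub>M W" q u
proof
  show "0 < p" "0 < q" by (fact p_pos, fact q_pos)
  show "u f \<in> borel_measurable (M \<Otimes>\<^sub>M W)" if "f \<in> Lp_space M p" for f
    using that by auto
  show "cmod (u f y) = 1" for f y by (simp add: u_def)
  fix f g assume f: "f \<in> Lp_space M p" and g: "g \<in> Lp_space M p"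
  note [measurable] = Lp_space_measurable[OF f] Lp_space_measurable[OF g]
  let ?\<phi> = "\<lambda>w. ennreal (cmod (cis (Re w) - 1) powr q)"
  have *: "cmod (u f (x, \<omega>) - u g (x, \<omega>)) = cmod (cis (Re (z \<omega> * (f x - g x))) - 1)" for x \<omega>
  proof -
    have "u f (x, \<omega>) - u g (x, \<omega>) = u g (x, \<omega>) * (cis (Re (z \<omega> * (f x - g x))) - 1)"
      by (simp add: u_def right_diff_distrib cis_mult)
    then show ?thesis by (simp add: norm_mult u_def)
  qed
  have "(\<integral>\<^sup>+ y. ennreal (cmod (u f y - u g y) powr q) \<partial>(M \<Otimes>\<^sub>M W))
     = (\<integral>\<^sup>+ x. (\<integral>\<^sup>+ \<omega>. ennreal (cmod (u f (x, \<omega>) - u g (x, \<omega>)) powr q) \<partial>W) \<partial>M)"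
    by (rule W.nn_integral_fst[symmetric]) measurable
  also have "\<dots> = (\<integral>\<^sup>+ x. ennreal (cmod (f x - g x) powr p) \<partial>M)"
  proof (intro nn_integral_cong)
    fix x
    show "(\<integral>\<^sup>+ \<omega>. ennreal (cmod (u f (x, \<omega>) - u g (x, \<omega>)) powr q) \<partial>W) = ennreal (cmod (f x - g x) powr p)"
      unfolding * using homogeneous[of ?\<phi> "f x - g x"] normalised by simp
  qed
  also have "\<dots> = ennreal (Lp_int M p (\<lambda>x. f x - g x))"
    by (rule Lp_int_eq_nn_integral[symmetric]) (intro Lp_space_diff p_pos f g)
  finally show "(\<integral>\<^sup>+ y. ennreal (cmod (u f y - u g y) powr q) \<partial>(M \<Otimes>\<^sub>M W)) = ennreal (Lp_int M p (\<lambda>x. f x - g x))" .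
qed

text \<open>For simple functions only finitely many lists occur, and their level sets form a common
  partition on which all functions of \<open>s\<close> are constant.\<close>

definition values_at :: "(complex \<times> ('a \<Rightarrow> complex)) list \<Rightarrow> 'a \<Rightarrow> complex list" where
  "values_at s x = map (\<lambda>(a, f). f x) s"

definition level :: "(complex \<times> ('a \<Rightarrow> complex)) list \<Rightarrow> complex list \<Rightarrow> 'a \<Rightarrow> complex" where
  "level s v x = indicator {x \<in> space M. values_at s x = v} x"

text \<open>The level set of the zero list may have infinite measure, and its indicator may fail to
  lie in L_p. It can be left out because a combination of weight 0 vanishes where all its functions
  do.\<close>

definition "nonzero_values s = {v \<in> values_at s ` space M. \<exists>j<length s. v ! j \<noteq> 0}"

text \<open>The q-th power of the combination at a point with value list \<open>v\<close>, as a
  function of the plane variable.\<close>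

definition profile :: "(complex \<times> ('a \<Rightarrow> complex)) list \<Rightarrow> complex list \<Rightarrow> complex \<Rightarrow> ennreal" where
  "profile s v \<zeta> = ennreal (cmod (\<Sum>j<length s. fst (s ! j) * cis (Re (\<zeta> * v ! j))) powr q)"

text \<open>The right-hand side does not depend on the isometry.\<close>

lemma nn_integral_comb_simple:
  assumes P: "Lp_linear_isometry M p P"
    and s: "snd ` set s \<subseteq> {f. simple_function M f} \<inter> Lp_space M p" "weight s = 0"
  shows "(\<integral>\<^sup>+ y. ennreal (cmod (comb u (map (apsnd P) s) y) powr q) \<partial>(M \<Otimes>\<^sub>M W))
    = (\<Sum>v\<in>nonzero_values s. ennreal (Lp_int M p (level s v)) * (\<integral>\<^sup>+ \<omega>. profile s v (z \<omega>) \<partial>W))"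
proof -
  define n where "n = length s"
  define a where "a j = fst (s ! j)" for j
  define f where "f j = snd (s ! j)" for j
  define V where "V = nonzero_values s"
  have f: "f j \<in> Lp_space M p" "simple_function M (f j)" if "j < n" for j
    using s(1) nth_mem[of j s] that by (auto simp: f_def n_def image_subset_iff)
  have val: "values_at s x ! j = f j x" "length (values_at s x) = n" if "j < n" for x j
    using that by (auto simp: values_at_def f_def n_def case_prod_beta)
  have finV: "finite V"
  proof -
    have "values_at s ` space M \<subseteq> {xs. set xs \<subseteq> (\<Union>j<n. f j ` space M) \<and> length xs = n}"
      by (auto simp: values_at_def in_set_conv_nth f_def n_def case_prod_beta) (metis imageI lessThan_iff nth_mem in_set_conv_nth UN_I snd_conv)
    moreover have "finite {xs. set xs \<subseteq> (\<Union>j<n. f j ` space M) \<and> length xs = n}"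
      using f(2) by (intro finite_lists_length_eq) (auto simp: simple_function_def)
    ultimately show ?thesis unfolding V_def nonzero_values_def by (auto intro: finite_subset)
  qed
  have level_sets: "{x \<in> space M. values_at s x = v} \<in> sets M" if "length v = n" for v
  proof -
    have "{x \<in> space M. values_at s x = v} = {x \<in> space M. \<forall>j\<in>{..<n}. f j x = v ! j}"
      using that val by (auto simp: list_eq_iff_nth_eq values_at_def n_def f_def case_prod_beta)
    also have "\<dots> \<in> sets M"
    proof (rule sets.sets_Collect_finite_All)
      show "{x \<in> space M. f j x = v ! j} \<in> sets M" if "j \<in> {..<n}" for j
        using simple_functionD(2)[OF f(2)[of j], of "{v ! j}"] that by (simp add: vimage_def Int_def conj_commute)
    qed simp
    finally show ?thesis .
  qed
  have level_Lp: "level s v \<in> Lp_space M p" if "v \<in> V" for v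
  proof -
    obtain j where j: "j < n" "v ! j \<noteq> 0" and v: "v \<in> values_at s ` space M"
      using \<open>v \<in> V\<close> by (auto simp: V_def nonzero_values_def n_def)
    have len: "length v = n" using v by (auto simp: values_at_def n_def)
    have "level s v \<in> borel_measurable M"
      unfolding level_def using level_sets[OF len] by measurable
    then show ?thesis
    \<comment> \<open>On the level set \<open>f j\<close> has the nonzero value
      \<open>v ! j\<close>, so the indicator is dominated by the quotient of \<open>f j\<close> by
      that number.\<close>
    proof (rule Lp_space_bound(1)[OF Lp_space_scale(1)[OF f(1)[OF j(1)], of "1 / v ! j"]])
      show "AE x in M. cmod (level s v x) powr p \<le> cmod (1 / v ! j * f j x) powr p"
        using j val[OF j(1)] p(1) by (intro AE_I2) (auto simp: level_def indicator_def)
    qed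
  qed
  define h where "h v = P (level s v)" for v
  have h: "h v \<in> Lp_space M p" "Lp_int M p (h v) = Lp_int M p (level s v)" if "v \<in> V" for v
    using linear_isometry_Lp[OF P level_Lp[OF that]] linear_isometry_int[OF p(1) P level_Lp[OF that]]
    by (auto simp: h_def)
  have Pf: "AE x in M. P (f j) x = (\<Sum>v\<in>V. v ! j * h v x)" if j: "j < n" for j
  proof -
    have "f j x = (\<Sum>v\<in>V. v ! j * level s v x)" if x: "x \<in> space M" for x
    proof (cases "values_at s x \<in> V")
      case True
      have "(\<Sum>v\<in>V. v ! j * level s v x) = (\<Sum>v\<in>V. if v = values_at s x then f j x else 0)"
        using x val[OF j] by (intro sum.cong) (auto simp: level_def indicator_def)
      then show ?thesis using True finV by simp
    next
      case False
      then have "f j x = 0" using x val[OF j] j by (auto simp: V_def nonzero_values_def n_def)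
      moreover have "(\<Sum>v\<in>V. v ! j * level s v x) = 0"
        using False by (intro sum.neutral) (auto simp: level_def indicator_def)
      ultimately show ?thesis by simp
    qed
    then have "AE x in M. f j x = (\<Sum>v\<in>V. v ! j * level s v x)" by (intro AE_I2)
    then have "AE x in M. P (f j) x = P (\<lambda>x. \<Sum>v\<in>V. v ! j * level s v x) x"
      by (intro linear_isometry_cong[OF P] f(1) j Lp_space_sum p Lp_space_scale(1) level_Lp)
    moreover have "AE x in M. P (\<lambda>x. \<Sum>v\<in>V. v ! j * level s v x) x = (\<Sum>v\<in>V. v ! j * h v x)"
      unfolding h_def by (rule linear_isometry_sum[OF p(1) P finV level_Lp])
    ultimately show ?thesis by eventually_elim simp
  qed
  have Pf_all: "AE x in M. \<forall>j\<in>{..<n}. P (f j) x = (\<Sum>v\<in>V. v ! j * h v x)"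
    by (intro AE_finite_allI Pf) auto
  have disj: "AE x in M. \<forall>v\<in>V. \<forall>v'\<in>V. v \<noteq> v' \<longrightarrow> h v x * h v' x = 0"
  proof (intro AE_finite_allI finV)
    fix v v' assume v: "v \<in> V" "v' \<in> V"
    show "AE x in M. v \<noteq> v' \<longrightarrow> h v x * h v' x = 0"
    proof (cases "v = v'")
      case False
      then have "AE x in M. level s v x * level s v' x = 0" by (intro AE_I2) (auto simp: level_def indicator_def)
      from linear_isometry_disjoint[OF p p_neq_2 P level_Lp[OF v(1)] level_Lp[OF v(2)] this]
      show ?thesis by (auto simp: h_def)
    qed simp
  qed
  have profile0: "profile s v 0 = 0" for v
    using s(2) by (simp add: profile_def weight_nth)
  have profile_m[measurable]: "profile s v \<in> borel_measurable borel" for v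
    unfolding profile_def by measurable
  have cm: "comb u (map (apsnd P) s) (x, \<omega>) = (\<Sum>j<n. a j * cis (Re (z \<omega> * P (f j) x)))" for x \<omega>
    unfolding comb_nth by (auto simp: n_def a_def f_def u_def intro!: sum.cong)
  \<comment> \<open>At almost every \<open>x\<close> at most one \<open>h v x\<close> is nonzero.
    The combination then equals the one with value list \<open>v\<close> at the rescaled point
    \<open>z \<omega> * h v x\<close>; all other profiles are taken at 0, where weight 0 makes them
    vanish.\<close>
  have key: "AE x in M. \<forall>\<omega>. ennreal (cmod (comb u (map (apsnd P) s) (x, \<omega>)) powr q) = (\<Sum>v\<in>V. profile s v (z \<omega> * h v x))"
    using Pf_all disj
  proof (eventually_elim, intro allI)
    fix x \<omega>
    assume Pfx: "\<forall>j\<in>{..<n}. P (f j) x = (\<Sum>v\<in>V. v ! j * h v x)"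
      and dj: "\<forall>v\<in>V. \<forall>v'\<in>V. v \<noteq> v' \<longrightarrow> h v x * h v' x = 0"
    show "ennreal (cmod (comb u (map (apsnd P) s) (x, \<omega>)) powr q) = (\<Sum>v\<in>V. profile s v (z \<omega> * h v x))"
    proof (cases "\<exists>v0\<in>V. h v0 x \<noteq> 0")
      case True
      then obtain v0 where v0: "v0 \<in> V" "h v0 x \<noteq> 0" by blast
      have zero: "h v x = 0" if "v \<in> V" "v \<noteq> v0" for v
        using dj v0 that by (metis mult_eq_0_iff)
      have "P (f j) x = v0 ! j * h v0 x" if "j < n" for j
      proof -
        have "(\<Sum>v\<in>V. v ! j * h v x) = (\<Sum>v\<in>V. if v = v0 then v0 ! j * h v0 x else 0)"
          using zero by (intro sum.cong) auto
        then show ?thesis using Pfx that v0 finV by simp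
      qed
      then have "comb u (map (apsnd P) s) (x, \<omega>) = (\<Sum>j<n. a j * cis (Re (z \<omega> * h v0 x * v0 ! j)))"
        unfolding cm by (intro sum.cong) (auto simp: mult_ac)
      then have "ennreal (cmod (comb u (map (apsnd P) s) (x, \<omega>)) powr q) = profile s v0 (z \<omega> * h v0 x)"
        by (simp add: profile_def n_def a_def)
      also have "\<dots> = (\<Sum>v\<in>V. if v = v0 then profile s v0 (z \<omega> * h v0 x) else 0)"
        using v0 finV by simp
      also have "\<dots> = (\<Sum>v\<in>V. profile s v (z \<omega> * h v x))"
        using zero profile0 by (intro sum.cong) auto
      finally show ?thesis .
    next
      case False
      then have "comb u (map (apsnd P) s) (x, \<omega>) = weight s"
        using Pfx unfolding cm by (simp add: weight_nth n_def a_def)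
      then show ?thesis using False s(2) profile0 by simp
    qed
  qed
  have fm: "snd ` set (map (apsnd P) s) \<subseteq> Lp_space M p"
    using s(1) linear_isometry_Lp[OF P] by auto
  have "(\<integral>\<^sup>+ y. ennreal (cmod (comb u (map (apsnd P) s) y) powr q) \<partial>(M \<Otimes>\<^sub>M W))
      = (\<integral>\<^sup>+ x. (\<integral>\<^sup>+ \<omega>. ennreal (cmod (comb u (map (apsnd P) s) (x, \<omega>)) powr q) \<partial>W) \<partial>M)"
  proof (rule W.nn_integral_fst[symmetric])
    have [measurable]: "comb u (map (apsnd P) s) \<in> borel_measurable (M \<Otimes>\<^sub>M W)"
      using fm by (intro comb_measurable u_measurable) auto
    show "(\<lambda>y. ennreal (cmod (comb u (map (apsnd P) s) y) powr q)) \<in> borel_measurable (M \<Otimes>\<^sub>M W)"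
      by measurable
  qed
  \<comment> \<open>Homogeneity turns the integral over \<open>W\<close> into a factor
    \<open>|h v x|^p\<close>, whose integral over \<open>M\<close> is preserved by the
    isometry.\<close>
  also have "\<dots> = (\<integral>\<^sup>+ x. (\<Sum>v\<in>V. ennreal (cmod (h v x) powr p) * (\<integral>\<^sup>+ \<omega>. profile s v (z \<omega>) \<partial>W)) \<partial>M)"
  proof (rule nn_integral_cong_AE, use key in eventually_elim)
    fix x
    assume "\<forall>\<omega>. ennreal (cmod (comb u (map (apsnd P) s) (x, \<omega>)) powr q) = (\<Sum>v\<in>V. profile s v (z \<omega> * h v x))"
    then have "(\<integral>\<^sup>+ \<omega>. ennreal (cmod (comb u (map (apsnd P) s) (x, \<omega>)) powr q) \<partial>W)
       = (\<integral>\<^sup>+ \<omega>. (\<Sum>v\<in>V. profile s v (z \<omega> * h v x)) \<partial>W)" by simp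
    also have "\<dots> = (\<Sum>v\<in>V. \<integral>\<^sup>+ \<omega>. profile s v (z \<omega> * h v x) \<partial>W)"
      by (rule nn_integral_sum) measurable
    also have "\<dots> = (\<Sum>v\<in>V. ennreal (cmod (h v x) powr p) * (\<integral>\<^sup>+ \<omega>. profile s v (z \<omega>) \<partial>W))"
      by (intro sum.cong refl homogeneous profile_m profile0)
    finally show "(\<integral>\<^sup>+ \<omega>. ennreal (cmod (comb u (map (apsnd P) s) (x, \<omega>)) powr q) \<partial>W) = \<dots>" .
  qed
  also have "\<dots> = (\<Sum>v\<in>V. \<integral>\<^sup>+ x. ennreal (cmod (h v x) powr p) * (\<integral>\<^sup>+ \<omega>. profile s v (z \<omega>) \<partial>W) \<partial>M)"
  proof (rule nn_integral_sum)
    fix v assume "v \<in> V"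
    note [measurable] = Lp_space_measurable[OF h(1)[OF this]]
    show "(\<lambda>x. ennreal (cmod (h v x) powr p) * (\<integral>\<^sup>+ \<omega>. profile s v (z \<omega>) \<partial>W)) \<in> borel_measurable M"
      by measurable
  qed
  also have "\<dots> = (\<Sum>v\<in>V. ennreal (Lp_int M p (level s v)) * (\<integral>\<^sup>+ \<omega>. profile s v (z \<omega>) \<partial>W))"
  proof (rule sum.cong[OF refl])
    fix v assume v: "v \<in> V"
    have "(\<integral>\<^sup>+ x. ennreal (cmod (h v x) powr p) * (\<integral>\<^sup>+ \<omega>. profile s v (z \<omega>) \<partial>W) \<partial>M)
        = (\<integral>\<^sup>+ x. ennreal (cmod (h v x) powr p) \<partial>M) * (\<integral>\<^sup>+ \<omega>. profile s v (z \<omega>) \<partial>W)"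
      using Lp_space_measurable[OF h(1)[OF v]] by (intro nn_integral_multc) measurable
    then show "(\<integral>\<^sup>+ x. ennreal (cmod (h v x) powr p) * (\<integral>\<^sup>+ \<omega>. profile s v (z \<omega>) \<partial>W) \<partial>M)
        = ennreal (Lp_int M p (level s v)) * (\<integral>\<^sup>+ \<omega>. profile s v (z \<omega>) \<partial>W)"
      using Lp_int_eq_nn_integral[OF h(1)[OF v]] h(2)[OF v] by simp
  qed
  finally show ?thesis by (simp add: V_def)
qed

text \<open>On simple functions the formula above is compared for \<open>P\<close> and for the
  identity; density does the rest.\<close>

lemma u_linear_isometry:
  assumes P: "Lp_linear_isometry M p P" and s: "snd ` set s \<subseteq> Lp_space M p" "weight s = 0"
  shows "Lp_int (M \<Otimes>\<^sub>M W) q (comb u (map (apsnd P) s)) = Lp_int (M \<Otimes>\<^sub>M W) q (comb u s)"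
proof (rule u_isometry_by_density[OF P _ _ s, of "{f. simple_function M f}"])
  show "\<exists>g :: nat \<Rightarrow> _. (\<forall>n. g n \<in> {f. simple_function M f} \<inter> Lp_space M p) \<and> (\<lambda>n. Lp_int M p (\<lambda>x. g n x - f x)) \<longlonglongrightarrow> 0"
    if f: "f \<in> Lp_space M p" for f
    using Lp_simple_approx[OF f p(1)] by (metis IntI mem_Collect_eq)
  fix t assume t: "snd ` set t \<subseteq> {f. simple_function M f} \<inter> Lp_space M p" "weight t = 0"
  have "map (apsnd (\<lambda>f. f)) t = t" by (induction t) auto
  then show "Lp_int (M \<Otimes>\<^sub>M W) q (comb u (map (apsnd P) t)) = Lp_int (M \<Otimes>\<^sub>M W) q (comb u t)"
    unfolding Lp_int_def[of "M \<Otimes>\<^sub>M W"] nn_integral_comb_simple[OF P t]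
    using nn_integral_comb_simple[OF linear_isometry_ident t] by simp
qed

lemma u_add: "u (\<lambda>x. f x + g x) y = u f y * u g y"
  by (simp add: u_def cis_mult distrib_left)

end

section \<open>Cholesky factorisation of positive semidefinite kernels\<close>

context
  fixes K :: "nat \<Rightarrow> nat \<Rightarrow> real"
begin

text \<open>If the pivot vanishes, so does its row, and the step with division by 0 changes nothing.\<close>

fun schur :: "nat \<Rightarrow> nat \<Rightarrow> nat \<Rightarrow> real" where
  "schur 0 n m = K n m"
| "schur (Suc k) n m = schur k n m - schur k n k * schur k m k / schur k k k"

definition cholesky :: "nat \<Rightarrow> nat \<Rightarrow> real" where
  "cholesky n k = schur k n k / sqrt (schur k k k)"

end

definition psd_kernel :: "(nat \<Rightarrow> nat \<Rightarrow> real) \<Rightarrow> bool" where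
  "psd_kernel K \<longleftrightarrow> (\<forall>n m. K n m = K m n) \<and> (\<forall>N c. 0 \<le> (\<Sum>n<N. \<Sum>m<N. c n * c m * K n m))"

lemma psd_kernelD:
  assumes "psd_kernel K"
  shows "K n m = K m n" "0 \<le> (\<Sum>n<N. \<Sum>m<N. c n * c m * K n m)"
  using assms unfolding psd_kernel_def by blast+

text \<open>The quadratic form at \<open>c - t e_k\<close>. Suitable choices of \<open>c\<close> and
  \<open>t\<close> give the sign of the diagonal, the vanishing of the row of a zero pivot, and the
  elimination step.\<close>

lemma quadratic_shift:
  fixes K :: "nat \<Rightarrow> nat \<Rightarrow> real"
  assumes "k < N" "\<And>n m. K n m = K m n"
  shows "(\<Sum>n<N. \<Sum>m<N. (c n - t * of_bool (n = k)) * (c m - t * of_bool (m = k)) * K n m)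
    = (\<Sum>n<N. \<Sum>m<N. c n * c m * K n m) - 2 * t * (\<Sum>n<N. c n * K n k) + t\<^sup>2 * K k k"
proof -
  have eq: "(c n - t * of_bool (n = k)) * (c m - t * of_bool (m = k)) * K n m
     = c n * c m * K n m - t * (if m = k then c n * K n k else 0) - t * (if n = k then c m * K m k else 0)
       + t\<^sup>2 * (if n = k then (if m = k then K k k else 0) else 0)" for n m
    using assms(2)[of k m] by (auto simp: algebra_simps power2_eq_square)
  have "(\<Sum>n<N. \<Sum>m<N. (c n - t * of_bool (n = k)) * (c m - t * of_bool (m = k)) * K n m)
    = (\<Sum>n<N. \<Sum>m<N. c n * c m * K n m) - t * (\<Sum>n<N. \<Sum>m<N. (if m = k then c n * K n k else 0))
      - t * (\<Sum>n<N. \<Sum>m<N. (if n = k then c m * K m k else 0))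
      + t\<^sup>2 * (\<Sum>n<N. \<Sum>m<N. (if n = k then (if m = k then K k k else 0) else 0))"
    by (simp only: eq sum.distrib sum_subtractf sum_distrib_left)
  moreover have "(\<Sum>n<N. \<Sum>m<N. (if m = k then c n * K n k else 0)) = (\<Sum>n<N. c n * K n k)"
    using assms(1) by simp
  moreover have "(\<Sum>n<N. \<Sum>m<N. (if n = k then c m * K m k else 0)) = (\<Sum>n<N. c n * K n k)"
    using assms(1) by (subst sum.swap) simp
  moreover have "(\<Sum>n<N. \<Sum>m<N. (if n = k then (if m = k then K k k else 0) else 0)) = K k k"
  proof -
    have "(\<Sum>m<N. (if n = k then (if m = k then K k k else 0) else 0)) = (if n = k then K k k else 0)" for n
      using assms(1) by simp
    then show ?thesis using assms(1) by simp
  qed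
  ultimately show ?thesis by simp
qed

lemma psd_diag_nonneg:
  assumes "psd_kernel K"
  shows "0 \<le> K k k"
proof -
  have "0 \<le> (\<Sum>n<Suc k. \<Sum>m<Suc k. (0 - 1 * of_bool (n = k)) * (0 - 1 * of_bool (m = k)) * K n m)"
    by (rule psd_kernelD(2)[OF assms, where c = "\<lambda>n. 0 - 1 * of_bool (n = k)"])
  also have "\<dots> = K k k"
    using quadratic_shift[of k "Suc k" K "\<lambda>_. 0" 1] assms by (simp add: psd_kernel_def)
  finally show ?thesis .
qed

lemma psd_zero_diag:
  assumes K: "psd_kernel K" and "K k k = 0"
  shows "K n k = 0"
proof (rule ccontr)
  assume ne: "K n k \<noteq> 0"
  define N where "N = Suc (max n k)"
  have N: "n < N" "k < N" by (auto simp: N_def)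
  \<comment> \<open>With a zero pivot the form at \<open>e_n - t e_k\<close> is
    \<open>K n n - 2 * t * K n k\<close>, affine in \<open>t\<close>; this \<open>t\<close> makes it
    -1.\<close>
  define t where "t = (K n n + 1) / (2 * K n k)"
  let ?c = "\<lambda>i. of_bool (i = n) :: real"
  have sym: "\<And>n m. K n m = K m n" using K unfolding psd_kernel_def by blast
  have "(\<Sum>i<N. \<Sum>j<N. ?c i * ?c j * K i j) = K n n"
  proof -
    have "(\<Sum>j<N. ?c i * ?c j * K i j) = (if i = n then K n n else 0)" for i
    proof -
      have "(\<Sum>j<N. ?c i * ?c j * K i j) = (\<Sum>j<N. if j = n then (if i = n then K n n else 0) else 0)"
        by (intro sum.cong) auto
      then show ?thesis using N by simp
    qed
    then show ?thesis using N by simp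
  qed
  moreover have "(\<Sum>i<N. ?c i * K i k) = K n k"
  proof -
    have "(\<Sum>i<N. ?c i * K i k) = (\<Sum>i<N. if i = n then K n k else 0)" by (intro sum.cong) auto
    then show ?thesis using N by simp
  qed
  moreover have "0 \<le> (\<Sum>i<N. \<Sum>j<N. (?c i - t * of_bool (i = k)) * (?c j - t * of_bool (j = k)) * K i j)"
    by (rule psd_kernelD(2)[OF K, where c = "\<lambda>i. ?c i - t * of_bool (i = k)"])
  ultimately have "0 \<le> K n n - 2 * t * K n k"
    using quadratic_shift[OF N(2) sym, of ?c t] assms(2) by simp
  moreover have "2 * t * K n k = K n n + 1" using ne by (simp add: t_def)
  ultimately show False by simp
qed

text \<open>The form of the Schur complement at \<open>c\<close> is the minimum over
  \<open>t\<close> of the form of \<open>K\<close> at \<open>c - t e_k\<close>, attained at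
  \<open>t = b / d\<close>.\<close>

lemma psd_schur_step:
  assumes K: "psd_kernel K"
  shows "psd_kernel (\<lambda>n m. K n m - K n k * K m k / K k k)"
proof (cases "K k k = 0")
  case False
  have sym: "\<And>n m. K n m = K m n" and psd: "\<And>N c. 0 \<le> (\<Sum>n<N. \<Sum>m<N. c n * c m * K n m)"
    using K unfolding psd_kernel_def by blast+
  define d where "d = K k k"
  have d: "0 < d" using psd_diag_nonneg[OF K, of k] False by (simp add: d_def)
  have "0 \<le> (\<Sum>n<N. \<Sum>m<N. c n * c m * (K n m - K n k * K m k / d))" for N c
  proof -
    \<comment> \<open>The index \<open>k\<close> may lie beyond \<open>N\<close>, so the sums are
      enlarged and \<open>c\<close> is continued by 0.\<close>
    define N' where "N' = max N (Suc k)"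
    define c' where "c' n = (if n < N then c n else 0)" for n
    have kN: "k < N'" and sub: "{..<N} \<subseteq> {..<N'}" by (auto simp: N'_def)
    define b where "b = (\<Sum>n<N'. c' n * K n k)"
    have trunc: "(\<Sum>n<N'. c' n * F n) = (\<Sum>n<N. c n * F n)" for F :: "nat \<Rightarrow> real"
      using sub by (intro sum.mono_neutral_cong_right) (auto simp: c'_def)
    have "(\<Sum>n<N. \<Sum>m<N. c n * c m * (K n m - K n k * K m k / d))
       = (\<Sum>n<N. \<Sum>m<N. c n * c m * K n m) - (\<Sum>n<N. c n * K n k) * (\<Sum>m<N. c m * K m k) / d"
      by (simp add: algebra_simps sum_subtractf sum_product sum_divide_distrib)
    also have "(\<Sum>n<N. \<Sum>m<N. c n * c m * K n m) = (\<Sum>n<N'. c' n * (\<Sum>m<N'. c' m * K n m))"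
      unfolding trunc by (simp add: sum_distrib_left mult.assoc)
    also have "\<dots> = (\<Sum>n<N'. \<Sum>m<N'. c' n * c' m * K n m)" by (simp add: sum_distrib_left mult.assoc)
    also have "(\<Sum>n<N. c n * K n k) = b" unfolding b_def trunc ..
    also have "(\<Sum>n<N'. \<Sum>m<N'. c' n * c' m * K n m) - b * b / d
      = (\<Sum>n<N'. \<Sum>m<N'. (c' n - (b / d) * of_bool (n = k)) * (c' m - (b / d) * of_bool (m = k)) * K n m)"
      unfolding quadratic_shift[OF kN sym] b_def[symmetric] d_def[symmetric] using d
      by (simp add: power2_eq_square field_simps)
    also have "0 \<le> \<dots>" by (rule psd)
    finally show ?thesis .
  qed
  then show ?thesis unfolding psd_kernel_def d_def using sym by (simp add: mult.commute)
next
  case True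
  then show ?thesis using K by simp
qed

lemma psd_schur: "psd_kernel K \<Longrightarrow> psd_kernel (schur K k)"
proof (induction k)
  case 0
  then show ?case by (simp add: psd_kernel_def)
next
  case (Suc k)
  have "schur K (Suc k) = (\<lambda>n m. schur K k n m - schur K k n k * schur K k m k / schur K k k k)" by (intro ext) simp
  then show ?case using psd_schur_step[OF Suc.IH[OF Suc.prems], of k] by simp
qed

text \<open>Step \<open>k\<close> clears row \<open>k\<close>, which vanishes beforehand if the
  pivot does; rows cleared earlier stay 0.\<close>

lemma schur_zero:
  assumes K: "psd_kernel K"
  shows "n < k \<Longrightarrow> schur K k n m = 0"
proof (induction k arbitrary: n m)
  case (Suc k)
  have k: "psd_kernel (schur K k)" by (rule psd_schur[OF K])
  show ?case
  proof (cases "n = k")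
    case True
    have "schur K k k m = schur K k m k" using k by (simp add: psd_kernel_def)
    then show ?thesis
      using True psd_zero_diag[OF k, of k m] by (cases "schur K k k k = 0") auto
  next
    case False
    then show ?thesis using Suc by simp
  qed
qed simp

text \<open>The elimination steps telescope: \<open>K\<close> minus the first \<open>N\<close>
  products is \<open>schur K N\<close>, whose row \<open>n\<close> is 0.\<close>

lemma cholesky_factorisation:
  assumes K: "psd_kernel K" and n: "n < N"
  shows "K n m = (\<Sum>k<N. cholesky K n k * cholesky K m k)"
proof -
  have prod: "cholesky K n k * cholesky K m k = schur K k n k * schur K k m k / schur K k k k" for k
    using psd_diag_nonneg[OF psd_schur[OF K], of k k] by (simp add: cholesky_def)
  have "K n m = schur K N n m + (\<Sum>k<N. cholesky K n k * cholesky K m k)"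
    unfolding prod by (induction N) auto
  then show ?thesis using schur_zero[OF K n] by simp
qed

lemma cholesky_lower: "psd_kernel K \<Longrightarrow> n < k \<Longrightarrow> cholesky K n k = 0"
  using schur_zero[of K n k k] by (simp add: cholesky_def)

section \<open>Gaussian sequences\<close>

text \<open>One countable product carries every Gaussian sequence needed, by way of a triangular
  linear transformation of the coordinates.\<close>

definition gauss_space :: "(nat \<Rightarrow> real) measure" where
  "gauss_space = PiM UNIV (\<lambda>_. std_normal_distribution)"

interpretation std_normal: real_distribution std_normal_distribution
  by (rule real_dist_normal_dist)

interpretation gauss: product_prob_space "\<lambda>_ :: nat. std_normal_distribution" UNIV
  by unfold_locales

lemma prob_space_gauss: "prob_space gauss_space"
  unfolding gauss_space_def by (rule gauss.prob_space_axioms)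

interpretation gauss_space: prob_space gauss_space
  by (rule prob_space_gauss)

lemma gauss_coordinate_distr: "distr gauss_space borel (\<lambda>\<omega>. \<omega> k) = std_normal_distribution"
proof -
  have "distr gauss_space std_normal_distribution (\<lambda>\<omega>. \<omega> k) = std_normal_distribution"
    unfolding gauss_space_def by (rule gauss.PiM_component) simp
  moreover have "distr gauss_space borel (\<lambda>\<omega>. \<omega> k) = distr gauss_space std_normal_distribution (\<lambda>\<omega>. \<omega> k)"
    by (intro distr_cong) auto
  ultimately show ?thesis by simp
qed

lemma gauss_coordinate_measurable [measurable]: "(\<lambda>\<omega>. \<omega> k) \<in> borel_measurable gauss_space"
proof -
  have "(\<lambda>\<omega>. \<omega> k) \<in> measurable gauss_space std_normal_distribution"
    unfolding gauss_space_def by (rule measurable_component_singleton) simp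
  then show ?thesis by simp
qed

lemma gauss_indep: "gauss_space.indep_vars (\<lambda>_. borel) (\<lambda>k \<omega>. b k * \<omega> k) UNIV"
proof -
  have "gauss_space.indep_vars (\<lambda>_. std_normal_distribution) (\<lambda>k \<omega>. \<omega> k) UNIV"
  proof (subst gauss_space.indep_vars_iff_distr_eq_PiM')
    show "distr gauss_space (PiM UNIV (\<lambda>_. std_normal_distribution)) (\<lambda>x. \<lambda>i\<in>UNIV. x i)
        = PiM UNIV (\<lambda>i. distr gauss_space std_normal_distribution (\<lambda>\<omega>. \<omega> i))"
      using gauss.PiM_component by (simp add: gauss_space_def distr_id2 restrict_UNIV)
  qed auto
  then show ?thesis
    by (rule gauss_space.indep_vars_compose2) auto
qed

lemma gauss_moments:
  "integrable gauss_space (\<lambda>\<omega>. \<omega> k)" "(\<integral>\<omega>. \<omega> k \<partial>gauss_space) = 0"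
  "integrable gauss_space (\<lambda>\<omega>. \<omega> k * \<omega> l)" "(\<integral>\<omega>. \<omega> k * \<omega> l \<partial>gauss_space) = of_bool (k = l)"
proof -
  have int: "integrable gauss_space (\<lambda>\<omega>. (\<omega> k) ^ j)" "(\<integral>\<omega>. (\<omega> k) ^ j \<partial>gauss_space) = (\<integral>x. x ^ j \<partial>std_normal_distribution)" for j k
  proof -
    have "integrable (distr gauss_space borel (\<lambda>\<omega>. \<omega> k)) (\<lambda>x. x ^ j)"
      unfolding gauss_coordinate_distr by (rule integrable_std_normal_distribution_moment)
    then show "integrable gauss_space (\<lambda>\<omega>. (\<omega> k) ^ j)"
      by (subst (asm) integrable_distr_eq) auto
    have "(\<integral>x. x ^ j \<partial>distr gauss_space borel (\<lambda>\<omega>. \<omega> k)) = (\<integral>\<omega>. (\<omega> k) ^ j \<partial>gauss_space)"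
      by (rule integral_distr) auto
    then show "(\<integral>\<omega>. (\<omega> k) ^ j \<partial>gauss_space) = (\<integral>x. x ^ j \<partial>std_normal_distribution)"
      unfolding gauss_coordinate_distr by simp
  qed
  show 1: "integrable gauss_space (\<lambda>\<omega>. \<omega> k)" for k using int(1)[of k 1] by simp
  show 2: "(\<integral>\<omega>. \<omega> k \<partial>gauss_space) = 0" for k
    using int(2)[of k 1] integral_std_normal_distribution_moment_odd[of 1] by simp
  have "integrable gauss_space (\<lambda>\<omega>. \<omega> k * \<omega> l) \<and> (\<integral>\<omega>. \<omega> k * \<omega> l \<partial>gauss_space) = of_bool (k = l)"
  proof (cases "k = l")
    case True
    have "(\<integral>x. x ^ (2 * 1) \<partial>std_normal_distribution) = 1"
      using std_normal_distribution_even_moments(1)[of 1] by simp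
    then show ?thesis using int[of k 2] True by (simp add: power2_eq_square)
  next
    case False
    have ind: "gauss_space.indep_vars (\<lambda>_. borel) (\<lambda>k \<omega>. \<omega> k) {k, l}"
      using gauss_space.indep_vars_subset[OF gauss_indep[of "\<lambda>_. 1"], of "{k, l}"] by simp
    have "integrable gauss_space (\<lambda>\<omega>. \<Prod>i\<in>{k, l}. \<omega> i)"
      by (rule gauss_space.indep_vars_integrable[OF _ ind]) (auto intro: 1)
    moreover have "(\<integral>\<omega>. (\<Prod>i\<in>{k, l}. \<omega> i) \<partial>gauss_space) = (\<Prod>i\<in>{k, l}. \<integral>\<omega>. \<omega> i \<partial>gauss_space)"
      by (rule gauss_space.indep_vars_lebesgue_integral[OF _ ind]) (auto intro: 1)
    ultimately show ?thesis using False 2 by simp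
  qed
  then show "integrable gauss_space (\<lambda>\<omega>. \<omega> k * \<omega> l)" "(\<integral>\<omega>. \<omega> k * \<omega> l \<partial>gauss_space) = of_bool (k = l)" by auto
qed

lemma gauss_sum_square:
  "integrable gauss_space (\<lambda>\<omega>. (\<Sum>k<N. b k * \<omega> k)\<^sup>2)"
  "(\<integral>\<omega>. (\<Sum>k<N. b k * \<omega> k)\<^sup>2 \<partial>gauss_space) = (\<Sum>k<N. (b k)\<^sup>2)"
proof -
  have eq: "(\<Sum>k<N. b k * \<omega> k)\<^sup>2 = (\<Sum>k<N. \<Sum>l<N. (b k * b l) * (\<omega> k * \<omega> l))" for \<omega> :: "nat \<Rightarrow> real"
    by (simp add: power2_eq_square sum_product mult_ac)
  have i: "integrable gauss_space (\<lambda>\<omega>. (b k * b l) * (\<omega> k * \<omega> l))" for k l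
    by (intro integrable_mult_right gauss_moments)
  show "integrable gauss_space (\<lambda>\<omega>. (\<Sum>k<N. b k * \<omega> k)\<^sup>2)"
    unfolding eq by (intro Bochner_Integration.integrable_sum i)
  have "(\<integral>\<omega>. (\<Sum>k<N. b k * \<omega> k)\<^sup>2 \<partial>gauss_space) = (\<Sum>k<N. \<integral>\<omega>. (\<Sum>l<N. (b k * b l) * (\<omega> k * \<omega> l)) \<partial>gauss_space)"
    unfolding eq by (rule Bochner_Integration.integral_sum) (intro Bochner_Integration.integrable_sum i)
  also have "\<dots> = (\<Sum>k<N. \<Sum>l<N. \<integral>\<omega>. (b k * b l) * (\<omega> k * \<omega> l) \<partial>gauss_space)"
    by (intro sum.cong refl Bochner_Integration.integral_sum i)
  also have "\<dots> = (\<Sum>k<N. \<Sum>l<N. (b k * b l) * of_bool (k = l))"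
    by (simp only: integral_mult_right_zero gauss_moments(4))
  also have "\<dots> = (\<Sum>k<N. (b k)\<^sup>2)"
  proof (rule sum.cong[OF refl])
    fix k assume "k \<in> {..<N}"
    have "(\<Sum>l<N. (b k * b l) * of_bool (k = l)) = (\<Sum>l<N. if l = k then (b k)\<^sup>2 else 0)"
      by (intro sum.cong) (auto simp: power2_eq_square)
    then show "(\<Sum>l<N. (b k * b l) * of_bool (k = l)) = (b k)\<^sup>2" using \<open>k \<in> {..<N}\<close> by simp
  qed
  finally show "(\<integral>\<omega>. (\<Sum>k<N. b k * \<omega> k)\<^sup>2 \<partial>gauss_space) = (\<Sum>k<N. (b k)\<^sup>2)" .
qed

lemma gauss_sum_char:
  "(\<integral>\<omega>. cis (\<Sum>k<N. b k * \<omega> k) \<partial>gauss_space) = complex_of_real (exp (- (\<Sum>k<N. (b k)\<^sup>2) / 2))"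
proof -
  have ind: "gauss_space.indep_vars (\<lambda>_. borel) (\<lambda>k \<omega>. b k * \<omega> k) {..<N}"
    using gauss_space.indep_vars_subset[OF gauss_indep] by blast
  have one: "char (distr gauss_space borel (\<lambda>\<omega>. b k * \<omega> k)) 1 = complex_of_real (exp (- (b k)\<^sup>2 / 2))" for k
  proof -
    have "char (distr gauss_space borel (\<lambda>\<omega>. b k * \<omega> k)) 1 = (\<integral>\<omega>. iexp (b k * \<omega> k) \<partial>gauss_space)"
      unfolding char_def by (subst integral_distr) auto
    also have "\<dots> = (\<integral>x. iexp (b k * x) \<partial>distr gauss_space borel (\<lambda>\<omega>. \<omega> k))"
      by (rule integral_distr[symmetric]) auto
    also have "\<dots> = char std_normal_distribution (b k)"
      unfolding gauss_coordinate_distr char_def ..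
    finally show ?thesis by (simp add: char_std_normal_distribution)
  qed
  have "(\<integral>\<omega>. cis (\<Sum>k<N. b k * \<omega> k) \<partial>gauss_space) = char (distr gauss_space borel (\<lambda>\<omega>. \<Sum>k<N. b k * \<omega> k)) 1"
    unfolding char_def by (subst integral_distr) (auto simp: cis_conv_exp)
  also have "\<dots> = (\<Prod>k<N. char (distr gauss_space borel (\<lambda>\<omega>. b k * \<omega> k)) 1)"
    by (rule gauss_space.char_distr_sum[OF ind])
  also have "\<dots> = complex_of_real (exp (\<Sum>k<N. - (b k)\<^sup>2 / 2))"
    unfolding one by (simp add: exp_sum)
  also have "(\<Sum>k<N. - (b k)\<^sup>2 / 2) = - (\<Sum>k<N. (b k)\<^sup>2) / 2"
    by (simp add: sum_negf sum_divide_distrib)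
  finally show ?thesis .
qed

text \<open>Since the Cholesky factor is triangular, each \<open>X n\<close> is a finite sum and no
  convergence is involved. Of the joint law only second moments and characteristic functions of
  finite combinations are kept.\<close>

lemma gaussian_sequence:
  assumes K: "psd_kernel K"
  obtains X :: "nat \<Rightarrow> (nat \<Rightarrow> real) \<Rightarrow> real" where
    "\<And>n. X n \<in> borel_measurable gauss_space"
    "\<And>N c. integrable gauss_space (\<lambda>\<omega>. (\<Sum>n<N. c n * X n \<omega>)\<^sup>2)"
    "\<And>N c. (\<integral>\<omega>. (\<Sum>n<N. c n * X n \<omega>)\<^sup>2 \<partial>gauss_space) = (\<Sum>n<N. \<Sum>m<N. c n * c m * K n m)"
    "\<And>N c. (\<integral>\<omega>. cis (\<Sum>n<N. c n * X n \<omega>) \<partial>gauss_space)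
       = complex_of_real (exp (- (\<Sum>n<N. \<Sum>m<N. c n * c m * K n m) / 2))"
proof -
  define X where "X n \<omega> = (\<Sum>k\<le>n. cholesky K n k * \<omega> k)" for n and \<omega> :: "nat \<Rightarrow> real"
  have comb: "(\<Sum>n<N. c n * X n \<omega>) = (\<Sum>k<N. (\<Sum>n<N. c n * cholesky K n k) * \<omega> k)" for N c \<omega>
  proof -
    have "X n \<omega> = (\<Sum>k<N. cholesky K n k * \<omega> k)" if "n < N" for n
      unfolding X_def using that cholesky_lower[OF K] by (intro sum.mono_neutral_left) (auto simp: not_le)
    then have "(\<Sum>n<N. c n * X n \<omega>) = (\<Sum>n<N. \<Sum>k<N. c n * (cholesky K n k * \<omega> k))"
      by (simp add: sum_distrib_left)
    also have "\<dots> = (\<Sum>k<N. \<Sum>n<N. c n * (cholesky K n k * \<omega> k))" by (rule sum.swap)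
    finally show ?thesis by (simp add: sum_distrib_right mult.assoc)
  qed
  have Q: "(\<Sum>k<N. (\<Sum>n<N. c n * cholesky K n k)\<^sup>2) = (\<Sum>n<N. \<Sum>m<N. c n * c m * K n m)" for N c
  proof -
    have "(\<Sum>k<N. (\<Sum>n<N. c n * cholesky K n k)\<^sup>2) = (\<Sum>k<N. \<Sum>n<N. \<Sum>m<N. c n * c m * (cholesky K n k * cholesky K m k))"
      by (simp add: power2_eq_square sum_product mult_ac)
    also have "\<dots> = (\<Sum>n<N. \<Sum>k<N. \<Sum>m<N. c n * c m * (cholesky K n k * cholesky K m k))" by (rule sum.swap)
    also have "\<dots> = (\<Sum>n<N. \<Sum>m<N. \<Sum>k<N. c n * c m * (cholesky K n k * cholesky K m k))"
      by (intro sum.cong refl sum.swap)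
    also have "\<dots> = (\<Sum>n<N. \<Sum>m<N. c n * c m * K n m)"
      using cholesky_factorisation[OF K, where N = N] by (intro sum.cong refl) (simp add: sum_distrib_left)
    finally show ?thesis .
  qed
  show ?thesis
  proof
    show "X n \<in> borel_measurable gauss_space" for n unfolding X_def by measurable
    show "integrable gauss_space (\<lambda>\<omega>. (\<Sum>n<N. c n * X n \<omega>)\<^sup>2)" for N c
      unfolding comb by (rule gauss_sum_square)
    show "(\<integral>\<omega>. (\<Sum>n<N. c n * X n \<omega>)\<^sup>2 \<partial>gauss_space) = (\<Sum>n<N. \<Sum>m<N. c n * c m * K n m)" for N c
      unfolding comb gauss_sum_square Q ..
    show "(\<integral>\<omega>. cis (\<Sum>n<N. c n * X n \<omega>) \<partial>gauss_space)
       = complex_of_real (exp (- (\<Sum>n<N. \<Sum>m<N. c n * c m * K n m) / 2))" for N c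
      unfolding comb gauss_sum_char Q ..
  qed
qed

section \<open>Moments\<close>

context prob_space
begin

text \<open>On a bounded interval polynomials are uniformly dense among the continuous functions.
  Boundedness is essential, as moments do not determine arbitrary laws.\<close>

lemma moments_determine:
  fixes X X' :: "'a \<Rightarrow> real" and \<psi> :: "real \<Rightarrow> real"
  assumes [measurable]: "X \<in> borel_measurable M" "X' \<in> borel_measurable M" "\<psi> \<in> borel_measurable borel"
    and X: "\<And>\<omega>. X \<omega> \<in> {0..B}" and X': "\<And>\<omega>. X' \<omega> \<in> {0..B}"
    and moments: "\<And>k. (\<integral>\<omega>. X \<omega> ^ k \<partial>M) = (\<integral>\<omega>. X' \<omega> ^ k \<partial>M)"
    and \<psi>: "continuous_on {0..B} \<psi>"
  shows "(\<integral>\<omega>. \<psi> (X \<omega>) \<partial>M) = (\<integral>\<omega>. \<psi> (X' \<omega>) \<partial>M)"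
proof -
  obtain C where "\<forall>x\<in>{0..B}. \<bar>\<psi> x\<bar> \<le> C"
    using compact_imp_bounded[OF compact_continuous_image[OF \<psi> compact_Icc]] by (auto simp: bounded_iff)
  then have C: "\<bar>\<psi> x\<bar> \<le> C" if "x \<in> {0..B}" for x using that by blast
  have int\<psi>: "integrable M (\<lambda>\<omega>. \<psi> (Z \<omega>))" if [measurable]: "Z \<in> borel_measurable M" and "\<And>\<omega>. Z \<omega> \<in> {0..B}" for Z
    using C that(2) by (intro integrable_const_bound[where B = C]) auto
  have intp: "integrable M (\<lambda>\<omega>. Z \<omega> ^ k)" if [measurable]: "Z \<in> borel_measurable M" and Z: "\<And>\<omega>. Z \<omega> \<in> {0..B}" for Z :: "'a \<Rightarrow> real" and k
  proof (intro integrable_const_bound[where B = "B ^ k"] AE_I2)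
    show "norm (Z \<omega> ^ k) \<le> B ^ k" for \<omega> using Z[of \<omega>] by (auto intro!: power_mono)
  qed measurable
  have "\<bar>(\<integral>\<omega>. \<psi> (X \<omega>) \<partial>M) - (\<integral>\<omega>. \<psi> (X' \<omega>) \<partial>M)\<bar> \<le> e" if "0 < e" for e
  proof -
    obtain g where g: "real_polynomial_function g" "\<And>x. x \<in> {0..B} \<Longrightarrow> \<bar>\<psi> x - g x\<bar> < e / 2"
      using Stone_Weierstrass_real_polynomial_function[OF compact_Icc \<psi>, of "e / 2"] \<open>0 < e\<close> by (metis half_gt_zero)
    then obtain a n where ga: "g = (\<lambda>x. \<Sum>i\<le>n. a i * x ^ i)" by (auto simp: real_polynomial_function_iff_sum)
    have intg: "integrable M (\<lambda>\<omega>. g (Z \<omega>))" "(\<integral>\<omega>. g (Z \<omega>) \<partial>M) = (\<Sum>i\<le>n. a i * (\<integral>\<omega>. Z \<omega> ^ i \<partial>M))"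
      if "Z \<in> borel_measurable M" "\<And>\<omega>. Z \<omega> \<in> {0..B}" for Z :: "'a \<Rightarrow> real"
      unfolding ga using intp[OF that] by auto
    have near: "\<bar>(\<integral>\<omega>. \<psi> (Z \<omega>) \<partial>M) - (\<integral>\<omega>. g (Z \<omega>) \<partial>M)\<bar> \<le> e / 2"
      if Z: "Z \<in> borel_measurable M" "\<And>\<omega>. Z \<omega> \<in> {0..B}" for Z :: "'a \<Rightarrow> real"
    proof -
      have "(\<integral>\<omega>. \<psi> (Z \<omega>) \<partial>M) - (\<integral>\<omega>. g (Z \<omega>) \<partial>M) = (\<integral>\<omega>. \<psi> (Z \<omega>) - g (Z \<omega>) \<partial>M)"
        using int\<psi>[OF Z] intg(1)[OF Z] by simp
      also have "\<bar>\<dots>\<bar> \<le> (\<integral>\<omega>. \<bar>\<psi> (Z \<omega>) - g (Z \<omega>)\<bar> \<partial>M)"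
        by (rule integral_abs_bound)
      also have "\<dots> \<le> (\<integral>\<omega>. e / 2 \<partial>M)"
        using int\<psi>[OF Z] intg(1)[OF Z] g(2)[OF Z(2)]
        by (intro integral_mono) (auto intro: less_imp_le)
      also have "\<dots> = e / 2" by (simp add: prob_space)
      finally show ?thesis .
    qed
    have "(\<integral>\<omega>. g (X \<omega>) \<partial>M) = (\<integral>\<omega>. g (X' \<omega>) \<partial>M)"
      using intg(2)[OF assms(1) X] intg(2)[OF assms(2) X'] moments by simp
    then show ?thesis using near[OF assms(1) X] near[OF assms(2) X'] by linarith
  qed
  then have "\<bar>(\<integral>\<omega>. \<psi> (X \<omega>) \<partial>M) - (\<integral>\<omega>. \<psi> (X' \<omega>) \<partial>M)\<bar> \<le> 0"
    by (rule field_le_epsilon[of _ 0, simplified])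
  then show ?thesis by simp
qed

end

fun abs_power :: "(complex \<times> ('a \<Rightarrow> complex)) list \<Rightarrow> nat \<Rightarrow> (complex \<times> ('a \<Rightarrow> complex)) list" where
  "abs_power s 0 = [(1, \<lambda>x. 0)]"
| "abs_power s (Suc k) = cprod (\<lambda>f g x. f x + g x) (abs_power s k)
     (cprod (\<lambda>f g x. f x + g x) s (cconj (\<lambda>f x. - f x) s))"

text \<open>A random unimodular character of the additive group \<open>F\<close>, up to null sets,
  with mean \<open>\<kappa>\<close>. The means control all mixed moments because products of phases
  are again phases.\<close>

locale random_character = prob_space \<Omega>
  for \<Omega> :: "'w measure" +
  fixes F :: "('a \<Rightarrow> complex) set" and w :: "('a \<Rightarrow> complex) \<Rightarrow> 'w \<Rightarrow> complex" and \<kappa> :: "('a \<Rightarrow> complex) \<Rightarrow> complex"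
  assumes F_zero: "(\<lambda>x. 0) \<in> F" and F_add: "f \<in> F \<Longrightarrow> g \<in> F \<Longrightarrow> (\<lambda>x. f x + g x) \<in> F"
    and F_uminus: "f \<in> F \<Longrightarrow> (\<lambda>x. - f x) \<in> F"
    and w_measurable: "f \<in> F \<Longrightarrow> w f \<in> borel_measurable \<Omega>"
    and w_unit: "cmod (w f \<omega>) = 1"
    and w_add: "f \<in> F \<Longrightarrow> g \<in> F \<Longrightarrow> AE \<omega> in \<Omega>. w (\<lambda>x. f x + g x) \<omega> = w f \<omega> * w g \<omega>"
    and w_expectation: "f \<in> F \<Longrightarrow> (\<integral>\<omega>. w f \<omega> \<partial>\<Omega>) = \<kappa> f"
begin

lemma w_zero: "AE \<omega> in \<Omega>. w (\<lambda>x. 0) \<omega> = 1"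
  using w_add[OF F_zero F_zero]
proof eventually_elim
  case (elim \<omega>)
  have "w (\<lambda>x. 0) \<omega> \<noteq> 0" using w_unit[of "\<lambda>x. 0" \<omega>] by auto
  then show ?case using elim by simp
qed

lemma w_uminus:
  assumes f: "f \<in> F"
  shows "AE \<omega> in \<Omega>. w (\<lambda>x. - f x) \<omega> = cnj (w f \<omega>)"
  using w_add[OF f F_uminus[OF f]] w_zero
proof eventually_elim
  case (elim \<omega>)
  have "w f \<omega> * cnj (w f \<omega>) = 1" using w_unit[of f \<omega>] by (simp add: complex_norm_square[symmetric])
  moreover have "w f \<omega> * w (\<lambda>x. - f x) \<omega> = 1" using elim by simp
  ultimately show ?case using w_unit[of f \<omega>] by (metis mult_cancel_left norm_zero zero_neq_one)
qed

lemma comb_w_measurable: "snd ` set s \<subseteq> F \<Longrightarrow> comb w s \<in> borel_measurable \<Omega>"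
  using w_measurable by (intro comb_measurable) auto

lemma comb_w_bound: "cmod (comb w s \<omega>) \<le> (\<Sum>(a, f)\<leftarrow>s. cmod a)"
proof (induction s)
  case (Cons af s)
  obtain a f where af: "af = (a, f)" by fastforce
  show ?case
    using Cons norm_triangle_mono[of "a * w f \<omega>" "cmod a" "comb w s \<omega>"] by (simp add: af norm_mult w_unit)
qed simp

lemma comb_w_expectation:
  assumes "snd ` set s \<subseteq> F"
  shows "(\<integral>\<omega>. comb w s \<omega> \<partial>\<Omega>) = comb (\<lambda>f _. \<kappa> f) s ()"
  using assms
proof (induction s)
  case (Cons af s)
  obtain a f where af: "af = (a, f)" by fastforce
  have f: "f \<in> F" and s: "snd ` set s \<subseteq> F" using Cons.prems af by auto
  have "integrable \<Omega> (w f)"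
    using w_measurable[OF f] by (intro integrable_const_bound[where B = 1]) (auto simp: w_unit)
  moreover have "integrable \<Omega> (comb w s)"
    using comb_w_measurable[OF s] comb_w_bound[of s]
    by (intro integrable_const_bound[where B = "\<Sum>(a, f)\<leftarrow>s. cmod a"]) auto
  ultimately show ?case using Cons.IH[OF s] w_expectation[OF f] by (simp add: af)
next
  case Nil
  have "comb w [] = (\<lambda>\<omega>. 0)" by auto
  then show ?case by simp
qed

lemma comb_w_cprod:
  assumes s: "snd ` set s \<subseteq> F" and t: "snd ` set t \<subseteq> F"
  shows "AE \<omega> in \<Omega>. comb w (cprod (\<lambda>f g x. f x + g x) s t) \<omega> = comb w s \<omega> * comb w t \<omega>"
    and "snd ` set (cprod (\<lambda>f g x. f x + g x) s t) \<subseteq> F"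
proof -
  have "AE \<omega> in \<Omega>. \<forall>f\<in>snd ` set s. \<forall>g\<in>snd ` set t. w (\<lambda>x. f x + g x) \<omega> = w f \<omega> * w g \<omega>"
    by (intro AE_finite_allI w_add subsetD[OF s] subsetD[OF t]) simp_all
  then show "AE \<omega> in \<Omega>. comb w (cprod (\<lambda>f g x. f x + g x) s t) \<omega> = comb w s \<omega> * comb w t \<omega>"
    by eventually_elim (intro comb_cprod, auto)
  show "snd ` set (cprod (\<lambda>f g x. f x + g x) s t) \<subseteq> F"
    unfolding snd_set_cprod using F_add s t by blast
qed

lemma comb_w_cconj:
  assumes s: "snd ` set s \<subseteq> F"
  shows "AE \<omega> in \<Omega>. comb w (cconj (\<lambda>f x. - f x) s) \<omega> = cnj (comb w s \<omega>)"
    and "snd ` set (cconj (\<lambda>f x. - f x) s) \<subseteq> F"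
proof -
  have "AE \<omega> in \<Omega>. \<forall>f\<in>snd ` set s. w (\<lambda>x. - f x) \<omega> = cnj (w f \<omega>)"
    by (intro AE_finite_allI w_uminus subsetD[OF s]) simp_all
  then show "AE \<omega> in \<Omega>. comb w (cconj (\<lambda>f x. - f x) s) \<omega> = cnj (comb w s \<omega>)"
    by eventually_elim (intro comb_cconj, auto)
  show "snd ` set (cconj (\<lambda>f x. - f x) s) \<subseteq> F"
    unfolding snd_set_cconj using F_uminus s by blast
qed

lemma comb_abs_power:
  assumes s: "snd ` set s \<subseteq> F"
  shows "snd ` set (abs_power s k) \<subseteq> F \<and>
    (AE \<omega> in \<Omega>. comb w (abs_power s k) \<omega> = complex_of_real (((cmod (comb w s \<omega>))\<^sup>2) ^ k))"
proof (induction k)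
  case 0
  then show ?case using F_zero w_zero by simp
next
  case (Suc k)
  let ?c = "cconj (\<lambda>f x. - f x) s"
  let ?p = "cprod (\<lambda>f g x. f x + g x)"
  note c = comb_w_cconj[OF s]
  note sc = comb_w_cprod[OF s c(2)]
  note ks = comb_w_cprod[OF conjunct1[OF Suc.IH] sc(2)]
  have "AE \<omega> in \<Omega>. comb w (abs_power s (Suc k)) \<omega> = complex_of_real (((cmod (comb w s \<omega>))\<^sup>2) ^ Suc k)"
    using ks(1) sc(1) c(1) conjunct2[OF Suc.IH]
  proof eventually_elim
    case (elim \<omega>)
    have "comb w s \<omega> * cnj (comb w s \<omega>) = complex_of_real ((cmod (comb w s \<omega>))\<^sup>2)"
      by (simp only: complex_norm_square)
    then show ?case using elim by (simp add: mult.commute)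
  qed
  then show ?case using ks(2) by simp
qed

text \<open>The right-hand side involves the mean \<open>\<kappa>\<close> but not \<open>w\<close>
  itself, so equal means force equal moments.\<close>

lemma abs_moment:
  assumes s: "snd ` set s \<subseteq> F"
  shows "complex_of_real (\<integral>\<omega>. ((cmod (comb w s \<omega>))\<^sup>2) ^ k \<partial>\<Omega>) = comb (\<lambda>f _. \<kappa> f) (abs_power s k) ()"
proof -
  note p = comb_abs_power[OF s, of k]
  have [measurable]: "comb w s \<in> borel_measurable \<Omega>" "comb w (abs_power s k) \<in> borel_measurable \<Omega>"
    using comb_w_measurable s p by auto
  have "comb (\<lambda>f _. \<kappa> f) (abs_power s k) () = (\<integral>\<omega>. comb w (abs_power s k) \<omega> \<partial>\<Omega>)"
    using comb_w_expectation p by simp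
  also have "\<dots> = (\<integral>\<omega>. complex_of_real (((cmod (comb w s \<omega>))\<^sup>2) ^ k) \<partial>\<Omega>)"
    using p by (intro integral_cong_AE) auto
  also have "\<dots> = complex_of_real (\<integral>\<omega>. ((cmod (comb w s \<omega>))\<^sup>2) ^ k \<partial>\<Omega>)"
    by (rule integral_complex_of_real)
  finally show ?thesis by simp
qed

end

text \<open>The bounded variables \<open>|comb|^2\<close> have equal moments, and
  \<open>|comb|^q\<close> is a continuous function of them, the power \<open>q / 2\<close>.\<close>

lemma random_character_norm_eq:
  assumes 1: "random_character \<Omega> F w \<kappa>" and 2: "random_character \<Omega> F w' \<kappa>"
    and s: "snd ` set s \<subseteq> F" and q: "0 < q"
  shows "(\<integral>\<^sup>+ \<omega>. ennreal (cmod (comb w s \<omega>) powr q) \<partial>\<Omega>) = (\<integral>\<^sup>+ \<omega>. ennreal (cmod (comb w' s \<omega>) powr q) \<partial>\<Omega>)"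
proof -
  interpret 1: random_character \<Omega> F w \<kappa> by fact
  interpret 2: random_character \<Omega> F w' \<kappa> by fact
  note [measurable] = "1.comb_w_measurable"[OF s] "2.comb_w_measurable"[OF s]
  define C where "C = (\<Sum>(a, f)\<leftarrow>s. cmod a)"
  define \<psi> where "\<psi> x = \<bar>x\<bar> powr (q / 2)" for x :: real
  have \<psi>: "\<psi> ((cmod z)\<^sup>2) = cmod z powr q" for z
    by (simp add: \<psi>_def powr_powr flip: powr_numeral)
  have b: "(cmod (comb w s \<omega>))\<^sup>2 \<in> {0..C\<^sup>2}" "(cmod (comb w' s \<omega>))\<^sup>2 \<in> {0..C\<^sup>2}" for \<omega>
    using "1.comb_w_bound"[of s \<omega>] "2.comb_w_bound"[of s \<omega>] by (auto simp: C_def intro!: power_mono)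
  have "(\<integral>\<omega>. \<psi> ((cmod (comb w s \<omega>))\<^sup>2) \<partial>\<Omega>) = (\<integral>\<omega>. \<psi> ((cmod (comb w' s \<omega>))\<^sup>2) \<partial>\<Omega>)"
  proof (rule "1.moments_determine"[OF _ _ _ b])
    show "(\<integral>\<omega>. ((cmod (comb w s \<omega>))\<^sup>2) ^ k \<partial>\<Omega>) = (\<integral>\<omega>. ((cmod (comb w' s \<omega>))\<^sup>2) ^ k \<partial>\<Omega>)" for k
      using "1.abs_moment"[OF s, of k] "2.abs_moment"[OF s, of k] by (metis of_real_eq_iff)
    show "continuous_on {0..C\<^sup>2} \<psi>"
      unfolding \<psi>_def using q by (intro continuous_on_powr' continuous_intros) auto
  qed (auto simp: \<psi>_def)
  then have eq: "(\<integral>\<omega>. cmod (comb w s \<omega>) powr q \<partial>\<Omega>) = (\<integral>\<omega>. cmod (comb w' s \<omega>) powr q \<partial>\<Omega>)"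
    by (simp only: \<psi>)
  have int: "integrable \<Omega> (\<lambda>\<omega>. cmod (h \<omega>) powr q)"
    if [measurable]: "h \<in> borel_measurable \<Omega>" and h: "\<And>\<omega>. cmod (h \<omega>) \<le> C" for h
    using h q by (intro "1.integrable_const_bound"[where B = "C powr q"]) (auto intro!: powr_mono2)
  show ?thesis
    using eq "1.comb_w_bound"[of s] "2.comb_w_bound"[of s]
    by (subst (1 2) nn_integral_eq_integral) (auto simp: C_def intro!: int)
qed

section \<open>Gaussian fields\<close>

text \<open>L_2 is viewed as a real Hilbert space: a covariance must be real, so the real part of
  the inner product is taken and the coefficients are real. The quadratic form is a squared norm,
  hence nonnegative.\<close>

lemma L2_gram:
  assumes D: "\<And>n. D n \<in> Lp_space M 2"
  defines "K \<equiv> \<lambda>n m. \<integral>x. Re (D n x * cnj (D m x)) \<partial>M"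
  shows "(\<Sum>n<N. \<Sum>m<N. c n * c m * K n m) = Lp_int M 2 (\<lambda>x. \<Sum>n<N. complex_of_real (c n) * D n x)"
    and "psd_kernel K"
proof -
  have [measurable]: "D n \<in> borel_measurable M" for n using D by auto
  have [measurable]: "(cnj :: complex \<Rightarrow> _) \<in> borel_measurable borel"
    by (intro borel_measurable_continuous_onI continuous_intros)
  have int: "integrable M (\<lambda>x. Re (D n x * cnj (D m x)))" for n m
  proof (rule Bochner_Integration.integrable_bound)
    show "integrable M (\<lambda>x. cmod (D n x) powr 2 + cmod (D m x) powr 2)"
      by (intro Bochner_Integration.integrable_add Lp_integrable(1) D)
    show "AE x in M. norm (Re (D n x * cnj (D m x))) \<le> norm (cmod (D n x) powr 2 + cmod (D m x) powr 2)"
    proof (rule AE_I2)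
      fix x
      have "\<bar>Re (D n x * cnj (D m x))\<bar> \<le> cmod (D n x) * cmod (D m x)"
        using abs_Re_le_cmod[of "D n x * cnj (D m x)"] by (simp add: norm_mult)
      also have "\<dots> \<le> (cmod (D n x))\<^sup>2 + (cmod (D m x))\<^sup>2"
      proof -
        have "0 \<le> cmod (D n x) * cmod (D m x)" by simp
        then show ?thesis using sum_squares_bound[of "cmod (D n x)" "cmod (D m x)"] by linarith
      qed
      finally show "norm (Re (D n x * cnj (D m x))) \<le> norm (cmod (D n x) powr 2 + cmod (D m x) powr 2)"
        by simp
    qed
  qed measurable
  have gram: "(\<Sum>n<N. \<Sum>m<N. c n * c m * K n m) = Lp_int M 2 (\<lambda>x. \<Sum>n<N. complex_of_real (c n) * D n x)" for N c
  proof -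
    let ?z = "\<lambda>x. \<Sum>n<N. complex_of_real (c n) * D n x"
    have z: "?z \<in> Lp_space M 2"
      by (intro Lp_space_sum Lp_space_scale(1) D) simp
    have "cmod (?z x) powr 2 = (\<Sum>n<N. \<Sum>m<N. c n * c m * Re (D n x * cnj (D m x)))" for x
    proof -
      have sq: "cmod w powr 2 = Re (w * cnj w)" for w
        using cmod_power2[of w] by (simp add: power2_eq_square)
      have "cmod (?z x) powr 2 = Re (?z x * cnj (?z x))" by (rule sq)
      also have "?z x * cnj (?z x) = (\<Sum>n<N. \<Sum>m<N. complex_of_real (c n * c m) * (D n x * cnj (D m x)))"
        by (simp add: sum_product mult_ac)
      also have "Re \<dots> = (\<Sum>n<N. \<Sum>m<N. c n * c m * Re (D n x * cnj (D m x)))"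
        unfolding Re_sum by (intro sum.cong refl) (simp add: algebra_simps)
      finally show ?thesis .
    qed
    then have "Lp_int M 2 ?z = (\<integral>x. (\<Sum>n<N. \<Sum>m<N. c n * c m * Re (D n x * cnj (D m x))) \<partial>M)"
      using Lp_integrable(2)[OF z] by simp
    also have "\<dots> = (\<Sum>n<N. \<integral>x. (\<Sum>m<N. c n * c m * Re (D n x * cnj (D m x))) \<partial>M)"
      by (rule Bochner_Integration.integral_sum) (intro Bochner_Integration.integrable_sum integrable_mult_right int)
    also have "\<dots> = (\<Sum>n<N. \<Sum>m<N. \<integral>x. c n * c m * Re (D n x * cnj (D m x)) \<partial>M)"
      by (intro sum.cong refl Bochner_Integration.integral_sum integrable_mult_right int)
    also have "\<dots> = (\<Sum>n<N. \<Sum>m<N. c n * c m * K n m)"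
      by (simp only: K_def integral_mult_right_zero)
    finally show ?thesis by simp
  qed
  show "(\<Sum>n<N. \<Sum>m<N. c n * c m * K n m) = Lp_int M 2 (\<lambda>x. \<Sum>n<N. complex_of_real (c n) * D n x)"
    by (rule gram)
  have "K n m = K m n" for n m
    unfolding K_def by (simp add: algebra_simps)
  then show "psd_kernel K"
    unfolding psd_kernel_def gram by simp
qed

lemma sum_of_bool_select:
  fixes G :: "nat \<Rightarrow> 'b::semiring_1"
  shows "a < N \<Longrightarrow> (\<Sum>n<N. of_bool (n = a) * G n) = G a"
proof -
  assume a: "a < N"
  have "(\<Sum>n<N. of_bool (n = a) * G n) = (\<Sum>n<N. if n = a then G a else 0)" by (intro sum.cong) auto
  then show ?thesis using a by simp
qed

text \<open>The isonormal Gaussian process of L_2(M), an additive isometry up to null sets. It is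
  given on the \<open>D n\<close> by their Gram kernel and extended by density; linear dependences
  among the \<open>D n\<close> are harmless because the kernel need only be semidefinite.\<close>

lemma gaussian_field:
  fixes M :: "'a measure" and D :: "nat \<Rightarrow> 'a \<Rightarrow> complex"
  assumes D: "\<And>n. D n \<in> Lp_space M 2"
    and D_dense: "\<And>f e. f \<in> Lp_space M 2 \<Longrightarrow> 0 < e \<Longrightarrow> \<exists>n. Lp_int M 2 (\<lambda>x. D n x - f x) < e"
  obtains \<gamma> :: "('a \<Rightarrow> complex) \<Rightarrow> (nat \<Rightarrow> real) \<Rightarrow> real" where
    "\<And>f. f \<in> Lp_space M 2 \<Longrightarrow> \<gamma> f \<in> borel_measurable gauss_space"
    "\<And>f g. f \<in> Lp_space M 2 \<Longrightarrow> g \<in> Lp_space M 2 \<Longrightarrow>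
       (\<integral>\<^sup>+ \<omega>. ennreal (\<bar>\<gamma> f \<omega> - \<gamma> g \<omega>\<bar> powr 2) \<partial>gauss_space) = ennreal (Lp_int M 2 (\<lambda>x. f x - g x))"
    "\<And>f g. f \<in> Lp_space M 2 \<Longrightarrow> g \<in> Lp_space M 2 \<Longrightarrow> AE \<omega> in gauss_space. \<gamma> (\<lambda>x. f x + g x) \<omega> = \<gamma> f \<omega> + \<gamma> g \<omega>"
    "\<And>f t. f \<in> Lp_space M 2 \<Longrightarrow> (\<integral>\<omega>. cis (t * \<gamma> f \<omega>) \<partial>gauss_space) = complex_of_real (exp (- (t\<^sup>2 * Lp_int M 2 f) / 2))"
proof -
  let ?\<Omega> = gauss_space
  have two: "(0::real) < 2" by simp
  note Df = Lp_space_diff[OF two]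
  define K where "K n m = (\<integral>x. Re (D n x * cnj (D m x)) \<partial>M)" for n m :: nat
  have K: "(\<Sum>n<N. \<Sum>m<N. c n * c m * K n m) = Lp_int M 2 (\<lambda>x. \<Sum>n<N. complex_of_real (c n) * D n x)" "psd_kernel K" for N c
    using L2_gram[OF D] unfolding K_def by auto
  obtain X where Xm[measurable]: "\<And>n. X n \<in> borel_measurable ?\<Omega>"
    and Xi: "\<And>N c. integrable ?\<Omega> (\<lambda>\<omega>. (\<Sum>n<N. c n * X n \<omega>)\<^sup>2)"
    and X2': "\<And>N c. (\<integral>\<omega>. (\<Sum>n<N. c n * X n \<omega>)\<^sup>2 \<partial>?\<Omega>) = (\<Sum>n<N. \<Sum>m<N. c n * c m * K n m)"
    and Xc': "\<And>N c. (\<integral>\<omega>. cis (\<Sum>n<N. c n * X n \<omega>) \<partial>?\<Omega>)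
       = complex_of_real (exp (- (\<Sum>n<N. \<Sum>m<N. c n * c m * K n m) / 2))"
    by (rule gaussian_sequence[OF K(2)]) (rule that)
  note X2 = X2'[unfolded K(1)] and Xc = Xc'[unfolded K(1)]
  have ofb: "complex_of_real (of_bool b) = of_bool b" for b by (cases b) auto
  \<comment> \<open>The L_2 lemmas are about complex functions, so the real variables are
    embedded.\<close>
  define Z where "Z n \<omega> = complex_of_real (X n \<omega>)" for n \<omega>
  have Zm[measurable]: "Z n \<in> borel_measurable ?\<Omega>" for n unfolding Z_def by measurable
  have Zcomb: "(\<lambda>\<omega>. complex_of_real (\<Sum>n<N. c n * X n \<omega>)) \<in> Lp_space ?\<Omega> 2"
    "Lp_int ?\<Omega> 2 (\<lambda>\<omega>. complex_of_real (\<Sum>n<N. c n * X n \<omega>)) = Lp_int M 2 (\<lambda>x. \<Sum>n<N. complex_of_real (c n) * D n x)" for N c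
  proof -
    have nn: "(\<integral>\<^sup>+ \<omega>. ennreal (cmod (complex_of_real (\<Sum>n<N. c n * X n \<omega>)) powr 2) \<partial>?\<Omega>)
       = ennreal (Lp_int M 2 (\<lambda>x. \<Sum>n<N. complex_of_real (c n) * D n x))"
      unfolding X2[symmetric] by (subst nn_integral_eq_integral[symmetric, OF Xi]) (auto simp del: of_real_sum)
    then show "(\<lambda>\<omega>. complex_of_real (\<Sum>n<N. c n * X n \<omega>)) \<in> Lp_space ?\<Omega> 2"
      by (intro Lp_spaceI) (auto simp del: of_real_sum)
    show "Lp_int ?\<Omega> 2 (\<lambda>\<omega>. complex_of_real (\<Sum>n<N. c n * X n \<omega>)) = Lp_int M 2 (\<lambda>x. \<Sum>n<N. complex_of_real (c n) * D n x)"
      unfolding Lp_int_def[of ?\<Omega>] nn by simp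
  qed
  have Z_Lp: "Z a \<in> Lp_space ?\<Omega> 2" for a
    using Zcomb(1)[where N = "Suc a" and c = "\<lambda>n. of_bool (n = a)"] unfolding sum_of_bool_select[OF lessI]
    by (simp add: Z_def[abs_def])
  have Z_dist: "Lp_int ?\<Omega> 2 (\<lambda>\<omega>. Z a \<omega> - Z b \<omega>) = Lp_int M 2 (\<lambda>x. D a x - D b x)" for a b
  proof -
    define N where "N = Suc (max a b)"
    have N: "a < N" "b < N" by (auto simp: N_def)
    let ?c = "\<lambda>n. of_bool (n = a) - of_bool (n = b) :: real"
    have "(\<Sum>n<N. ?c n * X n \<omega>) = X a \<omega> - X b \<omega>" for \<omega>
      using N by (simp add: left_diff_distrib sum_subtractf sum_of_bool_select)
    moreover have "(\<Sum>n<N. complex_of_real (?c n) * D n x) = D a x - D b x" for x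
      using N by (simp add: ofb left_diff_distrib sum_subtractf sum_of_bool_select)
    ultimately show ?thesis using Zcomb(2)[where c = ?c and N = N] by (simp add: Z_def)
  qed
  have Z_add: "Lp_int ?\<Omega> 2 (\<lambda>\<omega>. Z a \<omega> - Z b \<omega> - Z d \<omega>) = Lp_int M 2 (\<lambda>x. D a x - D b x - D d x)" for a b d
  proof -
    define N where "N = Suc (max a (max b d))"
    have N: "a < N" "b < N" "d < N" by (auto simp: N_def)
    let ?c = "\<lambda>n. of_bool (n = a) - of_bool (n = b) - of_bool (n = d) :: real"
    have "(\<Sum>n<N. ?c n * X n \<omega>) = X a \<omega> - X b \<omega> - X d \<omega>" for \<omega>
      using N by (simp add: left_diff_distrib sum_subtractf sum_of_bool_select)
    moreover have "(\<Sum>n<N. complex_of_real (?c n) * D n x) = D a x - D b x - D d x" for x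
      using N by (simp add: ofb left_diff_distrib sum_subtractf sum_of_bool_select)
    ultimately show ?thesis using Zcomb(2)[where c = ?c and N = N] by (simp add: Z_def)
  qed
  have Z_char: "(\<integral>\<omega>. cis (t * X a \<omega>) \<partial>?\<Omega>) = complex_of_real (exp (- (t\<^sup>2 * Lp_int M 2 (D a)) / 2))" for t a
  proof -
    let ?c = "\<lambda>n. t * of_bool (n = a)"
    have "(\<Sum>n<Suc a. ?c n * X n \<omega>) = t * X a \<omega>" for \<omega>
      by (simp only: mult.assoc sum_distrib_left[symmetric] sum_of_bool_select[OF lessI])
    moreover have "(\<Sum>n<Suc a. complex_of_real (?c n) * D n x) = complex_of_real t * D a x" for x
      by (simp only: mult.assoc sum_distrib_left[symmetric] of_real_mult ofb sum_of_bool_select[OF lessI])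
    moreover have "Lp_int M 2 (\<lambda>x. complex_of_real t * D a x) = t\<^sup>2 * Lp_int M 2 (D a)"
      using Lp_space_scale(2)[OF D, of "complex_of_real t" a] by simp
    ultimately show ?thesis using Xc[where c = ?c and N = "Suc a"] by simp
  qed
  define H where "H f = (SOME H. H \<in> Lp_space ?\<Omega> 2 \<and> (\<forall>n. Lp_int ?\<Omega> 2 (\<lambda>\<omega>. Z n \<omega> - H \<omega>) = Lp_int M 2 (\<lambda>x. D n x - f x)))" for f
  have H: "H f \<in> Lp_space ?\<Omega> 2" "Lp_int ?\<Omega> 2 (\<lambda>\<omega>. Z n \<omega> - H f \<omega>) = Lp_int M 2 (\<lambda>x. D n x - f x)"
    if f: "f \<in> Lp_space M 2" for f n
  proof -
    have "\<exists>H\<in>Lp_space ?\<Omega> 2. \<forall>n\<in>UNIV. Lp_int ?\<Omega> 2 (\<lambda>\<omega>. Z n \<omega> - H \<omega>) = Lp_int M 2 (\<lambda>x. D n x - f x)"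
      using D_dense[OF f] by (intro Lp_equidistant_extension two D Z_Lp Z_dist f) auto
    then have "\<exists>H. H \<in> Lp_space ?\<Omega> 2 \<and> (\<forall>n. Lp_int ?\<Omega> 2 (\<lambda>\<omega>. Z n \<omega> - H \<omega>) = Lp_int M 2 (\<lambda>x. D n x - f x))"
      by blast
    from someI_ex[OF this] show "H f \<in> Lp_space ?\<Omega> 2" "Lp_int ?\<Omega> 2 (\<lambda>\<omega>. Z n \<omega> - H f \<omega>) = Lp_int M 2 (\<lambda>x. D n x - f x)"
      unfolding H_def by auto
  qed
  have seq: "\<exists>k. (\<lambda>n::nat. Lp_int M 2 (\<lambda>x. D (k n) x - f x)) \<longlonglongrightarrow> 0" if f: "f \<in> Lp_space M 2" for f
  proof -
    obtain k where "(\<lambda>n. Lp_int M 2 (\<lambda>x. D (k n) x - f x)) \<longlonglongrightarrow> 0"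
      using null_sequence_exists[of UNIV "\<lambda>n. Lp_int M 2 (\<lambda>x. D n x - f x)"] D_dense[OF f] by auto
    then show ?thesis by blast
  qed
  \<comment> \<open>\<open>H f\<close> is a limit of real functions, so passing to the real part
    changes it on a null set only, as \<open>\<Gamma>_H\<close> confirms.\<close>
  define \<gamma> where "\<gamma> f \<omega> = Re (H f \<omega>)" for f \<omega>
  define \<Gamma> where "\<Gamma> f \<omega> = complex_of_real (\<gamma> f \<omega>)" for f \<omega>
  have \<gamma>m: "\<gamma> f \<in> borel_measurable ?\<Omega>" if "f \<in> Lp_space M 2" for f
    unfolding \<gamma>_def using Lp_space_measurable[OF H(1)[OF that]] by measurable
  have \<Gamma>_H: "AE \<omega> in ?\<Omega>. H f \<omega> = \<Gamma> f \<omega>" if f: "f \<in> Lp_space M 2" for f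
  proof -
    have [measurable]: "H f \<in> borel_measurable ?\<Omega>" "\<gamma> f \<in> borel_measurable ?\<Omega>"
      using H(1)[OF f] \<gamma>m[OF f] by auto
    obtain k where k: "(\<lambda>n. Lp_int M 2 (\<lambda>x. D (k n) x - f x)) \<longlonglongrightarrow> 0" using seq[OF f] by blast
    let ?h = "\<lambda>\<omega>. H f \<omega> - \<Gamma> f \<omega>"
    have hb: "cmod (?h \<omega>) powr 2 \<le> cmod (Z n \<omega> - H f \<omega>) powr 2" for n \<omega>
    proof -
      have "?h \<omega> = \<i> * complex_of_real (Im (H f \<omega>))" by (simp add: complex_eq_iff \<Gamma>_def \<gamma>_def)
      then have "cmod (?h \<omega>) = \<bar>Im (Z n \<omega> - H f \<omega>)\<bar>" by (simp add: norm_mult Z_def)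
      then show ?thesis using abs_Im_le_cmod[of "Z n \<omega> - H f \<omega>"] by (intro powr_mono2) auto
    qed
    have hm: "?h \<in> borel_measurable ?\<Omega>" unfolding \<Gamma>_def by measurable
    have h: "?h \<in> Lp_space ?\<Omega> 2" "Lp_int ?\<Omega> 2 ?h \<le> Lp_int M 2 (\<lambda>x. D n x - f x)" for n
      using Lp_space_bound[OF Df[OF Z_Lp[of n] H(1)[OF f]] hm] hb[of _ n] H(2)[OF f, of n] by auto
    have "Lp_int ?\<Omega> 2 ?h \<le> 0"
      using h(2) by (intro tendsto_lowerbound[OF k]) auto
    then have "Lp_int ?\<Omega> 2 ?h = 0" using Lp_int_nonneg by (rule antisym)
    then show ?thesis using Lp_int_eq_0_iff[OF h(1)] by simp
  qed
  have \<Gamma>_Lp: "\<Gamma> f \<in> Lp_space ?\<Omega> 2" if f: "f \<in> Lp_space M 2" for f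
  proof (rule Lp_space_bound(1)[OF H(1)[OF f]])
    show "\<Gamma> f \<in> borel_measurable ?\<Omega>" unfolding \<Gamma>_def using \<gamma>m[OF f] by measurable
    show "AE \<omega> in ?\<Omega>. cmod (\<Gamma> f \<omega>) powr 2 \<le> cmod (H f \<omega>) powr 2"
      using \<Gamma>_H[OF f] by eventually_elim simp
  qed
  have \<Gamma>_Z: "Lp_int ?\<Omega> 2 (\<lambda>\<omega>. Z n \<omega> - \<Gamma> f \<omega>) = Lp_int M 2 (\<lambda>x. D n x - f x)" if f: "f \<in> Lp_space M 2" for f n
    unfolding H(2)[OF f, symmetric]
    by (rule Lp_int_cong_AE) (use \<Gamma>_H[OF f] in \<open>eventually_elim, simp\<close>)
  have \<Gamma>_dist: "Lp_int ?\<Omega> 2 (\<lambda>\<omega>. \<Gamma> f \<omega> - \<Gamma> g \<omega>) = Lp_int M 2 (\<lambda>x. f x - g x)"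
    if f: "f \<in> Lp_space M 2" and g: "g \<in> Lp_space M 2" for f g
  proof (rule Lp_equidistant_limits[of 2 2 UNIV D M Z ?\<Omega>])
    show "\<exists>i\<in>UNIV. Lp_int M 2 (\<lambda>x. D i x - f x) < e" if "0 < e" for e
      using D_dense[OF f that] by simp
  qed (simp_all add: D Z_Lp f g \<Gamma>_Lp \<Gamma>_Z)
  show ?thesis
  proof
    show "\<gamma> f \<in> borel_measurable ?\<Omega>" if "f \<in> Lp_space M 2" for f by (rule \<gamma>m[OF that])
    show "(\<integral>\<^sup>+ \<omega>. ennreal (\<bar>\<gamma> f \<omega> - \<gamma> g \<omega>\<bar> powr 2) \<partial>?\<Omega>) = ennreal (Lp_int M 2 (\<lambda>x. f x - g x))"
      if f: "f \<in> Lp_space M 2" and g: "g \<in> Lp_space M 2" for f g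
    proof -
      have "cmod (\<Gamma> f \<omega> - \<Gamma> g \<omega>) = \<bar>\<gamma> f \<omega> - \<gamma> g \<omega>\<bar>" for \<omega>
        unfolding \<Gamma>_def of_real_diff[symmetric] norm_of_real ..
      then show ?thesis
        using Lp_int_eq_nn_integral[OF Df[OF \<Gamma>_Lp[OF f] \<Gamma>_Lp[OF g]]] \<Gamma>_dist[OF f g] by simp
    qed
    show "AE \<omega> in ?\<Omega>. \<gamma> (\<lambda>x. f x + g x) \<omega> = \<gamma> f \<omega> + \<gamma> g \<omega>"
      if f: "f \<in> Lp_space M 2" and g: "g \<in> Lp_space M 2" for f g
    proof -
      let ?fg = "\<lambda>x. f x + g x"
      have fg: "?fg \<in> Lp_space M 2" by (intro Lp_space_add two f g)
      obtain a where a: "(\<lambda>n. Lp_int M 2 (\<lambda>x. D (a n) x - ?fg x)) \<longlonglongrightarrow> 0" using seq[OF fg] by blast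
      obtain b where b: "(\<lambda>n. Lp_int M 2 (\<lambda>x. D (b n) x - f x)) \<longlonglongrightarrow> 0" using seq[OF f] by blast
      obtain d where d: "(\<lambda>n. Lp_int M 2 (\<lambda>x. D (d n) x - g x)) \<longlonglongrightarrow> 0" using seq[OF g] by blast
      \<comment> \<open>\<open>D\<close> need not be closed under addition, but
        \<open>D (a n) - D (b n) - D (d n)\<close> tends to 0, and \<open>Z_add\<close> transfers
        this to the Gaussian side.\<close>
      have "(\<lambda>n. Lp_int M 2 (\<lambda>x. (D (a n) x - ?fg x) + ((-1) * (D (b n) x - f x) + (-1) * (D (d n) x - g x)))) \<longlonglongrightarrow> 0"
        by (intro Lp_null_add Lp_null_scale a b d two Df D fg f g Lp_space_add Lp_space_scale(1))
      then have s1: "(\<lambda>n. Lp_int ?\<Omega> 2 (\<lambda>\<omega>. Z (a n) \<omega> - Z (b n) \<omega> - Z (d n) \<omega>)) \<longlonglongrightarrow> 0"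
        unfolding Z_add by (simp add: algebra_simps)
      have s2: "(\<lambda>n. Lp_int ?\<Omega> 2 (\<lambda>\<omega>. (-1) * (Z (a n) \<omega> - \<Gamma> ?fg \<omega>) + ((Z (b n) \<omega> - \<Gamma> f \<omega>) + (Z (d n) \<omega> - \<Gamma> g \<omega>)))) \<longlonglongrightarrow> 0"
        using a b d unfolding \<Gamma>_Z[OF f, symmetric] \<Gamma>_Z[OF g, symmetric] \<Gamma>_Z[OF fg, symmetric]
        by (intro Lp_null_add Lp_null_scale two Df Z_Lp \<Gamma>_Lp fg f g Lp_space_add Lp_space_scale(1))
      have "(\<lambda>n. Lp_int ?\<Omega> 2 (\<lambda>\<omega>. (Z (a n) \<omega> - Z (b n) \<omega> - Z (d n) \<omega>) +
          ((-1) * (Z (a n) \<omega> - \<Gamma> ?fg \<omega>) + ((Z (b n) \<omega> - \<Gamma> f \<omega>) + (Z (d n) \<omega> - \<Gamma> g \<omega>))))) \<longlonglongrightarrow> 0"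
        by (rule Lp_null_add[OF two _ _ s1 s2]) (intro two Df Z_Lp \<Gamma>_Lp fg f g Lp_space_add Lp_space_scale(1))+
      then have "Lp_int ?\<Omega> 2 (\<lambda>\<omega>. \<Gamma> ?fg \<omega> - (\<Gamma> f \<omega> + \<Gamma> g \<omega>)) = 0"
        by (simp add: algebra_simps LIMSEQ_const_iff)
      moreover have "(\<lambda>\<omega>. \<Gamma> ?fg \<omega> - (\<Gamma> f \<omega> + \<Gamma> g \<omega>)) \<in> Lp_space ?\<Omega> 2"
        by (intro Df Lp_space_add two \<Gamma>_Lp f g fg)
      ultimately have "AE \<omega> in ?\<Omega>. \<Gamma> ?fg \<omega> - (\<Gamma> f \<omega> + \<Gamma> g \<omega>) = 0"
        using Lp_int_eq_0_iff by blast
      then show ?thesis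
      proof eventually_elim
        case (elim \<omega>)
        then have "complex_of_real (\<gamma> ?fg \<omega>) = complex_of_real (\<gamma> f \<omega> + \<gamma> g \<omega>)" by (simp add: \<Gamma>_def)
        then show ?case by (simp only: of_real_eq_iff)
      qed
    qed
    show "(\<integral>\<omega>. cis (t * \<gamma> f \<omega>) \<partial>?\<Omega>) = complex_of_real (exp (- (t\<^sup>2 * Lp_int M 2 f) / 2))"
      if f: "f \<in> Lp_space M 2" for f t
    proof -
      note [measurable] = \<gamma>m[OF f]
      obtain k where k: "(\<lambda>n. Lp_int M 2 (\<lambda>x. D (k n) x - f x)) \<longlonglongrightarrow> 0" using seq[OF f] by blast
      have ic: "integrable ?\<Omega> (\<lambda>\<omega>. cis (h \<omega>))" if [measurable]: "h \<in> borel_measurable ?\<Omega>" for h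
        by (intro gauss_space.integrable_const_bound[where B = 1]) auto
      have bound: "cmod ((\<integral>\<omega>. cis (t * X n \<omega>) \<partial>?\<Omega>) - (\<integral>\<omega>. cis (t * \<gamma> f \<omega>) \<partial>?\<Omega>))
          \<le> \<bar>t\<bar> * (e + Lp_int M 2 (\<lambda>x. D n x - f x) / e)" if e: "0 < e" for e n
      proof -
        have L: "(\<lambda>\<omega>. Z n \<omega> - \<Gamma> f \<omega>) \<in> Lp_space ?\<Omega> 2" by (intro Df Z_Lp \<Gamma>_Lp f)
        have cm: "cmod (Z n \<omega> - \<Gamma> f \<omega>) = \<bar>X n \<omega> - \<gamma> f \<omega>\<bar>" for \<omega>
          unfolding Z_def \<Gamma>_def of_real_diff[symmetric] norm_of_real ..
        have "cmod ((\<integral>\<omega>. cis (t * X n \<omega>) \<partial>?\<Omega>) - (\<integral>\<omega>. cis (t * \<gamma> f \<omega>) \<partial>?\<Omega>))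
            = cmod (\<integral>\<omega>. cis (t * X n \<omega>) - cis (t * \<gamma> f \<omega>) \<partial>?\<Omega>)"
          by (subst Bochner_Integration.integral_diff) (auto intro!: ic)
        also have "\<dots> \<le> (\<integral>\<omega>. cmod (cis (t * X n \<omega>) - cis (t * \<gamma> f \<omega>)) \<partial>?\<Omega>)"
          by (rule integral_norm_bound)
        also have "\<dots> \<le> (\<integral>\<omega>. \<bar>t\<bar> * (e + cmod (Z n \<omega> - \<Gamma> f \<omega>) powr 2 / e) \<partial>?\<Omega>)"
        proof (rule integral_mono)
          show "integrable ?\<Omega> (\<lambda>\<omega>. cmod (cis (t * X n \<omega>) - cis (t * \<gamma> f \<omega>)))"
            by (intro integrable_norm Bochner_Integration.integrable_diff ic) auto
          show "integrable ?\<Omega> (\<lambda>\<omega>. \<bar>t\<bar> * (e + cmod (Z n \<omega> - \<Gamma> f \<omega>) powr 2 / e))"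
            using Lp_integrable(1)[OF L] by auto
          fix \<omega>
          define y where "y = X n \<omega> - \<gamma> f \<omega>"
          have "cis (t * X n \<omega>) - cis (t * \<gamma> f \<omega>) = cis (t * \<gamma> f \<omega>) * (cis (t * y) - 1)"
            by (simp add: y_def right_diff_distrib cis_mult)
          then have "cmod (cis (t * X n \<omega>) - cis (t * \<gamma> f \<omega>)) \<le> \<bar>t\<bar> * \<bar>y\<bar>"
            using cmod_cis_minus_one_le(1)[of "t * y"] by (simp add: norm_mult abs_mult)
          \<comment> \<open>A substitute for the Cauchy-Schwarz inequality: the first moment is at
            most \<open>e\<close> plus the second moment divided by \<open>e\<close>.\<close>
          also have "\<bar>y\<bar> \<le> e + \<bar>y\<bar> powr 2 / e"
          proof (cases "\<bar>y\<bar> \<le> e")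
            case False
            then have "\<bar>y\<bar> * e \<le> \<bar>y\<bar> * \<bar>y\<bar>" by (intro mult_left_mono) auto
            then have "\<bar>y\<bar> \<le> \<bar>y\<bar> powr 2 / e" using e by (simp add: field_simps power2_eq_square)
            then show ?thesis using e by simp
          qed (use e in \<open>simp add: add_increasing2\<close>)
          finally show "cmod (cis (t * X n \<omega>) - cis (t * \<gamma> f \<omega>)) \<le> \<bar>t\<bar> * (e + cmod (Z n \<omega> - \<Gamma> f \<omega>) powr 2 / e)"
            unfolding cm y_def by (simp add: mult_left_mono)
        qed
        also have "\<dots> = \<bar>t\<bar> * (e + Lp_int M 2 (\<lambda>x. D n x - f x) / e)"
          using Lp_integrable[OF L] \<Gamma>_Z[OF f, of n] by (simp add: gauss_space.prob_space)
        finally show ?thesis .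
      qed
      have "(\<lambda>n. \<integral>\<omega>. cis (t * X (k n) \<omega>) \<partial>?\<Omega>) \<longlonglongrightarrow> (\<integral>\<omega>. cis (t * \<gamma> f \<omega>) \<partial>?\<Omega>)"
      proof (rule LIMSEQ_I)
        fix r :: real assume r: "0 < r"
        \<comment> \<open>Once the second moment is below \<open>e * e\<close>, the bound is at most
          \<open>2 * \<bar>t\<bar> * e\<close>, which equals \<open>r - 2 * e\<close>.\<close>
        define e where "e = r / (2 * (\<bar>t\<bar> + 1))"
        have e: "0 < e" "2 * (\<bar>t\<bar> + 1) * e = r" using r by (auto simp: e_def)
        have "\<forall>\<^sub>F n in sequentially. Lp_int M 2 (\<lambda>x. D (k n) x - f x) < e * e"
          using e by (intro order_tendstoD(2)[OF k]) simp
        then obtain n0 where n0: "\<And>n. n \<ge> n0 \<Longrightarrow> Lp_int M 2 (\<lambda>x. D (k n) x - f x) < e * e"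
          by (auto simp: eventually_sequentially)
        have "cmod ((\<integral>\<omega>. cis (t * X (k n) \<omega>) \<partial>?\<Omega>) - (\<integral>\<omega>. cis (t * \<gamma> f \<omega>) \<partial>?\<Omega>)) < r" if "n \<ge> n0" for n
        proof -
          have "Lp_int M 2 (\<lambda>x. D (k n) x - f x) / e \<le> e" using n0[OF that] e by (simp add: field_simps)
          then have "\<bar>t\<bar> * (e + Lp_int M 2 (\<lambda>x. D (k n) x - f x) / e) \<le> \<bar>t\<bar> * (e + e)"
            by (intro mult_left_mono) auto
          also have "\<dots> < r"
          proof -
            have "\<bar>t\<bar> * (e + e) = r - 2 * e" unfolding e(2)[symmetric] by (simp add: algebra_simps)
            then show ?thesis using e(1) by linarith
          qed
          finally show ?thesis using bound[OF e(1), of "k n"] by linarith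
        qed
        then show "\<exists>no. \<forall>n\<ge>no. norm ((\<integral>\<omega>. cis (t * X (k n) \<omega>) \<partial>?\<Omega>) - (\<integral>\<omega>. cis (t * \<gamma> f \<omega>) \<partial>?\<Omega>)) < r" by blast
      qed
      moreover have "(\<lambda>n. complex_of_real (exp (- (t\<^sup>2 * Lp_int M 2 (D (k n))) / 2))) \<longlonglongrightarrow> complex_of_real (exp (- (t\<^sup>2 * Lp_int M 2 f) / 2))"
        by (intro tendsto_intros Lp_int_tendsto[OF two D f k]) auto
      ultimately show ?thesis unfolding Z_char using LIMSEQ_unique by blast
    qed
  qed
qed

section \<open>Existence of embeddings\<close>

text \<open>Two integrations produce the distance: over \<open>t\<close>, the q-th power of a
  difference of phases becomes \<open>|\<gamma> f - \<gamma> g|^2\<close>, and the Gaussian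
  expectation turns this into the squared distance of \<open>f\<close> and \<open>g\<close>.\<close>

lemma L2_embedding:
  fixes M :: "'a::polish_space measure"
  assumes M: "standard_measure_space M" and q: "2 < q"
  shows "\<exists>(N :: real measure) E. standard_measure_space N \<and> Lp_embedding M 2 N q E"
proof -
  obtain D :: "nat \<Rightarrow> 'a \<Rightarrow> complex" where D: "\<And>n. D n \<in> Lp_space M 2"
    "\<And>f e. f \<in> Lp_space M 2 \<Longrightarrow> 0 < e \<Longrightarrow> \<exists>n. Lp_int M 2 (\<lambda>x. D n x - f x) < e"
    using Lp_separable[OF M, of 2] by auto
  obtain \<gamma> :: "('a \<Rightarrow> complex) \<Rightarrow> (nat \<Rightarrow> real) \<Rightarrow> real" where
    \<gamma>_m: "\<And>f. f \<in> Lp_space M 2 \<Longrightarrow> \<gamma> f \<in> borel_measurable gauss_space" and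
    \<gamma>_dist: "\<And>f g. f \<in> Lp_space M 2 \<Longrightarrow> g \<in> Lp_space M 2 \<Longrightarrow>
       (\<integral>\<^sup>+ \<omega>. ennreal (\<bar>\<gamma> f \<omega> - \<gamma> g \<omega>\<bar> powr 2) \<partial>gauss_space) = ennreal (Lp_int M 2 (\<lambda>x. f x - g x))" and
    \<gamma>_add: "\<And>f g. f \<in> Lp_space M 2 \<Longrightarrow> g \<in> Lp_space M 2 \<Longrightarrow> AE \<omega> in gauss_space. \<gamma> (\<lambda>x. f x + g x) \<omega> = \<gamma> f \<omega> + \<gamma> g \<omega>" and
    \<gamma>_char: "\<And>f t. f \<in> Lp_space M 2 \<Longrightarrow> (\<integral>\<omega>. cis (t * \<gamma> f \<omega>) \<partial>gauss_space) = complex_of_real (exp (- (t\<^sup>2 * Lp_int M 2 f) / 2))"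
  proof (rule gaussian_field[of D M])
    show "D n \<in> Lp_space M 2" for n by (rule D(1))
    show "\<exists>n. Lp_int M 2 (\<lambda>x. D n x - f x) < e" if "f \<in> Lp_space M 2" "0 < e" for f e
      by (rule D(2)[OF that])
  qed (rule that)
  \<comment> \<open>Normalises the radial measure, so that the integral over \<open>t\<close> is
    exactly the square.\<close>
  define k where "k = enn2real (phase_const q 1 2)"
  have k: "ennreal k = phase_const q 1 2" "0 < k"
  proof -
    show *: "ennreal k = phase_const q 1 2" using phase_const_finite[of 2 q 1] q by (simp add: k_def)
    have "k \<noteq> 0" using * phase_const_pos[of 1 q 2] by (metis ennreal_0 less_irrefl zero_less_one)
    then show "0 < k" by (simp add: k_def less_le)
  qed
  define R where "R = radial (1 / k) 2"
  have [simp, measurable_cong]: "sets R = sets borel" by (simp add: R_def)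
  interpret R: sigma_finite_measure R unfolding R_def by (rule sigma_finite_radial)
  interpret Y: pair_sigma_finite gauss_space R ..
  have const: "phase_const q (1 / k) 2 = 1"
    using k(2) phase_const_scale[of "1 / k" q 2] by (simp flip: k(1) ennreal_mult)
  let ?Y = "gauss_space \<Otimes>\<^sub>M R"
  define u where "u f y = cis (snd y * \<gamma> f (fst y))" for f and y :: "(nat \<Rightarrow> real) \<times> real"
  have u_m: "u f \<in> borel_measurable ?Y" if f: "f \<in> Lp_space M 2" for f
    unfolding u_def using \<gamma>_m[OF f] by measurable
  have comb_u: "comb u (map (apsnd A) s) (\<omega>, t) = comb (\<lambda>f \<omega>. cis (t * \<gamma> (A f) \<omega>)) s \<omega>" for A s \<omega> t
    by (induction s) (auto simp: u_def)
  have "Lp_phase M 2 ?Y q u D"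
  proof
    show "(0::real) < 2" "0 < q" using q by auto
    show "u f \<in> borel_measurable ?Y" if "f \<in> Lp_space M 2" for f by (rule u_m[OF that])
    show "cmod (u f y) = 1" for f y by (simp add: u_def)
    show "D n \<in> Lp_space M 2" for n by (rule D)
    show "\<exists>n. Lp_int M 2 (\<lambda>x. D n x - f x) < e" if "f \<in> Lp_space M 2" "0 < e" for f e by (rule D(2)[OF that])
    fix f g assume f: "f \<in> Lp_space M 2" and g: "g \<in> Lp_space M 2"
    note [measurable] = u_m[OF f] u_m[OF g]
    have *: "cmod (u f (\<omega>, t) - u g (\<omega>, t)) = cmod (cis (t * (\<gamma> f \<omega> - \<gamma> g \<omega>)) - 1)" for \<omega> t
    proof -
      have "u f (\<omega>, t) - u g (\<omega>, t) = u g (\<omega>, t) * (cis (t * (\<gamma> f \<omega> - \<gamma> g \<omega>)) - 1)"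
        by (simp add: u_def right_diff_distrib cis_mult)
      then show ?thesis by (simp add: norm_mult u_def)
    qed
    have "(\<integral>\<^sup>+ y. ennreal (cmod (u f y - u g y) powr q) \<partial>?Y)
        = (\<integral>\<^sup>+ \<omega>. (\<integral>\<^sup>+ t. ennreal (cmod (u f (\<omega>, t) - u g (\<omega>, t)) powr q) \<partial>R) \<partial>gauss_space)"
      by (rule R.nn_integral_fst[symmetric]) measurable
    also have "\<dots> = (\<integral>\<^sup>+ \<omega>. ennreal (\<bar>\<gamma> f \<omega> - \<gamma> g \<omega>\<bar> powr 2) \<partial>gauss_space)"
      unfolding * R_def using k(2) by (intro nn_integral_cong) (subst phase_radial, auto simp: const)
    finally show "(\<integral>\<^sup>+ y. ennreal (cmod (u f y - u g y) powr q) \<partial>?Y) = ennreal (Lp_int M 2 (\<lambda>x. f x - g x))"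
      by (simp only: \<gamma>_dist[OF f g])
    have fg: "(\<lambda>x. f x + g x) \<in> Lp_space M 2" by (intro Lp_space_add f g) simp
    note [measurable] = u_m[OF fg]
    show "AE y in ?Y. u (\<lambda>x. f x + g x) y = u f y * u g y"
    proof (rule Y.AE_pair_measure)
      show "{y \<in> space ?Y. u (\<lambda>x. f x + g x) y = u f y * u g y} \<in> sets ?Y" by measurable
      show "AE \<omega> in gauss_space. AE t in R. u (\<lambda>x. f x + g x) (\<omega>, t) = u f (\<omega>, t) * u g (\<omega>, t)"
        using \<gamma>_add[OF f g] by eventually_elim (simp add: u_def cis_mult distrib_left)
    qed
  next
    fix P s assume P: "Lp_linear_isometry M 2 P" and s: "snd ` set s \<subseteq> Lp_space M 2" "weight s = 0"
    have PL: "P f \<in> Lp_space M 2" if "f \<in> Lp_space M 2" for f by (rule linear_isometry_Lp[OF P that])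
    \<comment> \<open>The moment argument needs a probability space, so \<open>t\<close> is fixed
      and the Gaussian integral is taken first.\<close>
    have swap: "(\<integral>\<^sup>+ y. ennreal (cmod (comb u (map (apsnd A) s) y) powr q) \<partial>?Y)
       = (\<integral>\<^sup>+ t. (\<integral>\<^sup>+ \<omega>. ennreal (cmod (comb (\<lambda>f \<omega>. cis (t * \<gamma> (A f) \<omega>)) s \<omega>) powr q) \<partial>gauss_space) \<partial>R)"
      if A: "\<And>f. f \<in> Lp_space M 2 \<Longrightarrow> A f \<in> Lp_space M 2" for A
    proof -
      have [measurable]: "comb u (map (apsnd A) s) \<in> borel_measurable ?Y"
        using A s by (intro comb_measurable u_m) auto
      have "(\<integral>\<^sup>+ t. (\<integral>\<^sup>+ \<omega>. ennreal (cmod (comb u (map (apsnd A) s) (\<omega>, t)) powr q) \<partial>gauss_space) \<partial>R)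
          = (\<integral>\<^sup>+ y. ennreal (cmod (comb u (map (apsnd A) s) y) powr q) \<partial>?Y)"
        by (rule Y.nn_integral_snd) measurable
      then show ?thesis by (simp only: comb_u)
    qed
    \<comment> \<open>The mean depends on \<open>A f\<close> through its norm only. So
      \<open>P\<close> and the identity give random characters with the same mean, although
      \<open>\<gamma>\<close> itself is not invariant under \<open>P\<close>.\<close>
    have char: "random_character gauss_space (Lp_space M 2) (\<lambda>f \<omega>. cis (t * \<gamma> (A f) \<omega>))
        (\<lambda>f. complex_of_real (exp (- (t\<^sup>2 * Lp_int M 2 f) / 2)))"
      if A: "Lp_linear_isometry M 2 A" for A t
    proof
      note AL = linear_isometry_Lp[OF A]
      show "(\<lambda>x. 0) \<in> Lp_space M 2" by simp
      show "(\<lambda>x. - f x) \<in> Lp_space M 2" if "f \<in> Lp_space M 2" for f by (rule Lp_space_uminus[OF that])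
      show "(\<lambda>\<omega>. cis (t * \<gamma> (A f) \<omega>)) \<in> borel_measurable gauss_space" if "f \<in> Lp_space M 2" for f
        using \<gamma>_m[OF AL[OF that]] by measurable
      show "cmod (cis (t * \<gamma> (A f) \<omega>)) = 1" for f \<omega> by simp
      show "(\<integral>\<omega>. cis (t * \<gamma> (A f) \<omega>) \<partial>gauss_space) = complex_of_real (exp (- (t\<^sup>2 * Lp_int M 2 f) / 2))"
        if "f \<in> Lp_space M 2" for f
        using \<gamma>_char[OF AL[OF that]] linear_isometry_int[OF _ A that] by simp
      fix f g assume f: "f \<in> Lp_space M 2" and g: "g \<in> Lp_space M 2"
      show fg: "(\<lambda>x. f x + g x) \<in> Lp_space M 2" by (intro Lp_space_add f g) simp
      have Afg: "(\<lambda>x. A f x + A g x) \<in> Lp_space M 2" by (intro Lp_space_add AL f g) simp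
      note [measurable] = \<gamma>_m[OF Afg] \<gamma>_m[OF AL[OF fg]]
      \<comment> \<open>\<open>A\<close> is additive only up to null sets;
        \<open>\<gamma>_dist\<close> shows that \<open>\<gamma>\<close> does not notice.\<close>
      have "Lp_int M 2 (\<lambda>x. A (\<lambda>x. f x + g x) x - (A f x + A g x)) = Lp_int M 2 (\<lambda>x. 0)"
        by (rule Lp_int_cong_AE) (use linear_isometry_add[OF A f g] in \<open>eventually_elim, simp\<close>)
      then have "(\<integral>\<^sup>+ \<omega>. ennreal (\<bar>\<gamma> (A (\<lambda>x. f x + g x)) \<omega> - \<gamma> (\<lambda>x. A f x + A g x) \<omega>\<bar> powr 2) \<partial>gauss_space) = 0"
        using \<gamma>_dist[OF AL[OF fg] Afg] by simp
      then have "AE \<omega> in gauss_space. \<gamma> (A (\<lambda>x. f x + g x)) \<omega> = \<gamma> (\<lambda>x. A f x + A g x) \<omega>"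
        by (subst (asm) nn_integral_0_iff_AE) auto
      then show "AE \<omega> in gauss_space. cis (t * \<gamma> (A (\<lambda>x. f x + g x)) \<omega>) = cis (t * \<gamma> (A f) \<omega>) * cis (t * \<gamma> (A g) \<omega>)"
        using \<gamma>_add[OF AL[OF f] AL[OF g]] by eventually_elim (simp add: cis_mult distrib_left)
    qed
    have "(\<integral>\<^sup>+ y. ennreal (cmod (comb u (map (apsnd P) s) y) powr q) \<partial>?Y)
        = (\<integral>\<^sup>+ y. ennreal (cmod (comb u (map (apsnd (\<lambda>f. f)) s) y) powr q) \<partial>?Y)"
      using q by (subst (1 2) swap)
        (auto intro!: nn_integral_cong PL random_character_norm_eq[OF char[OF P] char[OF linear_isometry_ident] s(1)])
    moreover have "map (apsnd (\<lambda>f. f)) s = s" by (induction s) auto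
    ultimately show "Lp_int ?Y q (comb u (map (apsnd P) s)) = Lp_int ?Y q (comb u s)"
      by (simp only: Lp_int_def)
  qed
  then show ?thesis by (rule Lp_phase.real_embedding)
qed

lemma Lp_embedding_exists:
  fixes M :: "'a::polish_space measure"
  assumes M: "standard_measure_space M" and p: "0 < p" "p < q"
  shows "\<exists>(N :: real measure) E. standard_measure_space N \<and> Lp_embedding M p N q E"
proof (cases "p = 2")
  case True
  then show ?thesis using L2_embedding[OF M] p by simp
next
  case False
  obtain D :: "nat \<Rightarrow> 'a \<Rightarrow> complex" where D: "\<And>n. D n \<in> Lp_space M p"
    "\<And>f e. f \<in> Lp_space M p \<Longrightarrow> 0 < e \<Longrightarrow> \<exists>n. Lp_int M p (\<lambda>x. D n x - f x) < e"
    using Lp_separable[OF M p(1)] by blast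
  obtain W :: "(real \<times> real) measure" and z where W: "sigma_finite_measure W" "z \<in> borel_measurable W"
    "\<And>\<phi> h. \<phi> \<in> borel_measurable borel \<Longrightarrow> \<phi> 0 = 0 \<Longrightarrow>
       (\<integral>\<^sup>+ \<omega>. \<phi> (z \<omega> * h) \<partial>W) = ennreal (cmod h powr p) * (\<integral>\<^sup>+ \<omega>. \<phi> (z \<omega>) \<partial>W)"
    "(\<integral>\<^sup>+ \<omega>. ennreal (cmod (cis (Re (z \<omega>)) - 1) powr q) \<partial>W) = 1"
    by (rule complex_homogeneous_measure[OF p]) (rule that)
  interpret M: sigma_finite_measure M using M by (simp add: standard_measure_space_def)
  interpret W: sigma_finite_measure W by fact
  interpret Lp_homogeneous M W p q z
    by unfold_locales (use p False W in auto)
  have "Lp_phase M p (M \<Otimes>\<^sub>M W) q u D"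
    by unfold_locales (use u_add u_linear_isometry D in auto)
  then show ?thesis by (rule Lp_phase.real_embedding)
qed

theorem theoremA:
  fixes G :: "('g, 'm) monoid_scheme" and T :: "'g topology"
    and M :: "'a::polish_space measure" and p q :: real
    and \<alpha> :: "'g \<Rightarrow> ('a \<Rightarrow> complex) \<Rightarrow> ('a \<Rightarrow> complex)"
  assumes "topological_group G T"
    and "0 < p" and "p < q"
    and "standard_measure_space M"
    and "cont_affine_isometric_action G T M p \<alpha>"
  shows "\<exists>(N :: real measure) \<beta>. standard_measure_space N \<and>
           cont_affine_isometric_action G T N q \<beta> \<and>
           (\<forall>g\<in>carrier G. Lp_int M p (\<alpha> g (\<lambda>x. 0)) = Lp_int N q (\<beta> g (\<lambda>x. 0)))"
proof -
  obtain N :: "real measure" and E where N: "standard_measure_space N" "Lp_embedding M p N q E"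
    using Lp_embedding_exists[OF assms(4,2,3)] by blast
  have "group G" "topspace T = carrier G"
    using assms(1) by (auto simp: topological_group_def)
  from Lp_embedding.lifted_action[OF N(2) this assms(5)] N(1) show ?thesis by blast
qed

end
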